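(* Let $G$ be a finitely presented group with bounded finite subgroups that acts minimally, acylindrically and non-elementarily on a tree $T$. (a) If all vertex stabilisers of the action of $G$ on $T$ are locally finite height, then $G$ admits a non-elementary finite height acylindrical splitting with finitely generated edge stabilisers that dominates the action of $G$ on $T$. Consequently, assuming the statement (C) "for every hyperbolic group $K$, every finitely generated subgroup of $K$ that has finite height in $K$ is quasi-convex in $K$", if $G$ is moreover hyperbolic then $G$ admits a quasi-convex splitting that dominates the action of $G$ on $T$. (b) If there exists an edge $e$ of $T$ whose stabiliser $G_e$ has finite height in $G$ and is locally finite height, then $G$ admits a non-elementary finite height acylindrical splitting with finitely generated edge stabilisers. Furthermore, if every edge stabiliser of the action of $G$ on $T$ satisfies this condition (has finite height in $G$ and is locally finite height), then the new splitting may be chosen to dominate the action of $G$ on $T$; and consequently in this case, assuming statement (C), if $G$ is moreover hyperbolic then $G$ admits a quasi-convex splitting that dominates the action of $G$ on $T$.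
   Context: All trees are simplicial and all actions on trees are by simplicial isometries without inversions. A splitting of a group $G$ is a graph of groups decomposition of $G$, equivalently (via Bass--Serre theory) an action of $G$ on a tree. Stabiliser of a vertex or edge means its stabiliser in the acting group. The action of $G$ on $T$ is minimal if there is no proper subtree of $T$ preserved setwise by $G$. For integers $k\ge 0$, $C>0$ it is $(k,C)$-acylindrical if the pointwise stabiliser of any edge path in $T$ of length at least $k$ contains at most $C$ elements; it is acylindrical if it is $(k,C)$-acylindrical for some $k,C$. An acylindrical action is non-elementary if it has no global fixed point and does not fix any bi-infinite geodesic setwise. A group $G$ has bounded finite subgroups if there is a natural number $M$ such that $|F|<M$ for every finite subgroup $F\le G$. Let $H\le G$. Conjugates $g_1Hg_1^{-1}$ and $g_2Hg_2^{-1}$ are essentially distinct if $g_1H\ne g_2H$. $H$ has height at most $n$ in $G$ if the intersection of any collection of at least $n$ essentially distinct conjugates of $H$ is finite; the height $h_G(H)$ is the least such $n$, or $\infty$ if none exists. $H$ has finite height in $G$ if $h_G(H)<\infty$. A group is locally finite height if each of its finitely generated subgroups has finite height in it. An action of $G$ on a tree is a finite height splitting if every edge stabiliser has finite height in $G$. A non-elementary finite height acylindrical splitting is an action on a tree that is a finite height splitting, acylindrical and non-elementary. A subgroup $H$ of a hyperbolic group $G$ is quasi-convex if it is finitely generated and the inclusion $H\hookrightarrow G$ is a quasi-isometric embedding for word metrics of finite generating sets. An action of a hyperbolic group $G$ on a tree is a quasi-convex splitting if every edge stabiliser is quasi-convex in $G$. An action of $G$ on a tree $T'$ dominates an action of $G$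 on a tree $T$ if there is a $G$-equivariant graph epimorphism (surjective graph morphism, sending vertices to vertices and edges to edges) $\phi: T'\to T$. *)

theory Defs
  imports Complex_Main "HOL-Library.Extended_Nat" "HOL-Algebra.Generated_Groups"
    "HOL-Algebra.Group_Action"
begin

section \<open>Finiteness conditions on groups\<close>

text \<open>The letter \<open>(x, True)\<close> stands for the generator \<open>x\<close>, the letter \<open>(x, False)\<close> for its
  formal inverse.\<close>

definition words :: "'x set \<Rightarrow> ('x \<times> bool) list set" where
  "words X = lists (X \<times> UNIV)"

text \<open>The congruence on words generated by free cancellation and by the relators.\<close>

inductive_set pres_rel ::
  "'x set \<Rightarrow> ('x \<times> bool) list set \<Rightarrow> (('x \<times> bool) list \<times> ('x \<times> bool) list) set"
  for X R where
  refl: "w \<in> words X \<Longrightarrow> (w, w) \<in> pres_rel X R"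
| sym: "(v, w) \<in> pres_rel X R \<Longrightarrow> (w, v) \<in> pres_rel X R"
| trans: "(u, v) \<in> pres_rel X R \<Longrightarrow> (v, w) \<in> pres_rel X R \<Longrightarrow> (u, w) \<in> pres_rel X R"
| cancel: "u \<in> words X \<Longrightarrow> v \<in> words X \<Longrightarrow> x \<in> X \<Longrightarrow>
    (u @ [(x, b), (x, \<not> b)] @ v, u @ v) \<in> pres_rel X R"
| relator: "u \<in> words X \<Longrightarrow> v \<in> words X \<Longrightarrow> r \<in> R \<Longrightarrow> (u @ r @ v, u @ v) \<in> pres_rel X R"

definition presented_group :: "'x set \<Rightarrow> ('x \<times> bool) list set \<Rightarrow> ('x \<times> bool) list set monoid" where
  "presented_group X R =
    \<lparr>carrier = words X // pres_rel X R,
     mult = (\<lambda>A B. \<Union>a\<in>A. \<Union>b\<in>B. pres_rel X R `` {a @ b}),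
     one = pres_rel X R `` {[]}\<rparr>"

definition finitely_presented :: "('g, 'b) monoid_scheme \<Rightarrow> bool" where
  "finitely_presented G \<longleftrightarrow> group G \<and>
    (\<exists>(X :: nat set) R. finite X \<and> finite R \<and> R \<subseteq> words X \<and> G \<cong> presented_group X R)"

definition finite_generating_set :: "('g, 'b) monoid_scheme \<Rightarrow> 'g set \<Rightarrow> bool" where
  "finite_generating_set G S \<longleftrightarrow> finite S \<and> S \<subseteq> carrier G \<and> generate G S = carrier G"

definition finitely_generated :: "('g, 'b) monoid_scheme \<Rightarrow> bool" where
  "finitely_generated G \<longleftrightarrow> group G \<and> (\<exists>S. finite_generating_set G S)"

definition fg_subgroup :: "'g set \<Rightarrow> ('g, 'b) monoid_scheme \<Rightarrow> bool" where
  "fg_subgroup H G \<longleftrightarrow> subgroup H G \<and> finitely_generated (G\<lparr>carrier := H\<rparr>)"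

definition bounded_finite_subgroups :: "('g, 'b) monoid_scheme \<Rightarrow> bool" where
  "bounded_finite_subgroups G \<longleftrightarrow> (\<exists>M::nat. \<forall>F. subgroup F G \<and> finite F \<longrightarrow> card F < M)"


section \<open>Height\<close>

text \<open>A collection of essentially distinct conjugates of \<open>H\<close> is given by a set \<open>A\<close> of conjugating
  elements whose left cosets \<open>a H\<close> are pairwise distinct; it may be infinite. The intersection is
  taken inside \<open>carrier G\<close>, so that of the empty collection (relevant only to \<open>n = 0\<close>)
  is the whole group.\<close>

definition height_at_most :: "('g, 'b) monoid_scheme \<Rightarrow> 'g set \<Rightarrow> nat \<Rightarrow> bool" where
  "height_at_most G H n \<longleftrightarrow>
    (\<forall>A \<subseteq> carrier G. inj_on (\<lambda>a. a <#\<^bsub>G\<^esub> H) A \<and> (infinite A \<or> n \<le> card A) \<longrightarrow>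
       finite {x \<in> carrier G. \<forall>a\<in>A. x \<in> a <#\<^bsub>G\<^esub> H #>\<^bsub>G\<^esub> inv\<^bsub>G\<^esub> a})"

text \<open>The infimum of the empty set in \<open>enat\<close> is \<open>\<infinity>\<close>.\<close>

definition height :: "('g, 'b) monoid_scheme \<Rightarrow> 'g set \<Rightarrow> enat" where
  "height G H = Inf (enat ` {n. height_at_most G H n})"

definition finite_height :: "('g, 'b) monoid_scheme \<Rightarrow> 'g set \<Rightarrow> bool" where
  "finite_height G H \<longleftrightarrow> height G H < \<infinity>"

definition locally_finite_height :: "('g, 'b) monoid_scheme \<Rightarrow> bool" where
  "locally_finite_height G \<longleftrightarrow> (\<forall>H. fg_subgroup H G \<longrightarrow> finite_height G H)"


section \<open>Hyperbolic groups and quasi-convex subgroups\<close>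

definition word_dist :: "('g, 'b) monoid_scheme \<Rightarrow> 'g set \<Rightarrow> 'g \<Rightarrow> 'g \<Rightarrow> nat" where
  "word_dist G S x y =
    (LEAST n. \<exists>w \<in> lists (S \<union> m_inv G ` S).
       length w = n \<and> foldr (\<otimes>\<^bsub>G\<^esub>) w \<one>\<^bsub>G\<^esub> = inv\<^bsub>G\<^esub> x \<otimes>\<^bsub>G\<^esub> y)"

definition gromov_product :: "('a \<Rightarrow> 'a \<Rightarrow> nat) \<Rightarrow> 'a \<Rightarrow> 'a \<Rightarrow> 'a \<Rightarrow> real" where
  "gromov_product d w x y = (real (d w x) + real (d w y) - real (d x y)) / 2"

definition gromov_hyperbolic_on :: "'a set \<Rightarrow> ('a \<Rightarrow> 'a \<Rightarrow> nat) \<Rightarrow> bool" where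
  "gromov_hyperbolic_on A d \<longleftrightarrow>
    (\<exists>\<delta>. \<forall>w\<in>A. \<forall>x\<in>A. \<forall>y\<in>A. \<forall>z\<in>A.
       min (gromov_product d w x y) (gromov_product d w y z) - \<delta> \<le> gromov_product d w x z)"

definition hyperbolic_group :: "('g, 'b) monoid_scheme \<Rightarrow> bool" where
  "hyperbolic_group G \<longleftrightarrow> group G \<and>
    (\<exists>S. finite_generating_set G S \<and> gromov_hyperbolic_on (carrier G) (word_dist G S))"

definition quasi_isometric_embedding_on ::
  "'a set \<Rightarrow> ('a \<Rightarrow> 'a \<Rightarrow> nat) \<Rightarrow> ('b \<Rightarrow> 'b \<Rightarrow> nat) \<Rightarrow> ('a \<Rightarrow> 'b) \<Rightarrow> bool" where
  "quasi_isometric_embedding_on A d d' f \<longleftrightarrow>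
    (\<exists>L c :: real. L \<ge> 1 \<and> c \<ge> 0 \<and>
      (\<forall>x\<in>A. \<forall>y\<in>A. real (d x y) / L - c \<le> real (d' (f x) (f y)) \<and>
                   real (d' (f x) (f y)) \<le> L * real (d x y) + c))"

text \<open>Word metrics of two finite generating sets are bi-Lipschitz equivalent, so the choice of
  generating sets here and in \<open>hyperbolic_group\<close> is immaterial.\<close>

definition quasi_convex :: "('g, 'b) monoid_scheme \<Rightarrow> 'g set \<Rightarrow> bool" where
  "quasi_convex G H \<longleftrightarrow> fg_subgroup H G \<and>
    (\<exists>S X. finite_generating_set (G\<lparr>carrier := H\<rparr>) S \<and> finite_generating_set G X \<and>
       quasi_isometric_embedding_on H (word_dist (G\<lparr>carrier := H\<rparr>) S) (word_dist G X) id)"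

text \<open>A hyperbolic group is finitely generated, hence countable, hence isomorphic to a group
  whose elements are natural numbers. The quantifier over \<open>nat monoid\<close> therefore ranges over all
  hyperbolic groups up to isomorphism.\<close>

definition finite_height_imp_quasi_convex :: bool where
  "finite_height_imp_quasi_convex \<longleftrightarrow>
    (\<forall>K :: nat monoid. hyperbolic_group K \<longrightarrow>
      (\<forall>H. fg_subgroup H K \<and> finite_height K H \<longrightarrow> quasi_convex K H))"


section \<open>Simplicial trees\<close>

text \<open>A simplicial graph is a set \<open>V\<close> of vertices with a set \<open>E\<close> of edges, which are two-element
  subsets of \<open>V\<close>. Edge paths are recorded by their vertices; the length of \<open>p\<close> is
  \<open>length p - 1\<close>.\<close>

definition edge_path :: "'v set \<Rightarrow> 'v set set \<Rightarrow> 'v list \<Rightarrow> bool" where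
  "edge_path V E p \<longleftrightarrow> p \<noteq> [] \<and> set p \<subseteq> V \<and> successively (\<lambda>u v. {u, v} \<in> E) p"

definition simplicial_graph :: "'v set \<Rightarrow> 'v set set \<Rightarrow> bool" where
  "simplicial_graph V E \<longleftrightarrow> (\<forall>e\<in>E. e \<subseteq> V \<and> card e = 2)"

definition graph_connected :: "'v set \<Rightarrow> 'v set set \<Rightarrow> bool" where
  "graph_connected V E \<longleftrightarrow> (\<forall>u\<in>V. \<forall>v\<in>V. \<exists>p. edge_path V E p \<and> hd p = u \<and> last p = v)"

definition graph_cycle :: "'v set \<Rightarrow> 'v set set \<Rightarrow> 'v list \<Rightarrow> bool" where
  "graph_cycle V E p \<longleftrightarrow> edge_path V E p \<and> distinct p \<and> length p \<ge> 3 \<and> {last p, hd p} \<in> E"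

definition is_tree :: "'v set \<Rightarrow> 'v set set \<Rightarrow> bool" where
  "is_tree V E \<longleftrightarrow> V \<noteq> {} \<and> simplicial_graph V E \<and> graph_connected V E \<and> (\<nexists>p. graph_cycle V E p)"

definition graph_dist :: "'v set \<Rightarrow> 'v set set \<Rightarrow> 'v \<Rightarrow> 'v \<Rightarrow> nat" where
  "graph_dist V E u v =
    (LEAST n. \<exists>p. edge_path V E p \<and> hd p = u \<and> last p = v \<and> length p = Suc n)"

definition bi_infinite_geodesic :: "'v set \<Rightarrow> 'v set set \<Rightarrow> (int \<Rightarrow> 'v) \<Rightarrow> bool" where
  "bi_infinite_geodesic V E \<gamma> \<longleftrightarrow>
    range \<gamma> \<subseteq> V \<and> (\<forall>i j. int (graph_dist V E (\<gamma> i) (\<gamma> j)) = \<bar>i - j\<bar>)"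


section \<open>Actions on trees\<close>

locale tree_action = group_action G V \<phi>
  for G :: "('g, 'b) monoid_scheme" (structure) and V :: "'v set" and E :: "'v set set"
    and \<phi> :: "'g \<Rightarrow> 'v \<Rightarrow> 'v" +
  assumes tree: "is_tree V E"
    and edge_closed: "g \<in> carrier G \<Longrightarrow> e \<in> E \<Longrightarrow> \<phi> g ` e \<in> E"
    and no_inversion: "g \<in> carrier G \<Longrightarrow> {u, v} \<in> E \<Longrightarrow> \<not> (\<phi> g u = v \<and> \<phi> g v = u)"

abbreviation vertex_stab :: "('g, 'b) monoid_scheme \<Rightarrow> ('g \<Rightarrow> 'v \<Rightarrow> 'v) \<Rightarrow> 'v \<Rightarrow> 'g set" where
  "vertex_stab G \<phi> v \<equiv> stabilizer G \<phi> v"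

abbreviation edge_stab :: "('g, 'b) monoid_scheme \<Rightarrow> ('g \<Rightarrow> 'v \<Rightarrow> 'v) \<Rightarrow> 'v set \<Rightarrow> 'g set" where
  "edge_stab G \<phi> e \<equiv> stabilizer G (\<lambda>g. image (\<phi> g)) e"

definition minimal_action ::
  "('g, 'b) monoid_scheme \<Rightarrow> 'v set \<Rightarrow> 'v set set \<Rightarrow> ('g \<Rightarrow> 'v \<Rightarrow> 'v) \<Rightarrow> bool" where
  "minimal_action G V E \<phi> \<longleftrightarrow>
    (\<forall>V' E'. V' \<subseteq> V \<and> E' \<subseteq> E \<and> is_tree V' E' \<and>
       (\<forall>g\<in>carrier G. \<phi> g ` V' = V' \<and> (\<lambda>e. \<phi> g ` e) ` E' = E') \<longrightarrow> V' = V \<and> E' = E)"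

text \<open>The edge paths in question are the embedded ones (equivalently, in a tree, the geodesic
  ones): for paths with backtracking the condition would just bound all edge stabilisers.\<close>

definition kC_acylindrical ::
  "('g, 'b) monoid_scheme \<Rightarrow> 'v set \<Rightarrow> 'v set set \<Rightarrow> ('g \<Rightarrow> 'v \<Rightarrow> 'v) \<Rightarrow> nat \<Rightarrow> nat \<Rightarrow> bool" where
  "kC_acylindrical G V E \<phi> k C \<longleftrightarrow>
    (\<forall>p. edge_path V E p \<and> distinct p \<and> length p - 1 \<ge> k \<longrightarrow>
       finite {g \<in> carrier G. \<forall>v\<in>set p. \<phi> g v = v} \<and>
       card {g \<in> carrier G. \<forall>v\<in>set p. \<phi> g v = v} \<le> C)"

definition acylindrical ::
  "('g, 'b) monoid_scheme \<Rightarrow> 'v set \<Rightarrow> 'v set set \<Rightarrow> ('g \<Rightarrow> 'v \<Rightarrow> 'v) \<Rightarrow> bool" where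
  "acylindrical G V E \<phi> \<longleftrightarrow> (\<exists>k C. C > 0 \<and> kC_acylindrical G V E \<phi> k C)"

text \<open>Since actions are without inversions, a global fixed point in the geometric realisation
  exists if and only if a vertex is fixed.\<close>

definition non_elementary ::
  "('g, 'b) monoid_scheme \<Rightarrow> 'v set \<Rightarrow> 'v set set \<Rightarrow> ('g \<Rightarrow> 'v \<Rightarrow> 'v) \<Rightarrow> bool" where
  "non_elementary G V E \<phi> \<longleftrightarrow>
    \<not> (\<exists>v\<in>V. \<forall>g\<in>carrier G. \<phi> g v = v) \<and>
    \<not> (\<exists>\<gamma>. bi_infinite_geodesic V E \<gamma> \<and> (\<forall>g\<in>carrier G. \<phi> g ` range \<gamma> = range \<gamma>))"

definition finite_height_splitting ::
  "('g, 'b) monoid_scheme \<Rightarrow> 'v set \<Rightarrow> 'v set set \<Rightarrow> ('g \<Rightarrow> 'v \<Rightarrow> 'v) \<Rightarrow> bool" where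
  "finite_height_splitting G V E \<phi> \<longleftrightarrow>
    tree_action G V E \<phi> \<and> (\<forall>e\<in>E. finite_height G (edge_stab G \<phi> e))"

definition nonelem_fh_acyl_splitting ::
  "('g, 'b) monoid_scheme \<Rightarrow> 'v set \<Rightarrow> 'v set set \<Rightarrow> ('g \<Rightarrow> 'v \<Rightarrow> 'v) \<Rightarrow> bool" where
  "nonelem_fh_acyl_splitting G V E \<phi> \<longleftrightarrow>
    finite_height_splitting G V E \<phi> \<and> acylindrical G V E \<phi> \<and> non_elementary G V E \<phi>"

definition fg_edge_stabs ::
  "('g, 'b) monoid_scheme \<Rightarrow> 'v set set \<Rightarrow> ('g \<Rightarrow> 'v \<Rightarrow> 'v) \<Rightarrow> bool" where
  "fg_edge_stabs G E \<phi> \<longleftrightarrow> (\<forall>e\<in>E. fg_subgroup (edge_stab G \<phi> e) G)"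

definition quasi_convex_splitting ::
  "('g, 'b) monoid_scheme \<Rightarrow> 'v set \<Rightarrow> 'v set set \<Rightarrow> ('g \<Rightarrow> 'v \<Rightarrow> 'v) \<Rightarrow> bool" where
  "quasi_convex_splitting G V E \<phi> \<longleftrightarrow>
    tree_action G V E \<phi> \<and> (\<forall>e\<in>E. quasi_convex G (edge_stab G \<phi> e))"

text \<open>The action on the tree \<open>(V', E')\<close> dominates the action on the tree \<open>(V, E)\<close>. Edges having
  two elements, the conditions on edges say that no edge is collapsed.\<close>

definition dominates ::
  "('g, 'b) monoid_scheme \<Rightarrow> 'w set \<Rightarrow> 'w set set \<Rightarrow> ('g \<Rightarrow> 'w \<Rightarrow> 'w) \<Rightarrow>
    'v set \<Rightarrow> 'v set set \<Rightarrow> ('g \<Rightarrow> 'v \<Rightarrow> 'v) \<Rightarrow> bool" where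
  "dominates G V' E' \<phi>' V E \<phi> \<longleftrightarrow>
    (\<exists>f. f ` V' = V \<and> (\<lambda>e. f ` e) ` E' = E \<and>
       (\<forall>g\<in>carrier G. \<forall>v\<in>V'. f (\<phi>' g v) = \<phi> g (f v)))"

text \<open>HOL cannot quantify existentially over types, so the existence of a tree with a certain
  action of a countable group \<open>G\<close> has to be stated for a fixed type of vertices, and \<open>nat\<close> is large
  enough. Given a tree \<open>T'\<close> with an action of \<open>G\<close>, the orbits of countably many vertices span
  a countable \<open>G\<close>-invariant subtree, and passing to an invariant subtree preserves
  acylindricity, non-elementarity and every condition on edge stabilisers. If \<open>T'\<close> dominates
  a countable tree \<open>T\<close>, then the subtree can be chosen so that it still surjects onto \<open>T\<close>.
  A minimal \<open>G\<close>-tree without global fixed points is countable.\<close>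

end

theory Submission
  imports Defs "HOL-Algebra.Weak_Morphisms"
begin

text \<open>Let \<open>S\<close> be a ball of \<open>G\<close> that contains the values of all prefixes of the relators, and let
  \<open>F\<close> be a finite subtree of \<open>T\<close> that contains \<open>v0\<close> and \<open>S v0\<close>. Glue the copies \<open>gF\<close>, for \<open>g\<close> in
  \<open>G\<close>, along the intersections \<open>gF \<inter> gsF\<close> with \<open>s \<in> S\<close> only. The result \<open>T'\<close> maps to \<open>T\<close>; a
  vertex of \<open>T'\<close> over \<open>y\<close> is a connected component of \<open>{g. y \<in> gF}\<close> in the Cayley graph of \<open>S\<close>.
  A connected graph is a tree if and only if each edge \<open>e\<close> has a two-colouring of the vertices which
  changes exactly across \<open>e\<close>. For \<open>T'\<close> the obstruction to such a colouring is a \<open>\<int>/2\<close>-cocycle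
  on the Rips complex of \<open>S\<close>, and this complex is simply connected because \<open>G\<close> is finitely
  presented. Edge stabilisers of \<open>T'\<close> act cofinitely on connected subgraphs of the Cayley graph,
  so they are finitely generated.

  Since \<open>T'\<close> has finitely many orbits of edges, the finite height assumptions bound the number of
  edges of \<open>T'\<close> fixed by an infinite subset of \<open>G\<close>. This gives finite height of the edge
  stabilisers and, because finite subgroups are bounded, acylindricity. An invariant line in \<open>T'\<close>
  would make \<open>G\<close> virtually cyclic, so that all its actions on trees would be elementary. If only one
  edge of \<open>T\<close> is controlled, the edges outside its orbit are collapsed before \<open>T'\<close> is formed.\<close>

section \<open>Edge cuts in trees\<close>

text \<open>Gluing along all intersections would only return the part of \<open>T\<close> covered by
  the copies, whose edge stabilisers are beyond control. Gluing along \<open>S\<close> replaces an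
  edge by one \<open>S\<close>-connected piece of \<open>G\<close>. The price is that acyclicity has
  to be proved again; two-colourings suit this because, unlike cycles, they descend to quotients and
  restrict to subgraphs.

  The map from \<open>T'\<close> to \<open>T\<close> may fold, so an invariant line of
  \<open>T'\<close> need not have a line as its image. This is why non-elementarity is transferred
  through an algebraic property of \<open>G\<close>. The same detour serves the collapsed case: the
  collapsed tree is only known to have no fixed vertex, and the contradiction is found in the
  original \<open>T\<close>.

  Under the hypothesis on vertex stabilisers, height controls just the fixed edges over one star of
  \<open>T\<close>. Acylindricity of \<open>T\<close> then confines the image of a fixed subtree to
  a ball of radius less than \<open>k\<close>, so that a geometric sum bounds the number of fixed
  edges.\<close>

fun path_edges :: "'v list \<Rightarrow> 'v set set" where
  "path_edges (x # y # p) = insert {x, y} (path_edges (y # p))"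
| "path_edges p = {}"

abbreviation adjacency :: "'v set set \<Rightarrow> ('v \<times> 'v) set" where
  "adjacency E \<equiv> {(u, v). {u, v} \<in> E}"

definition is_cut :: "'v set set \<Rightarrow> 'v set \<Rightarrow> ('v \<Rightarrow> bool) \<Rightarrow> bool" where
  "is_cut E e \<sigma> \<longleftrightarrow> (\<forall>x y. {x, y} \<in> E \<longrightarrow> (\<sigma> x \<noteq> \<sigma> y \<longleftrightarrow> {x, y} = e))"

section \<open>Edge paths and the edges they cross\<close>

lemma edge_path_Cons:
  "edge_path V E (x # p) \<longleftrightarrow> x \<in> V \<and> (p = [] \<or> {x, hd p} \<in> E \<and> edge_path V E p)"
  by (cases p) (auto simp: edge_path_def)

lemma edge_path_append:
  "p \<noteq> [] \<Longrightarrow> q \<noteq> [] \<Longrightarrow>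
    edge_path V E (p @ q) \<longleftrightarrow> edge_path V E p \<and> edge_path V E q \<and> {last p, hd q} \<in> E"
  by (auto simp: edge_path_def successively_append_iff)

lemma path_edges_Cons: "p \<noteq> [] \<Longrightarrow> path_edges (x # p) = insert {x, hd p} (path_edges p)"
  by (cases p) auto

lemma path_edges_append:
  "p \<noteq> [] \<Longrightarrow> q \<noteq> [] \<Longrightarrow>
    path_edges (p @ q) = path_edges p \<union> {{last p, hd q}} \<union> path_edges q"
proof (induction p)
  case (Cons a p)
  then show ?case by (cases "p = []") (auto simp: path_edges_Cons)
qed auto

lemma path_edges_subset_set: "e \<in> path_edges p \<Longrightarrow> e \<subseteq> set p"
  by (induction p rule: path_edges.induct) auto

lemma finite_path_edges: "finite (path_edges p)"
  by (induction p rule: path_edges.induct) auto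

lemma card_path_edges_le: "card (path_edges p) \<le> length p - 1"
  by (induction p rule: path_edges.induct) (auto simp: card_insert_if finite_path_edges)

lemma card_path_edges: "distinct p \<Longrightarrow> card (path_edges p) = length p - 1"
proof (induction p rule: path_edges.induct)
  case (1 x y p)
  then have "{x, y} \<notin> path_edges (y # p)"
    using path_edges_subset_set by (metis distinct.simps(2) insert_subset)
  then show ?case using 1 by (simp add: finite_path_edges)
qed auto

lemma path_edges_subset: "edge_path V E p \<Longrightarrow> path_edges p \<subseteq> E"
  by (induction p rule: path_edges.induct) (auto simp: edge_path_Cons)

lemma edge_path_imp_rtrancl:
  "edge_path V E p \<Longrightarrow> (hd p, last p) \<in> (adjacency E)\<^sup>*"
proof (induction p)
  case (Cons x p)
  show ?case
  proof (cases "p = []")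
    case False
    then have "(x, hd p) \<in> adjacency E" "(hd p, last p) \<in> (adjacency E)\<^sup>*"
      using Cons by (auto simp: edge_path_Cons)
    then show ?thesis using False by (auto intro: converse_rtrancl_into_rtrancl)
  qed auto
qed (auto simp: edge_path_def)

lemma rtrancl_imp_edge_path:
  assumes "(u, v) \<in> (adjacency E)\<^sup>*" "v \<in> V" "simplicial_graph V E"
  shows "\<exists>p. edge_path V E p \<and> hd p = u \<and> last p = v"
  using assms(1)
proof (induction rule: converse_rtrancl_induct)
  case base
  then show ?case using assms(2) by (intro exI[of _ "[v]"]) (auto simp: edge_path_def)
next
  case (step u w)
  then obtain p where p: "edge_path V E p" "hd p = w" "last p = v" by blast
  then have "edge_path V E (u # p)"
    using step(1) assms(3) by (auto simp: edge_path_Cons simplicial_graph_def)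
  moreover have "p \<noteq> []" using p by (auto simp: edge_path_def)
  ultimately show ?case using p by (intro exI[of _ "u # p"]) auto
qed

lemma graph_connected_iff:
  assumes "simplicial_graph V E"
  shows "graph_connected V E \<longleftrightarrow> (\<forall>u\<in>V. \<forall>v\<in>V. (u, v) \<in> (adjacency E)\<^sup>*)"
proof
  assume "graph_connected V E"
  then show "\<forall>u\<in>V. \<forall>v\<in>V. (u, v) \<in> (adjacency E)\<^sup>*"
    unfolding graph_connected_def using edge_path_imp_rtrancl by fast
next
  assume "\<forall>u\<in>V. \<forall>v\<in>V. (u, v) \<in> (adjacency E)\<^sup>*"
  then show "graph_connected V E"
    unfolding graph_connected_def using rtrancl_imp_edge_path[OF _ _ assms] by simp
qed

lemma sym_adjacency_rtrancl: "(u, v) \<in> (adjacency E)\<^sup>* \<Longrightarrow> (v, u) \<in> (adjacency E)\<^sup>*"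
proof -
  have "sym (adjacency E)" by (auto simp: sym_def insert_commute)
  then show "(u, v) \<in> (adjacency E)\<^sup>* \<Longrightarrow> (v, u) \<in> (adjacency E)\<^sup>*"
    using sym_rtrancl symD by metis
qed

lemma edge_path_distinct:
  assumes "edge_path V E p"
  shows "\<exists>q. edge_path V E q \<and> hd q = hd p \<and> last q = last p \<and> distinct q \<and> set q \<subseteq> set p"
  using assms
proof (induction p)
  case (Cons x p)
  show ?case
  proof (cases "p = []")
    case True
    then show ?thesis using Cons by (intro exI[of _ "[x]"]) auto
  next
    case False
    then obtain q where q: "edge_path V E q" "hd q = hd p" "last q = last p" "distinct q"
      "set q \<subseteq> set p" "{x, hd p} \<in> E" "x \<in> V"
      using Cons by (auto simp: edge_path_Cons)
    have "q \<noteq> []" using q by (auto simp: edge_path_def)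
    show ?thesis
    proof (cases "x \<in> set q")
      case True
      then obtain r s where rs: "q = r @ x # s" by (meson split_list)
      have "edge_path V E (x # s)"
        using q(1) rs edge_path_append[of r "x # s"] by (cases "r = []") auto
      then show ?thesis using q rs False by (intro exI[of _ "x # s"]) auto
    next
      case False
      then have "edge_path V E (x # q)" using q by (auto simp: edge_path_Cons)
      then show ?thesis using q False \<open>p \<noteq> []\<close> \<open>q \<noteq> []\<close> by (intro exI[of _ "x # q"]) auto
    qed
  qed
qed (auto simp: edge_path_def)

lemma is_cut_path:
  assumes "edge_path V E p" "is_cut E e \<sigma>" "e \<notin> path_edges p"
  shows "\<sigma> (hd p) = \<sigma> (last p)"
  using assms(1,3)
proof (induction p)
  case (Cons x p)
  then show ?case using assms(2)
    by (cases "p = []") (auto simp: edge_path_Cons path_edges_Cons is_cut_def)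
qed (auto simp: edge_path_def)

text \<open>Colour by reachability from the end \<open>a\<close> once \<open>e\<close> is deleted.
  If \<open>b\<close> were still reachable, a simple path from \<open>a\<close> to \<open>b\<close>
  avoiding \<open>e\<close> would be closed up by \<open>e\<close> to a cycle.\<close>

lemma tree_imp_cut:
  assumes "is_tree V E" "e \<in> E"
  shows "\<exists>\<sigma>. is_cut E e \<sigma>"
proof -
  have sg: "simplicial_graph V E" using assms by (simp add: is_tree_def)
  obtain a b where ab: "e = {a, b}" "a \<noteq> b" "a \<in> V" "b \<in> V"
    using sg assms(2) unfolding simplicial_graph_def by (metis card_2_iff insert_subset)
  define A where "A = adjacency (E - {e})"
  have "(a, b) \<notin> A\<^sup>*"
  proof
    assume "(a, b) \<in> A\<^sup>*"
    moreover have "simplicial_graph V (E - {e})" using sg by (auto simp: simplicial_graph_def)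
    ultimately obtain p0 where "edge_path V (E - {e}) p0" "hd p0 = a" "last p0 = b"
      using ab(4) rtrancl_imp_edge_path unfolding A_def by metis
    then obtain p where p: "edge_path V (E - {e}) p" "hd p = a" "last p = b" "distinct p"
      using edge_path_distinct by metis
    have "length p \<ge> 3"
    proof (rule ccontr)
      assume "\<not> length p \<ge> 3"
      then consider "p = []" | x where "p = [x]" | x y where "p = [x, y]"
        by (cases p rule: path_edges.cases) (auto simp: not_le less_Suc_eq)
      then show False using p ab by cases (auto simp: edge_path_def)
    qed
    moreover have "edge_path V E p"
      using p(1) unfolding edge_path_def by (auto elim: successively_mono)
    ultimately have "graph_cycle V E p"
      using p assms(2) ab by (auto simp: graph_cycle_def insert_commute)
    then show False using assms(1) by (auto simp: is_tree_def)
  qed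
  moreover have "(a, x) \<in> A\<^sup>* \<longleftrightarrow> (a, y) \<in> A\<^sup>*" if "{x, y} \<in> E - {e}" for x y
    using that unfolding A_def by (auto intro: rtrancl_into_rtrancl simp: insert_commute)
  ultimately have "is_cut E e (\<lambda>x. (a, x) \<in> A\<^sup>*)"
    unfolding is_cut_def ab(1) by (auto simp: doubleton_eq_iff)
  then show ?thesis by blast
qed

text \<open>The closing edge of a cycle is avoided by the rest of the cycle, so its two ends would
  have the same colour. Every tree below is recognised in this way.\<close>

lemma cuts_imp_tree:
  assumes "V \<noteq> {}" "simplicial_graph V E" "graph_connected V E"
    and cuts: "\<And>e. e \<in> E \<Longrightarrow> \<exists>\<sigma>. is_cut E e \<sigma>"
  shows "is_tree V E"
proof -
  have "False" if c: "graph_cycle V E p" for p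
  proof -
    have p: "edge_path V E p" "distinct p" "length p \<ge> 3" "{last p, hd p} \<in> E"
      using c by (auto simp: graph_cycle_def)
    then obtain \<sigma> where s: "is_cut E {last p, hd p} \<sigma>" using cuts by blast
    obtain x q where pq: "p = x # q" "length q \<ge> 2" using p(3) by (cases p) auto
    then obtain y z r where q: "q = y # z # r" by (cases q rule: path_edges.cases) auto
    have "{last p, hd p} \<notin> path_edges p"
    proof
      assume "{last p, hd p} \<in> path_edges p"
      then have "{last q, x} = {x, y} \<or> {last q, x} \<in> path_edges q"
        using pq q by auto
      moreover have "x \<notin> set q" "last q \<noteq> y" using p pq q by auto
      ultimately show False using path_edges_subset_set by (metis doubleton_eq_iff insert_subset)
    qed
    then have "\<sigma> (hd p) = \<sigma> (last p)" using is_cut_path p(1) s by blast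
    then show False using s p(4) by (auto simp: is_cut_def)
  qed
  then show ?thesis using assms by (auto simp: is_tree_def)
qed

locale simplicial_tree =
  fixes V :: "'v set" and E :: "'v set set"
  assumes tree: "is_tree V E"
begin

definition cut :: "'v set \<Rightarrow> 'v \<Rightarrow> bool" where
  "cut e = (SOME \<sigma>. is_cut E e \<sigma>)"

text \<open>For vertices these are the edges of the geodesic from \<open>x\<close> to
  \<open>y\<close> (\<open>walls_path\<close>). The set is independent of the choice made in
  \<open>cut\<close>, since two colourings of a tree across the same edge differ at most by a
  swap.\<close>

definition walls :: "'v \<Rightarrow> 'v \<Rightarrow> 'v set set" where
  "walls x y = {e \<in> E. cut e x \<noteq> cut e y}"

definition td :: "'v \<Rightarrow> 'v \<Rightarrow> nat" where
  "td x y = card (walls x y)"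

lemma is_cut_cut: "e \<in> E \<Longrightarrow> is_cut E e (cut e)"
  unfolding cut_def using tree_imp_cut[OF tree] by (rule someI_ex)

lemma simplicial: "simplicial_graph V E" and connected: "graph_connected V E"
  using tree by (auto simp: is_tree_def)

lemma edge_in_V: "{x, y} \<in> E \<Longrightarrow> x \<in> V \<and> y \<in> V"
  using simplicial by (auto simp: simplicial_graph_def)

lemma edge_neq: "{x, y} \<in> E \<Longrightarrow> x \<noteq> y"
  using simplicial by (auto simp: simplicial_graph_def)

lemma edge_obtain:
  assumes "e \<in> E" obtains x y where "e = {x, y}" "x \<noteq> y" "x \<in> V" "y \<in> V"
  using assms simplicial unfolding simplicial_graph_def by (metis card_2_iff insert_subset)

lemma edge_subset: "e \<in> E \<Longrightarrow> e \<subseteq> V"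
  using simplicial by (auto simp: simplicial_graph_def)

lemma rtrancl_adjacency: "x \<in> V \<Longrightarrow> y \<in> V \<Longrightarrow> (x, y) \<in> (adjacency E)\<^sup>*"
  using connected graph_connected_iff[OF simplicial] by blast

lemma walls_self [simp]: "walls x x = {}"
  by (simp add: walls_def)

lemma walls_commute: "walls x y = walls y x"
  by (auto simp: walls_def)

text \<open>Colour changes add modulo two, so \<open>walls\<close> is a cocycle under symmetric
  difference. Backtracking cancels by itself, and concatenated geodesics need no reduction.\<close>

lemma walls_triangle: "walls x z = (walls x y - walls y z) \<union> (walls y z - walls x y)"
  by (auto simp: walls_def)

lemma walls_subset: "walls x y \<subseteq> E"
  by (auto simp: walls_def)

lemma walls_edge: "{x, y} \<in> E \<Longrightarrow> walls x y = {{x, y}}"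
  using is_cut_cut by (auto simp: walls_def is_cut_def)

lemma walls_path:
  "edge_path V E p \<Longrightarrow> distinct p \<Longrightarrow> walls (hd p) (last p) = path_edges p"
proof (induction p)
  case (Cons x p)
  show ?case
  proof (cases "p = []")
    case False
    then have *: "{x, hd p} \<in> E" "walls (hd p) (last p) = path_edges p" "x \<notin> set p"
      using Cons by (auto simp: edge_path_Cons)
    then have "{x, hd p} \<notin> path_edges p" using path_edges_subset_set by (metis insert_subset)
    then show ?thesis
      using * False walls_triangle[of x "last p" "hd p"] walls_edge[OF *(1)]
      by (auto simp: path_edges_Cons)
  qed auto
qed (auto simp: edge_path_def)

lemma distinct_path:
  assumes "x \<in> V" "y \<in> V"
  obtains p where "edge_path V E p" "hd p = x" "last p = y" "distinct p"
    "walls x y = path_edges p" "length p = Suc (td x y)"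
proof -
  obtain p0 where "edge_path V E p0" "hd p0 = x" "last p0 = y"
    using connected assms unfolding graph_connected_def by metis
  then obtain p where p: "edge_path V E p" "hd p = x" "last p = y" "distinct p"
    using edge_path_distinct by metis
  then have w: "walls x y = path_edges p" using walls_path by metis
  then have "length p = Suc (td x y)"
    using card_path_edges[OF p(4)] p(1) by (cases p) (auto simp: td_def edge_path_def)
  then show ?thesis using that p w by blast
qed

lemma finite_walls: "x \<in> V \<Longrightarrow> y \<in> V \<Longrightarrow> finite (walls x y)"
  using distinct_path finite_path_edges by metis

lemma td_self [simp]: "td x x = 0"
  by (simp add: td_def)

lemma td_commute: "td x y = td y x"
  by (simp add: td_def walls_commute)

lemma td_eq_0: "x \<in> V \<Longrightarrow> y \<in> V \<Longrightarrow> td x y = 0 \<longleftrightarrow> x = y"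
proof
  assume "x \<in> V" "y \<in> V" "td x y = 0"
  then obtain p where "hd p = x" "last p = y" "length p = 1"
    using distinct_path[of x y] by (metis One_nat_def)
  then show "x = y" by (cases p) auto
qed auto

lemma td_edge: "{x, y} \<in> E \<Longrightarrow> td x y = 1"
  by (simp add: td_def walls_edge)

lemma td_eq_1: "x \<in> V \<Longrightarrow> y \<in> V \<Longrightarrow> td x y = 1 \<Longrightarrow> {x, y} \<in> E"
proof -
  assume "x \<in> V" "y \<in> V" "td x y = 1"
  then obtain p where "edge_path V E p" "hd p = x" "last p = y" "length p = 2"
    using distinct_path[of x y] by (metis Suc_1)
  then show ?thesis by (auto simp: edge_path_def numeral_2_eq_2 length_Suc_conv)
qed

lemma walls_disjoint:
  "walls x y \<inter> walls y z = {} \<Longrightarrow> walls x z = walls x y \<union> walls y z"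
  using walls_triangle[of x z y] by blast

lemma td_disjoint:
  "x \<in> V \<Longrightarrow> y \<in> V \<Longrightarrow> z \<in> V \<Longrightarrow> walls x y \<inter> walls y z = {} \<Longrightarrow> td x z = td x y + td y z"
  unfolding td_def using walls_disjoint[of x y z] card_Un_disjoint[of "walls x y" "walls y z"]
  by (simp only: finite_walls)

lemma walls_mono_endpoint:
  assumes "x \<in> V" "y \<in> V" "e \<in> walls x y" "a \<in> e"
  shows "walls x a \<subseteq> walls x y"
proof -
  obtain p where p: "edge_path V E p" "hd p = x" "last p = y" "distinct p"
    "walls x y = path_edges p" using distinct_path assms by metis
  then have "a \<in> set p" using assms(3,4) path_edges_subset_set by blast
  then obtain r s where rs: "p = r @ a # s" by (meson split_list)
  show ?thesis
  proof (cases "s = []")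
    case True
    then show ?thesis using p rs by auto
  next
    case False
    then have "p = (r @ [a]) @ s" using rs by simp
    moreover from this have "edge_path V E (r @ [a])"
      using p(1) False edge_path_append[of "r @ [a]" s V E] by auto
    moreover have "hd (r @ [a]) = x" using p(2) rs by (cases r) auto
    ultimately have "walls x a = path_edges (r @ [a])" "path_edges (r @ [a]) \<subseteq> path_edges p"
      using walls_path[of "r @ [a]"] p(4) False path_edges_append[of "r @ [a]" s] by auto
    then show ?thesis using p(5) by simp
  qed
qed

text \<open>The witness is the vertex after \<open>x\<close> on the geodesic to \<open>y\<close>.
  Below, \<open>{x, u} \<in> walls x y\<close> serves as the assertion that \<open>y\<close> lies
  behind the neighbour \<open>u\<close> of \<open>x\<close>.\<close>

lemma toward_exists:
  assumes "x \<in> V" "y \<in> V" "x \<noteq> y"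
  shows "\<exists>u. {x, u} \<in> walls x y"
proof -
  obtain p where p: "edge_path V E p" "hd p = x" "last p = y" "walls x y = path_edges p"
    using distinct_path assms by metis
  then obtain u q where "p = x # u # q" using assms(3)
    by (cases p rule: path_edges.cases) (auto simp: edge_path_def)
  then show ?thesis using p by auto
qed

lemma toward_unique:
  assumes "x \<in> V" "y \<in> V" "{x, u} \<in> walls x y" "{x, v} \<in> walls x y"
  shows "u = v"
proof -
  obtain p where p: "edge_path V E p" "hd p = x" "last p = y" "distinct p"
    "walls x y = path_edges p" using distinct_path assms by metis
  show ?thesis
  proof (cases p rule: path_edges.cases)
    case (1 a b q)
    then have "a = x" "x \<notin> set (b # q)" using p by auto
    then have "\<And>w. {x, w} \<in> path_edges p \<Longrightarrow> w = b"
      using 1 path_edges_subset_set by (fastforce simp: doubleton_eq_iff)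
    then show ?thesis using assms p by metis
  qed (use p assms in auto)
qed

lemma toward_walls:
  assumes "x \<in> V" "y \<in> V" "{x, u} \<in> walls x y"
  shows "walls u y = walls x y - {{x, u}}" "td x y = Suc (td u y)" "u \<in> V" "{x, u} \<in> E"
proof -
  show e: "{x, u} \<in> E" using assms walls_subset by blast
  then show "u \<in> V" using edge_in_V by blast
  show w: "walls u y = walls x y - {{x, u}}"
    using walls_triangle[of u y x] walls_edge[OF e] assms walls_commute[of u x] by auto
  have "card (walls x y) > 0" using assms finite_walls card_gt_0_iff by blast
  then show "td x y = Suc (td u y)"
    unfolding td_def w using assms finite_walls by (simp add: card_Diff_singleton)
qed

text \<open>If the geodesics from \<open>x\<close> to \<open>y\<close> and to \<open>z\<close>
  shared an edge, its end \<open>a\<close> other than \<open>x\<close> would lie on both, and both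
  would leave \<open>x\<close> by the first edge towards \<open>a\<close>.\<close>

lemma tripod:
  assumes V: "x \<in> V" "y \<in> V" "z \<in> V" and u: "{x, u} \<in> walls x y" "{x, u} \<notin> walls x z"
  shows "walls x y \<inter> walls x z = {}"
proof (rule ccontr)
  assume "walls x y \<inter> walls x z \<noteq> {}"
  then obtain e where e: "e \<in> walls x y" "e \<in> walls x z" by blast
  then have "e \<in> E" using walls_subset by blast
  then obtain a where a: "a \<in> e" "a \<noteq> x" "a \<in> V" using edge_obtain[of e] by (metis insertCI)
  then obtain c where c: "{x, c} \<in> walls x a" using toward_exists V(1) by metis
  then have "{x, c} \<in> walls x y" "{x, c} \<in> walls x z"
    using walls_mono_endpoint V e a by blast+
  then show False using toward_unique V u by metis
qed

lemma graph_dist_eq: "x \<in> V \<Longrightarrow> y \<in> V \<Longrightarrow> graph_dist V E x y = td x y"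
  unfolding graph_dist_def
proof (rule Least_equality)
  assume xy: "x \<in> V" "y \<in> V"
  show "\<exists>p. edge_path V E p \<and> hd p = x \<and> last p = y \<and> length p = Suc (td x y)"
    using distinct_path[OF xy] by metis
next
  fix n assume "\<exists>p. edge_path V E p \<and> hd p = x \<and> last p = y \<and> length p = Suc n"
  then obtain p where p: "edge_path V E p" "hd p = x" "last p = y" "length p = Suc n" by blast
  have "walls x y \<subseteq> path_edges p"
    using is_cut_path[OF p(1) is_cut_cut] p unfolding walls_def by blast
  then have "td x y \<le> card (path_edges p)"
    unfolding td_def using finite_path_edges card_mono by blast
  then show "td x y \<le> n" using card_path_edges_le[of p] p(4) by simp
qed

text \<open>In a tree, absence of backtracking suffices for a geodesic: by
  \<open>toward_unique\<close> the only edge at \<open>\<gamma> k\<close> leading back to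
  \<open>\<gamma> i\<close> is the previous one, so the next edge is new.\<close>

lemma reduced_walk_td:
  fixes \<gamma> :: "int \<Rightarrow> 'v"
  assumes e: "\<And>i. {\<gamma> i, \<gamma> (i + 1)} \<in> E" and red: "\<And>i. \<gamma> (i + 2) \<noteq> \<gamma> i"
  shows "walls (\<gamma> i) (\<gamma> (i + int n)) = {{\<gamma> j, \<gamma> (j + 1)} | j. i \<le> j \<and> j < i + int n}"
    and "td (\<gamma> i) (\<gamma> (i + int n)) = n"
proof -
  have V: "\<gamma> i \<in> V" for i using e edge_in_V by blast
  have "walls (\<gamma> i) (\<gamma> (i + int n)) = {{\<gamma> j, \<gamma> (j + 1)} | j. i \<le> j \<and> j < i + int n} \<and>
     td (\<gamma> i) (\<gamma> (i + int n)) = n"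
  proof (induction n)
    case (Suc n)
    define k where "k = i + int n"
    have k1: "i + int (Suc n) = k + 1" by (simp add: k_def)
    have disj: "walls (\<gamma> i) (\<gamma> k) \<inter> walls (\<gamma> k) (\<gamma> (k + 1)) = {}"
    proof (cases n)
      case (Suc m)
      have "{\<gamma> k, \<gamma> (k - 1)} \<in> walls (\<gamma> k) (\<gamma> i)"
      proof -
        have "i \<le> k - 1 \<and> k - 1 < k" using Suc by (simp add: k_def)
        then have "{\<gamma> (k - 1), \<gamma> (k - 1 + 1)} \<in> walls (\<gamma> i) (\<gamma> k)"
          using Suc.IH[folded k_def] by blast
        then show ?thesis by (simp add: insert_commute walls_commute)
      qed
      moreover have "\<gamma> (k - 1) \<noteq> \<gamma> (k + 1)" using red[of "k - 1"] by (simp add: add.commute)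
      ultimately have "{\<gamma> k, \<gamma> (k + 1)} \<notin> walls (\<gamma> k) (\<gamma> i)"
        using toward_unique V by metis
      then show ?thesis using walls_edge[OF e] by (simp add: walls_commute)
    qed (simp add: k_def)
    have "walls (\<gamma> i) (\<gamma> (k + 1)) = walls (\<gamma> i) (\<gamma> k) \<union> {{\<gamma> k, \<gamma> (k + 1)}}"
      using walls_disjoint[OF disj] walls_edge[OF e] by simp
    also have "\<dots> = {{\<gamma> j, \<gamma> (j + 1)} | j. i \<le> j \<and> j < k + 1}"
    proof -
      have "(i \<le> j \<and> j < k + 1) \<longleftrightarrow> (i \<le> j \<and> j < k) \<or> j = k" for j
        by (auto simp: k_def)
      then show ?thesis using Suc.IH[folded k_def] by auto
    qed
    finally show ?case
      unfolding k1 using td_disjoint[OF V V V disj] td_edge[OF e] Suc.IH[folded k_def] by simp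
  qed auto
  then show "walls (\<gamma> i) (\<gamma> (i + int n)) = {{\<gamma> j, \<gamma> (j + 1)} | j. i \<le> j \<and> j < i + int n}"
    and "td (\<gamma> i) (\<gamma> (i + int n)) = n" by auto
qed

lemma reduced_walk_geodesic:
  fixes \<gamma> :: "int \<Rightarrow> 'v"
  assumes e: "\<And>i. {\<gamma> i, \<gamma> (i + 1)} \<in> E" and red: "\<And>i. \<gamma> (i + 2) \<noteq> \<gamma> i"
  shows "bi_infinite_geodesic V E \<gamma>"
proof -
  have V: "\<gamma> i \<in> V" for i using e edge_in_V by blast
  have le: "int (td (\<gamma> i) (\<gamma> j)) = \<bar>i - j\<bar>" if "i \<le> j" for i j
    using reduced_walk_td(2)[OF e red, of i "nat (j - i)"] that by simp
  have "int (td (\<gamma> i) (\<gamma> j)) = \<bar>i - j\<bar>" for i j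
    using le[of i j] le[of j i] td_commute[of "\<gamma> i" "\<gamma> j"] by (cases "i \<le> j") auto
  then show ?thesis using V by (auto simp: bi_infinite_geodesic_def graph_dist_eq)
qed

end

section \<open>Finitely presented groups\<close>

text \<open>Combinatorial simple connectivity of the Rips complex with step set \<open>S\<close>, for coefficients
  in the group of order two.\<close>

definition simply_connected_steps :: "('g, 'b) monoid_scheme \<Rightarrow> 'g set \<Rightarrow> bool" where
  "simply_connected_steps G S \<longleftrightarrow>
    finite S \<and> S \<subseteq> carrier G \<and> \<one>\<^bsub>G\<^esub> \<in> S \<and> (\<forall>s\<in>S. inv\<^bsub>G\<^esub> s \<in> S) \<and>
    (\<forall>P. P \<one>\<^bsub>G\<^esub> \<and> (\<forall>g\<in>carrier G. \<forall>s\<in>S. P g \<longrightarrow> P (g \<otimes>\<^bsub>G\<^esub> s)) \<longrightarrow> (\<forall>g\<in>carrier G. P g)) \<and>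
    (\<forall>\<epsilon>. (\<forall>g\<in>carrier G. \<forall>s\<in>S. \<forall>t\<in>S. s \<otimes>\<^bsub>G\<^esub> t \<in> S \<longrightarrow>
            \<epsilon> g (g \<otimes>\<^bsub>G\<^esub> (s \<otimes>\<^bsub>G\<^esub> t)) = (\<epsilon> g (g \<otimes>\<^bsub>G\<^esub> s) \<noteq> \<epsilon> (g \<otimes>\<^bsub>G\<^esub> s) (g \<otimes>\<^bsub>G\<^esub> (s \<otimes>\<^bsub>G\<^esub> t)))) \<longrightarrow>
       (\<exists>\<kappa> :: 'g \<Rightarrow> bool. \<forall>g\<in>carrier G. \<forall>s\<in>S. \<epsilon> g (g \<otimes>\<^bsub>G\<^esub> s) = (\<kappa> g \<noteq> \<kappa> (g \<otimes>\<^bsub>G\<^esub> s))))"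

lemma words_Nil [simp]: "[] \<in> words X"
  and words_append [simp]: "u @ v \<in> words X \<longleftrightarrow> u \<in> words X \<and> v \<in> words X"
  and words_Cons [simp]: "x # u \<in> words X \<longleftrightarrow> fst x \<in> X \<and> u \<in> words X"
  by (auto simp: words_def mem_Times_iff)

lemma pres_rel_words:
  assumes "R \<subseteq> words X" "(u, v) \<in> pres_rel X R"
  shows "u \<in> words X \<and> v \<in> words X"
  using assms(2) by (induction rule: pres_rel.induct) (use assms(1) in auto)

lemma pres_rel_append_left:
  assumes "(u, v) \<in> pres_rel X R" "w \<in> words X"
  shows "(w @ u, w @ v) \<in> pres_rel X R"
  using assms(1)
proof (induction rule: pres_rel.induct)
  case (cancel u v x b)
  then show ?case using pres_rel.cancel[where u = "w @ u" and v = v] assms(2) by simp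
next
  case (relator u v r)
  then show ?case using pres_rel.relator[where u = "w @ u" and v = v] assms(2) by simp
qed (use assms(2) in \<open>auto intro: pres_rel.intros\<close>)

lemma pres_rel_append_right:
  assumes "(u, v) \<in> pres_rel X R" "w \<in> words X"
  shows "(u @ w, v @ w) \<in> pres_rel X R"
  using assms(1)
proof (induction rule: pres_rel.induct)
  case (cancel u v x b)
  then show ?case using pres_rel.cancel[where u = u and v = "v @ w"] assms(2) by simp
next
  case (relator u v r)
  then show ?case using pres_rel.relator[where u = u and v = "v @ w"] assms(2) by simp
qed (use assms(2) in \<open>auto intro: pres_rel.intros\<close>)

lemma equiv_pres_rel: "R \<subseteq> words X \<Longrightarrow> equiv (words X) (pres_rel X R)"
proof (rule equivI)
  assume R: "R \<subseteq> words X"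
  show "pres_rel X R \<subseteq> words X \<times> words X" using pres_rel_words[OF R] by auto
  show "refl_on (words X) (pres_rel X R)" by (auto intro: refl_onI pres_rel.refl)
  show "sym (pres_rel X R)" by (auto intro: symI pres_rel.sym)
  show "trans (pres_rel X R)" by (auto intro: transI pres_rel.trans)
qed

lemma presented_group_mult:
  assumes R: "R \<subseteq> words X" and uv: "u \<in> words X" "v \<in> words X"
  shows "(pres_rel X R `` {u}) \<otimes>\<^bsub>presented_group X R\<^esub> (pres_rel X R `` {v}) = pres_rel X R `` {u @ v}"
proof -
  have eq: "pres_rel X R `` {a @ b} = pres_rel X R `` {u @ v}"
    if "(u, a) \<in> pres_rel X R" "(v, b) \<in> pres_rel X R" for a b
  proof -
    have "(u @ v, u @ b) \<in> pres_rel X R" using pres_rel_append_left that uv by blast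
    moreover have "(u @ b, a @ b) \<in> pres_rel X R"
      using pres_rel_append_right that uv pres_rel_words[OF R] by blast
    ultimately have "(u @ v, a @ b) \<in> pres_rel X R" by (rule pres_rel.trans)
    then show ?thesis using equiv_class_eq[OF equiv_pres_rel[OF R]] by metis
  qed
  have self: "(u, u) \<in> pres_rel X R" "(v, v) \<in> pres_rel X R" using uv pres_rel.refl by auto
  have "(pres_rel X R `` {u}) \<otimes>\<^bsub>presented_group X R\<^esub> (pres_rel X R `` {v}) =
      (\<Union>a\<in>pres_rel X R `` {u}. \<Union>b\<in>pres_rel X R `` {v}. pres_rel X R `` {a @ b})"
    by (simp add: presented_group_def)
  also have "\<dots> = (\<Union>a\<in>pres_rel X R `` {u}. \<Union>b\<in>pres_rel X R `` {v}. pres_rel X R `` {u @ v})"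
    by (intro SUP_cong refl eq) blast+
  also have "\<dots> = pres_rel X R `` {u @ v}"
    using self by blast
  finally show ?thesis .
qed

text \<open>Trades the isomorphism with a group of classes for an evaluation map on words. Its
  surjectivity, multiplicativity and kernel are what the cocycle argument works with.\<close>

lemma (in group) finitely_presented_eval:
  assumes "finitely_presented G"
  obtains X :: "nat set" and R \<eta> where "finite X" "finite R" "R \<subseteq> words X"
    "\<eta> ` words X = carrier G" "\<eta> [] = \<one>"
    "\<And>u v. u \<in> words X \<Longrightarrow> v \<in> words X \<Longrightarrow> \<eta> (u @ v) = \<eta> u \<otimes> \<eta> v"
    "\<And>u v. u \<in> words X \<Longrightarrow> v \<in> words X \<Longrightarrow> \<eta> u = \<eta> v \<longleftrightarrow> (u, v) \<in> pres_rel X R"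
proof -
  obtain X :: "nat set" and R where XR: "finite X" "finite R" "R \<subseteq> words X"
    "G \<cong> presented_group X R" using assms by (auto simp: finitely_presented_def)
  let ?Q = "presented_group X R" and ?c = "\<lambda>w. pres_rel X R `` {w}"
  obtain h where h: "h \<in> iso G ?Q" using XR(4) by (auto simp: is_iso_def)
  define \<eta> where "\<eta> = inv_into (carrier G) h \<circ> ?c"
  have bij: "bij_betw h (carrier G) (carrier ?Q)" using h by (simp add: iso_def)
  have car: "carrier ?Q = ?c ` words X" by (auto simp: presented_group_def quotient_def)
  have h\<eta>: "h (\<eta> u) = ?c u" if "u \<in> words X" for u
    using that bij car unfolding \<eta>_def by (simp add: bij_betw_inv_into_right)
  have img: "\<eta> ` words X = carrier G"
    unfolding \<eta>_def image_comp[symmetric] car[symmetric]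
    using bij_betw_inv_into[OF bij] by (simp add: bij_betw_def)
  have inj: "a = b" if "h a = h b" "a \<in> carrier G" "b \<in> carrier G" for a b
    using bij that by (auto simp: bij_betw_def inj_on_def)
  have mult: "\<eta> (u @ v) = \<eta> u \<otimes> \<eta> v" if uv: "u \<in> words X" "v \<in> words X" for u v
  proof (rule inj)
    have c: "\<eta> u \<in> carrier G" "\<eta> v \<in> carrier G" "\<eta> (u @ v) \<in> carrier G"
      using img uv by auto
    then show "\<eta> (u @ v) \<in> carrier G" "\<eta> u \<otimes> \<eta> v \<in> carrier G" by auto
    have "h (\<eta> u \<otimes> \<eta> v) = h (\<eta> u) \<otimes>\<^bsub>?Q\<^esub> h (\<eta> v)"
      using h c by (simp add: iso_def hom_def)
    then show "h (\<eta> (u @ v)) = h (\<eta> u \<otimes> \<eta> v)"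
      using uv h\<eta> presented_group_mult[OF XR(3) uv] by simp
  qed
  have ker: "\<eta> u = \<eta> v \<longleftrightarrow> (u, v) \<in> pres_rel X R" if uv: "u \<in> words X" "v \<in> words X" for u v
  proof -
    have "\<eta> u = \<eta> v \<longleftrightarrow> ?c u = ?c v"
      using h\<eta> uv by (metis \<eta>_def comp_apply)
    then show ?thesis using eq_equiv_class_iff[OF equiv_pres_rel[OF XR(3)] uv] by simp
  qed
  have e: "\<eta> [] \<in> carrier G" using img by (metis imageI words_Nil)
  have "\<eta> [] \<otimes> \<eta> [] = \<eta> []" using mult[of "[]" "[]"] by simp
  then have "\<eta> [] = \<one>" using e by (metis l_cancel_one' one_closed)
  then show ?thesis using that XR(1-3) img mult ker by blast
qed

text \<open>A filling argument. Summing \<epsilon> along the path of a word gives a parity. All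
  prefixes of a word of length at most \<open>N\<close> have values in \<open>S\<close>, so coning
  off its path at the start by triangles identifies the parity with the value of \<epsilon> on the
  chord. Hence relators have parity zero, cancelling pairs likewise, and \<kappa> can be the parity
  of any word that evaluates to \<open>g\<close>.\<close>

lemma (in group) finitely_presented_simply_connected:
  assumes "finitely_presented G"
  shows "\<exists>S. simply_connected_steps G S" "countable (carrier G)"
proof -
  obtain X :: "nat set" and R \<eta> where X: "finite X" "finite R" "R \<subseteq> words X"
    and img: "\<eta> ` words X = carrier G" and one: "\<eta> [] = \<one>"
    and mult: "\<And>u v. u \<in> words X \<Longrightarrow> v \<in> words X \<Longrightarrow> \<eta> (u @ v) = \<eta> u \<otimes> \<eta> v"
    and ker: "\<And>u v. u \<in> words X \<Longrightarrow> v \<in> words X \<Longrightarrow> \<eta> u = \<eta> v \<longleftrightarrow> (u, v) \<in> pres_rel X R"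
    using finitely_presented_eval[OF assms] by metis
  show "countable (carrier G)" unfolding img[symmetric] by simp
  have cl [simp]: "\<eta> u \<in> carrier G" if "u \<in> words X" for u using img that by blast
  \<comment> \<open>The \<open>insert 0\<close> covers an empty set of relators, and
    \<open>Suc\<close> puts the values of single letters into \<open>S\<close>.\<close>
  define N where "N = Suc (Max (insert 0 (length ` R)))"
  have N: "length r \<le> N" if "r \<in> R" for r
    using that X(2) unfolding N_def by (simp add: le_SucI)
  define S where "S = \<eta> ` {w \<in> words X. length w \<le> N}"
  have "{w \<in> words X. length w \<le> N} = {w. set w \<subseteq> X \<times> UNIV \<and> length w \<le> N}"
    by (auto simp: words_def lists_eq_set)
  then have finS: "finite S" unfolding S_def
    using finite_lists_length_le[of "X \<times> (UNIV :: bool set)" N] X(1) by simp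
  have SI: "\<eta> w \<in> S" if "w \<in> words X" "length w \<le> N" for w
    using that by (auto simp: S_def)
  have SG: "S \<subseteq> carrier G" by (auto simp: S_def)
  have invx: "\<eta> [(x, \<not> b)] = inv (\<eta> [(x, b)])" if "x \<in> X" for x b
  proof -
    have "([] @ [(x, b), (x, \<not> b)] @ [], [] @ []) \<in> pres_rel X R"
      by (rule pres_rel.cancel) (use that in auto)
    then have "\<eta> [(x, b), (x, \<not> b)] = \<one>"
      using ker[of "[(x, b), (x, \<not> b)]" "[]"] that one by simp
    then have "\<eta> [(x, b)] \<otimes> \<eta> [(x, \<not> b)] = \<one>"
      using mult[of "[(x, b)]" "[(x, \<not> b)]"] that by simp
    then show ?thesis using that by (metis inv_equality inv_inv cl fst_conv words_Cons words_Nil)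
  qed
  have inv_word: "\<exists>w'\<in>words X. length w' = length w \<and> \<eta> w' = inv (\<eta> w)"
    if "w \<in> words X" for w
    using that
  proof (induction w)
    case (Cons x w)
    then obtain w' where w': "w' \<in> words X" "length w' = length w" "\<eta> w' = inv (\<eta> w)"
      by auto
    obtain y b where x: "x = (y, b)" by (cases x)
    have "\<eta> (w' @ [(y, \<not> b)]) = inv (\<eta> w) \<otimes> inv (\<eta> [x])"
      using mult[of w' "[(y, \<not> b)]"] w' Cons.prems x invx by simp
    also have "\<dots> = inv (\<eta> (x # w))"
      using mult[of "[x]" w] Cons.prems by (simp add: inv_mult_group)
    finally show ?case
      using w' Cons.prems x by (intro bexI[of _ "w' @ [(y, \<not> b)]"]) auto
  qed (auto simp: one)
  have invS: "inv s \<in> S" if "s \<in> S" for s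
    using that inv_word unfolding S_def by (smt (verit, best) image_iff mem_Collect_eq)
  have oneS: "\<one> \<in> S" using SI[of "[]"] one by simp
  have gen: "P g"
    if "P \<one>" "\<forall>g\<in>carrier G. \<forall>s\<in>S. P g \<longrightarrow> P (g \<otimes> s)" "g \<in> carrier G" for P g
  proof -
    have "P (\<eta> w)" if "w \<in> words X" for w
      using that
    proof (induction w rule: rev_induct)
      case (snoc x w)
      have "\<eta> [x] \<in> S" using snoc by (intro SI) (auto simp: N_def)
      then show ?case using snoc mult[of w "[x]"]
        \<open>\<forall>g\<in>carrier G. \<forall>s\<in>S. P g \<longrightarrow> P (g \<otimes> s)\<close> by auto
    qed (simp add: one \<open>P \<one>\<close>)
    then show ?thesis using img that(3) by (metis imageE)
  qed
  have coc: "\<exists>\<kappa> :: 'a \<Rightarrow> bool. \<forall>g\<in>carrier G. \<forall>s\<in>S. \<epsilon> g (g \<otimes> s) = (\<kappa> g \<noteq> \<kappa> (g \<otimes> s))"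
    if \<epsilon>: "\<And>g s t. g \<in> carrier G \<Longrightarrow> s \<in> S \<Longrightarrow> t \<in> S \<Longrightarrow> s \<otimes> t \<in> S \<Longrightarrow>
            \<epsilon> g (g \<otimes> (s \<otimes> t)) = (\<epsilon> g (g \<otimes> s) \<noteq> \<epsilon> (g \<otimes> s) (g \<otimes> (s \<otimes> t)))"
    for \<epsilon>
  proof -
    \<comment> \<open>The sum of \<epsilon> modulo two along the path that spells \<open>w\<close>
      from \<open>g\<close>.\<close>
    define par :: "'a \<Rightarrow> (nat \<times> bool) list \<Rightarrow> bool" where
      "par g w = odd (card {i. i < length w \<and> \<epsilon> (g \<otimes> \<eta> (take i w)) (g \<otimes> \<eta> (take (Suc i) w))})"
      for g w
    have par_Nil: "par g [] = False" for g by (simp add: par_def)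
    have par_snoc: "par g (w @ [x]) =
        (par g w \<noteq> \<epsilon> (g \<otimes> \<eta> w) (g \<otimes> \<eta> (w @ [x])))" for g w x
    proof -
      let ?A = "\<lambda>v. {i. i < length v \<and> \<epsilon> (g \<otimes> \<eta> (take i v)) (g \<otimes> \<eta> (take (Suc i) v))}"
      have "?A (w @ [x]) = (if \<epsilon> (g \<otimes> \<eta> w) (g \<otimes> \<eta> (w @ [x])) then insert (length w) (?A w) else ?A w)"
        by (auto simp: less_Suc_eq)
      then show ?thesis by (simp add: par_def)
    qed
    have par_append: "par g (u @ v) = (par g u \<noteq> par (g \<otimes> \<eta> u) v)"
      if "g \<in> carrier G" "u \<in> words X" "v \<in> words X" for g u v
      using that(3)
    proof (induction v rule: rev_induct)
      case (snoc x v)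
      have "par g (u @ v @ [x]) = (par g (u @ v) \<noteq> \<epsilon> (g \<otimes> \<eta> (u @ v)) (g \<otimes> \<eta> (u @ v @ [x])))"
        using par_snoc[of g "u @ v" x] by simp
      moreover have "g \<otimes> \<eta> (u @ v) = g \<otimes> \<eta> u \<otimes> \<eta> v"
        "g \<otimes> \<eta> (u @ v @ [x]) = g \<otimes> \<eta> u \<otimes> \<eta> (v @ [x])"
        using mult[of u v] mult[of u "v @ [x]"] that snoc.prems by (auto simp: m_assoc)
      ultimately show ?case
        using snoc par_snoc[of "g \<otimes> \<eta> u" v x] by auto
    qed (simp add: par_Nil)
    \<comment> \<open>The degenerate triangle \<open>s = t = \<one>\<close> equates the value with
      its exclusive or with itself.\<close>
    have \<epsilon>_refl: "\<epsilon> g g = False" if "g \<in> carrier G" for g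
      using \<epsilon>[OF that oneS oneS] oneS that by simp
    have par_short: "par g w = \<epsilon> g (g \<otimes> \<eta> w)"
      if "g \<in> carrier G" "w \<in> words X" "length w \<le> N" for g w
      using that(2,3)
    proof (induction w rule: rev_induct)
      case Nil
      then show ?case using \<epsilon>_refl that(1) by (simp add: par_Nil one)
    next
      case (snoc x w)
      have w: "\<eta> w \<in> S" "\<eta> [x] \<in> S" "\<eta> (w @ [x]) \<in> S"
        by (rule SI; use snoc.prems in \<open>simp add: N_def\<close>)+
      have "\<eta> (w @ [x]) = \<eta> w \<otimes> \<eta> [x]" using snoc.prems by (simp add: mult)
      then show ?case using snoc par_snoc[of g w x] \<epsilon>[OF that(1) w(1,2)] w(3) by simp
    qed
    have par_inv: "\<forall>g\<in>carrier G. par g u = par g v" if "(u, v) \<in> pres_rel X R" for u v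
      using that
    proof (induction rule: pres_rel.induct)
      case (cancel u v x b)
      have w: "[(x, b), (x, \<not> b)] \<in> words X" using cancel by simp
      have e: "\<eta> [(x, b), (x, \<not> b)] = \<one>"
        using ker[of "[(x, b), (x, \<not> b)]" "[]"] pres_rel.cancel[where u = "[]" and v = "[]"] cancel one by simp
      have "par g [(x, b), (x, \<not> b)] = False" if "g \<in> carrier G" for g
      proof -
        \<comment> \<open>The word has length two, which may exceed \<open>N\<close>; so its parity
          is computed from one triangle with \<open>?s \<otimes> ?t = \<one>\<close>.\<close>
        let ?s = "\<eta> [(x, b)]" and ?t = "\<eta> [(x, \<not> b)]"
        have st: "?s \<in> S" "?t \<in> S" "?s \<otimes> ?t = \<one>"
          using mult[of "[(x, b)]" "[(x, \<not> b)]"] cancel e by (auto intro!: SI simp: N_def)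
        have "par g [(x, b), (x, \<not> b)] = (par g [(x, b)] \<noteq> \<epsilon> (g \<otimes> ?s) (g \<otimes> \<one>))"
          using par_snoc[of g "[(x, b)]" "(x, \<not> b)"] e by simp
        also have "par g [(x, b)] = \<epsilon> g (g \<otimes> ?s)"
          using cancel that by (intro par_short) (auto simp: N_def)
        finally show ?thesis
          using \<epsilon>[OF that st(1,2)] st(3) oneS \<epsilon>_refl that by simp
      qed
      then have "par g ([(x, b), (x, \<not> b)] @ v) = par g v" if "g \<in> carrier G" for g
        using par_append[OF that w cancel(2)] e that by simp
      then show ?case
        using cancel w by (auto simp: par_append simp del: append_Cons append_Nil)
    next
      case (relator u v r)
      then have r: "r \<in> words X" "\<eta> r = \<one>"
        using X(3) ker[of r "[]"] pres_rel.relator[where u = "[]" and v = "[]"] one by auto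
      then have "par g r = False" if "g \<in> carrier G" for g
        using par_short[of g r] N[OF relator(3)] \<epsilon>_refl that by simp
      then show ?case using relator r by (auto simp: par_append)
    qed auto
    define w where "w g = (SOME u. u \<in> words X \<and> \<eta> u = g)" for g
    have w: "w g \<in> words X" "\<eta> (w g) = g" if "g \<in> carrier G" for g
    proof -
      have "\<exists>u. u \<in> words X \<and> \<eta> u = g" using that unfolding img[symmetric] by blast
      from someI_ex[OF this] show "w g \<in> words X" "\<eta> (w g) = g" by (auto simp: w_def)
    qed
    have "\<epsilon> g (g \<otimes> s) = (par \<one> (w g) \<noteq> par \<one> (w (g \<otimes> s)))"
      if g: "g \<in> carrier G" and s: "s \<in> S" for g s
    proof -
      obtain u where u: "u \<in> words X" "length u \<le> N" "s = \<eta> u" using s by (auto simp: S_def)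
      have "\<eta> (w g @ u) = \<eta> (w (g \<otimes> s))" using mult w g u by simp
      then have "(w g @ u, w (g \<otimes> s)) \<in> pres_rel X R"
        using ker w g u by (metis m_closed cl words_append)
      then have "par \<one> (w (g \<otimes> s)) = par \<one> (w g @ u)" using par_inv by blast
      also have "\<dots> = (par \<one> (w g) \<noteq> \<epsilon> g (g \<otimes> s))"
        using par_append[of "\<one>" "w g" u] par_short[of g u] w g u by simp
      finally show ?thesis by blast
    qed
    then show ?thesis by (intro exI[of _ "\<lambda>g. par \<one> (w g)"]) blast
  qed
  have "simply_connected_steps G S"
    unfolding simply_connected_steps_def
  proof (intro conjI allI impI ballI; (elim conjE)?)
    show "finite S" "S \<subseteq> carrier G" "\<one> \<in> S" by (fact finS SG oneS)+
    show "inv s \<in> S" if "s \<in> S" for s using invS that .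
    show "P g" if "g \<in> carrier G" "P \<one>"
      "\<forall>g\<in>carrier G. \<forall>s\<in>S. P g \<longrightarrow> P (g \<otimes> s)" for P g
      using gen that by metis
    show "\<exists>\<kappa> :: 'a \<Rightarrow> bool. \<forall>g\<in>carrier G. \<forall>s\<in>S. \<epsilon> g (g \<otimes> s) = (\<kappa> g \<noteq> \<kappa> (g \<otimes> s))"
      if "\<forall>g\<in>carrier G. \<forall>s\<in>S. \<forall>t\<in>S. s \<otimes> t \<in> S \<longrightarrow>
            \<epsilon> g (g \<otimes> (s \<otimes> t)) = (\<epsilon> g (g \<otimes> s) \<noteq> \<epsilon> (g \<otimes> s) (g \<otimes> (s \<otimes> t)))" for \<epsilon>
      using coc[of \<epsilon>] that by simp
  qed
  then show "\<exists>S. simply_connected_steps G S" by blast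
qed

section \<open>Actions on trees\<close>

lemma group_actionI:
  assumes "group G"
    and ext: "\<And>g. g \<in> carrier G \<Longrightarrow> \<phi> g \<in> extensional V"
    and closed: "\<And>g x. g \<in> carrier G \<Longrightarrow> x \<in> V \<Longrightarrow> \<phi> g x \<in> V"
    and one: "\<And>x. x \<in> V \<Longrightarrow> \<phi> \<one>\<^bsub>G\<^esub> x = x"
    and mult: "\<And>g h x. g \<in> carrier G \<Longrightarrow> h \<in> carrier G \<Longrightarrow> x \<in> V \<Longrightarrow> \<phi> (g \<otimes>\<^bsub>G\<^esub> h) x = \<phi> g (\<phi> h x)"
  shows "group_action G V \<phi>"
proof -
  interpret group G by fact
  have "bij_betw (\<phi> g) V V" if g: "g \<in> carrier G" for g
  proof (rule bij_betw_byWitness[where f' = "\<phi> (inv\<^bsub>G\<^esub> g)"])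
    show "\<forall>a\<in>V. \<phi> (inv\<^bsub>G\<^esub> g) (\<phi> g a) = a"
      using g mult[of "inv\<^bsub>G\<^esub> g" g] one by simp
    show "\<forall>a\<in>V. \<phi> g (\<phi> (inv\<^bsub>G\<^esub> g) a) = a"
      using g mult[of g "inv\<^bsub>G\<^esub> g"] one by simp
  qed (use g closed in auto)
  then have bij: "\<phi> g \<in> Bij V" if "g \<in> carrier G" for g
    using ext that by (simp add: Bij_def)
  have "\<phi> \<in> hom G (BijGroup V)"
  proof (rule homI)
    fix g h assume gh: "g \<in> carrier G" "h \<in> carrier G"
    have "\<phi> (g \<otimes>\<^bsub>G\<^esub> h) = compose V (\<phi> g) (\<phi> h)"
      using gh ext mult by (intro extensionalityI[of _ V]) (auto simp: compose_def)
    then show "\<phi> (g \<otimes>\<^bsub>G\<^esub> h) = \<phi> g \<otimes>\<^bsub>BijGroup V\<^esub> \<phi> h"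
      using gh bij by (simp add: BijGroup_def)
  qed (simp add: BijGroup_def bij)
  then show ?thesis
    by (simp add: group_action_def group_hom_def group_hom_axioms_def group_BijGroup is_group)
qed

sublocale tree_action \<subseteq> group G
  using group_hom group_hom.axioms(1) by blast

sublocale tree_action \<subseteq> T: simplicial_tree V E
  by standard (rule tree)

section \<open>Geodesics and stabilisers under the action\<close>

lemma path_edges_map: "path_edges (map f p) = (`) f ` path_edges p"
  by (induction p rule: path_edges.induct) auto

context tree_action
begin

lemma act_closed: "g \<in> carrier G \<Longrightarrow> x \<in> V \<Longrightarrow> \<phi> g x \<in> V"
  using element_image by blast

lemma act_one: "x \<in> V \<Longrightarrow> \<phi> \<one> x = x"
  using id_eq_one by (metis restrict_apply')

lemma act_inv: "g \<in> carrier G \<Longrightarrow> x \<in> V \<Longrightarrow> \<phi> (inv g) (\<phi> g x) = x"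
  and act_inv': "g \<in> carrier G \<Longrightarrow> x \<in> V \<Longrightarrow> \<phi> g (\<phi> (inv g) x) = x"
  using composition_rule[of x "inv g" g] composition_rule[of x g "inv g"] act_one by auto

lemma act_inject: "g \<in> carrier G \<Longrightarrow> x \<in> V \<Longrightarrow> y \<in> V \<Longrightarrow> \<phi> g x = \<phi> g y \<longleftrightarrow> x = y"
  using act_inv by metis

lemma act_edge: "g \<in> carrier G \<Longrightarrow> {x, y} \<in> E \<Longrightarrow> {\<phi> g x, \<phi> g y} \<in> E"
  using edge_closed[of g "{x, y}"] by simp

lemma act_edge_path:
  assumes "g \<in> carrier G" "edge_path V E p"
  shows "edge_path V E (map (\<phi> g) p)"
  using assms(2)
proof (induction p)
  case (Cons x p)
  then show ?case using assms(1) act_edge act_closed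
    by (cases "p = []") (auto simp: edge_path_Cons hd_map)
qed (auto simp: edge_path_def)

text \<open>The chosen colourings need not be equivariant, but geodesics are, and
  \<open>walls\<close> collects their edges.\<close>

lemma walls_act:
  assumes "g \<in> carrier G" "x \<in> V" "y \<in> V"
  shows "T.walls (\<phi> g x) (\<phi> g y) = (`) (\<phi> g) ` T.walls x y"
proof -
  obtain p where p: "edge_path V E p" "hd p = x" "last p = y" "distinct p"
    "T.walls x y = path_edges p" using T.distinct_path assms(2,3) by metis
  then have "p \<noteq> []" "set p \<subseteq> V" by (auto simp: edge_path_def)
  have "distinct (map (\<phi> g) p)"
    using p(4) \<open>set p \<subseteq> V\<close> inj_prop[OF assms(1)] by (auto simp: distinct_map intro: inj_on_subset)
  then show ?thesis
    using T.walls_path[OF act_edge_path[OF assms(1) p(1)]] p \<open>p \<noteq> []\<close>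
    by (simp add: hd_map last_map path_edges_map)
qed

lemma mem_walls_act:
  assumes g: "g \<in> carrier G" and V: "x \<in> V" "y \<in> V" "a \<in> V" "b \<in> V"
  shows "{\<phi> g a, \<phi> g b} \<in> T.walls (\<phi> g x) (\<phi> g y) \<longleftrightarrow> {a, b} \<in> T.walls x y"
proof
  assume "{\<phi> g a, \<phi> g b} \<in> T.walls (\<phi> g x) (\<phi> g y)"
  then obtain e where e: "e \<in> T.walls x y" "{\<phi> g a, \<phi> g b} = \<phi> g ` e"
    using walls_act[OF g V(1,2)] by auto
  have "e \<subseteq> V" using e(1) T.walls_subset[of x y] T.edge_subset by blast
  moreover have "\<phi> g ` e = \<phi> g ` {a, b}" using e by simp
  ultimately have "e = {a, b}"
    using inj_on_image_eq_iff[OF inj_prop[OF g], of e "{a, b}"] V by auto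
  then show "{a, b} \<in> T.walls x y" using e by simp
next
  assume "{a, b} \<in> T.walls x y"
  then show "{\<phi> g a, \<phi> g b} \<in> T.walls (\<phi> g x) (\<phi> g y)"
    unfolding walls_act[OF g V(1,2)] by (intro image_eqI[of _ _ "{a, b}"]) simp_all
qed

lemma td_act:
  assumes "g \<in> carrier G" "x \<in> V" "y \<in> V"
  shows "T.td (\<phi> g x) (\<phi> g y) = T.td x y"
proof -
  have "T.walls x y \<subseteq> Pow V" using T.walls_subset[of x y] T.edge_subset by blast
  then have "inj_on ((`) (\<phi> g)) (T.walls x y)"
    using inj_prop[OF assms(1)] by (meson inj_on_image_Pow inj_on_subset)
  then show ?thesis using walls_act[OF assms] by (simp add: T.td_def card_image)
qed

lemma edge_stab_eq:
  assumes "{x, y} \<in> E"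
  shows "edge_stab G \<phi> {x, y} = {g \<in> carrier G. \<phi> g x = x \<and> \<phi> g y = y}"
  using no_inversion assms by (fastforce simp: stabilizer_def doubleton_eq_iff)

lemma edge_stab_fixes:
  assumes "e \<in> E" "g \<in> edge_stab G \<phi> e" "x \<in> e" shows "\<phi> g x = x"
proof -
  obtain a b where "e = {a, b}" using T.edge_obtain assms(1) by metis
  then show ?thesis using assms edge_stab_eq[of a b] by auto
qed

lemma vertex_stab_subgroup: "x \<in> V \<Longrightarrow> subgroup (vertex_stab G \<phi> x) G"
  using stabilizer_subgroup by blast

lemma edge_stab_subgroup:
  assumes "e \<in> E" shows "subgroup (edge_stab G \<phi> e) G"
proof -
  obtain x y where xy: "e = {x, y}" "x \<in> V" "y \<in> V" using T.edge_obtain assms by metis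
  have "edge_stab G \<phi> e = vertex_stab G \<phi> x \<inter> vertex_stab G \<phi> y"
    using edge_stab_eq assms xy by (auto simp: stabilizer_def)
  then show ?thesis using subgroups_Inter_pair vertex_stab_subgroup xy by metis
qed

end

lemma (in group) inv_cancel:
  assumes "a \<in> carrier G" "b \<in> carrier G"
  shows "inv a \<otimes> (a \<otimes> b) = b" "a \<otimes> (inv a \<otimes> b) = b"
  using assms by (simp_all add: m_assoc[symmetric])

text \<open>A Schreier argument for the left action of \<open>H\<close> on the
  \<open>S\<close>-connected set \<open>D\<close>. Labels are constant on \<open>H\<close>-orbits
  and separate them, so there are finitely many orbits. Write \<open>d\<close> as an element of
  \<open>H\<close> times the representative \<open>r (l d)\<close>; each step of a path changes the
  factor in \<open>H\<close> by one of finitely many products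
  \<open>r t \<otimes> s \<otimes> inv (r t')\<close>.\<close>

lemma (in group) fg_subgroupI_connected:
  assumes "subgroup H G" "finite S" "S \<subseteq> carrier G" and D: "D \<subseteq> carrier G" "d0 \<in> D"
    and conn: "\<And>d. d \<in> D \<Longrightarrow>
      (d0, d) \<in> {(g, g'). g \<in> D \<and> g' \<in> D \<and> inv g \<otimes> g' \<in> S}\<^sup>*"
    and HD: "\<And>h d. h \<in> H \<Longrightarrow> d \<in> D \<Longrightarrow> h \<otimes> d \<in> D \<and> l (h \<otimes> d) = l d"
    and fin: "finite (l ` D)"
    and lab: "\<And>d d'. d \<in> D \<Longrightarrow> d' \<in> D \<Longrightarrow> l d = l d' \<Longrightarrow> d' \<otimes> inv d \<in> H"
  shows "fg_subgroup H G"
proof -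
  interpret H: subgroup H G by fact
  \<comment> \<open>The orbit of \<open>d0\<close> is represented by \<open>d0\<close> itself, so
    that the factor of \<open>h \<otimes> d0\<close> is \<open>h\<close>.\<close>
  define r where "r t = (if t = l d0 then d0 else SOME d. d \<in> D \<and> l d = t)" for t
  have r: "r (l d) \<in> D" "l (r (l d)) = l d" if "d \<in> D" for d
  proof -
    have "\<exists>d'. d' \<in> D \<and> l d' = l d" using that by blast
    from someI_ex[OF this] show "r (l d) \<in> D" "l (r (l d)) = l d" using D(2) by (auto simp: r_def)
  qed
  define Z where "Z = (\<lambda>(t, s, t'). r t \<otimes> s \<otimes> inv (r t')) ` (l ` D \<times> S \<times> l ` D) \<inter> H"
  have finZ: "finite Z" unfolding Z_def using fin assms(2) by auto
  have ZH: "Z \<subseteq> H" by (auto simp: Z_def)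
  have \<rho>: "d \<otimes> inv (r (l d)) \<in> generate G Z" if "d \<in> D" for d
    using conn[OF that]
  proof induction
    case base
    then show ?case using D by (auto simp: r_def subsetD intro: generate.one)
  next
    case (step d d')
    then have d: "d \<in> D" "d' \<in> D" "inv d \<otimes> d' \<in> S" by auto
    note c = subsetD[OF D(1) d(1)] subsetD[OF D(1) d(2)]
      subsetD[OF D(1) r(1)[OF d(1)]] subsetD[OF D(1) r(1)[OF d(2)]]
    define z where "z = r (l d) \<otimes> (inv d \<otimes> d') \<otimes> inv (r (l d'))"
    have "z = inv (d \<otimes> inv (r (l d))) \<otimes> (d' \<otimes> inv (r (l d')))"
      unfolding z_def using c by (simp add: inv_mult_group m_assoc)
    moreover have "d \<otimes> inv (r (l d)) \<in> H" "d' \<otimes> inv (r (l d')) \<in> H"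
      using lab r d by metis+
    ultimately have "z \<in> H" by simp
    moreover have "z \<in> (\<lambda>(t, s, t'). r t \<otimes> s \<otimes> inv (r t')) ` (l ` D \<times> S \<times> l ` D)"
      unfolding z_def using d by (intro image_eqI[of _ _ "(l d, inv d \<otimes> d', l d')"]) auto
    ultimately have "z \<in> Z" unfolding Z_def by blast
    then have "(d \<otimes> inv (r (l d))) \<otimes> z \<in> generate G Z"
      by (rule generate.eng[OF step.IH generate.incl])
    moreover have "(d \<otimes> inv (r (l d))) \<otimes> z = d' \<otimes> inv (r (l d'))"
      unfolding z_def using c by (simp add: m_assoc inv_cancel)
    ultimately show ?case by simp
  qed
  have "H \<subseteq> generate G Z"
  proof
    fix h assume h: "h \<in> H"
    have "h \<otimes> d0 \<in> D" "l (h \<otimes> d0) = l d0" using HD h D by auto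
    then have "(h \<otimes> d0) \<otimes> inv d0 \<in> generate G Z" using \<rho> by (metis r_def)
    moreover have "(h \<otimes> d0) \<otimes> inv d0 = h"
      using h D by (simp add: m_assoc subsetD)
    ultimately show "h \<in> generate G Z" by simp
  qed
  moreover have "generate G Z \<subseteq> H" using generate_subgroup_incl[OF ZH assms(1)] .
  ultimately have "generate (G\<lparr>carrier := H\<rparr>) Z = H"
    using generate_consistent[OF ZH assms(1)] by simp
  then show ?thesis
    unfolding fg_subgroup_def finitely_generated_def finite_generating_set_def
    using assms(1) finZ ZH subgroup_imp_group[OF assms(1)] by auto
qed

section \<open>The Dunwoody resolution of an action\<close>

locale resolution = tree_action G V E \<phi>
  for G :: "('g, 'b) monoid_scheme" (structure) and V :: "'v set" and E :: "'v set set"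
    and \<phi> :: "'g \<Rightarrow> 'v \<Rightarrow> 'v" +
  fixes S :: "'g set" and v0 :: 'v and F :: "'v set"
  assumes steps: "simply_connected_steps G S"
    and v0: "v0 \<in> V" and F: "F \<subseteq> V" "finite F"
    and F_connected: "\<And>x. x \<in> F \<Longrightarrow> \<exists>p. edge_path V E p \<and> set p \<subseteq> F \<and> hd p = v0 \<and> last p = x"
    and S_F: "\<And>s. s \<in> S \<Longrightarrow> \<phi> s v0 \<in> F"
begin

text \<open>The relation \<open>g \<in> P y\<close> means \<open>y \<in> gF\<close>, and \<open>vx y g\<close> is the vertex over \<open>y\<close> that lies in
  the copy of \<open>F\<close> with index \<open>g\<close>.\<close>

definition P :: "'v \<Rightarrow> 'g set" where
  "P y = {g \<in> carrier G. \<phi> (inv g) y \<in> F}"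

definition step :: "('g \<times> 'g) set" where
  "step = {(g, g'). g \<in> carrier G \<and> g' \<in> carrier G \<and> inv g \<otimes> g' \<in> S}"

definition compo :: "'g set \<Rightarrow> 'g \<Rightarrow> 'g set" where
  "compo A g = {h. (g, h) \<in> (step \<inter> A \<times> A)\<^sup>*}"

definition vx :: "'v \<Rightarrow> 'g \<Rightarrow> 'v \<times> 'g set" where
  "vx y g = (y, compo (P y) g)"

definition V' :: "('v \<times> 'g set) set" where
  "V' = {vx y g | y g. y \<in> V \<and> g \<in> P y}"

definition E' :: "('v \<times> 'g set) set set" where
  "E' = {{vx y g, vx z g} | y z g. {y, z} \<in> E \<and> g \<in> P y \<and> g \<in> P z}"

definition act' :: "'g \<Rightarrow> 'v \<times> 'g set \<Rightarrow> 'v \<times> 'g set" where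
  "act' h = restrict (\<lambda>(y, C). (\<phi> h y, (\<otimes>) h ` C)) V'"

lemma S: "finite S" "S \<subseteq> carrier G" "\<one> \<in> S" "s \<in> S \<Longrightarrow> inv s \<in> S"
  using steps by (auto simp: simply_connected_steps_def)

lemma steps_induct:
  assumes "Q \<one>" "\<And>g s. g \<in> carrier G \<Longrightarrow> s \<in> S \<Longrightarrow> Q g \<Longrightarrow> Q (g \<otimes> s)" "g \<in> carrier G"
  shows "Q g"
proof -
  have "\<forall>Q. Q \<one> \<and> (\<forall>g\<in>carrier G. \<forall>s\<in>S. Q g \<longrightarrow> Q (g \<otimes> s)) \<longrightarrow> (\<forall>g\<in>carrier G. Q g)"
    using steps unfolding simply_connected_steps_def by (elim conjE)
  then show ?thesis using assms by blast
qed

lemma steps_cocycle: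
  assumes "\<And>g s t. g \<in> carrier G \<Longrightarrow> s \<in> S \<Longrightarrow> t \<in> S \<Longrightarrow> s \<otimes> t \<in> S \<Longrightarrow>
     \<epsilon> g (g \<otimes> (s \<otimes> t)) = (\<epsilon> g (g \<otimes> s) \<noteq> \<epsilon> (g \<otimes> s) (g \<otimes> (s \<otimes> t)))"
  shows "\<exists>\<kappa> :: 'g \<Rightarrow> bool. \<forall>g\<in>carrier G. \<forall>s\<in>S. \<epsilon> g (g \<otimes> s) = (\<kappa> g \<noteq> \<kappa> (g \<otimes> s))"
proof -
  have "\<forall>\<epsilon>. (\<forall>g\<in>carrier G. \<forall>s\<in>S. \<forall>t\<in>S. s \<otimes> t \<in> S \<longrightarrow>
            \<epsilon> g (g \<otimes> (s \<otimes> t)) = (\<epsilon> g (g \<otimes> s) \<noteq> \<epsilon> (g \<otimes> s) (g \<otimes> (s \<otimes> t)))) \<longrightarrow>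
       (\<exists>\<kappa> :: 'g \<Rightarrow> bool. \<forall>g\<in>carrier G. \<forall>s\<in>S. \<epsilon> g (g \<otimes> s) = (\<kappa> g \<noteq> \<kappa> (g \<otimes> s)))"
    using steps unfolding simply_connected_steps_def by (elim conjE)
  note this[rule_format, of \<epsilon>]
  then show ?thesis using assms by blast
qed

lemma stepE: "(g, g') \<in> step \<Longrightarrow> g \<in> carrier G \<and> g' \<in> carrier G \<and> inv g \<otimes> g' \<in> S \<and> g' = g \<otimes> (inv g \<otimes> g')"
  by (auto simp: step_def m_assoc[symmetric])

lemma step_mult: "g \<in> carrier G \<Longrightarrow> s \<in> S \<Longrightarrow> (g, g \<otimes> s) \<in> step"
  using S(2) by (auto simp: step_def m_assoc[symmetric] subsetD)

lemma step_sym: "(g, g') \<in> step \<Longrightarrow> (g', g) \<in> step"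
  using S(4)[of "inv g \<otimes> g'"] by (auto simp: step_def inv_mult_group)

lemma step_translate:
  assumes "h \<in> carrier G" "(g, g') \<in> step" shows "(h \<otimes> g, h \<otimes> g') \<in> step"
proof -
  have c: "g \<in> carrier G" "g' \<in> carrier G" using assms by (auto simp: step_def)
  have "inv h \<otimes> (h \<otimes> g') = g'" using assms(1) c by (simp add: m_assoc[symmetric])
  then have "inv (h \<otimes> g) \<otimes> (h \<otimes> g') = inv g \<otimes> g'"
    using assms(1) c by (simp add: inv_mult_group m_assoc)
  then show ?thesis using assms by (simp add: step_def)
qed

lemma v0_F: "v0 \<in> F"
  using S_F[OF S(3)] act_one v0 by simp

lemma P_carrier: "g \<in> P y \<Longrightarrow> g \<in> carrier G"
  by (simp add: P_def)

lemma P_translate: "h \<in> carrier G \<Longrightarrow> g \<in> carrier G \<Longrightarrow> y \<in> V \<Longrightarrow> h \<otimes> g \<in> P (\<phi> h y) \<longleftrightarrow> g \<in> P y"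
  by (simp add: P_def inv_mult_group composition_rule act_closed act_inv)

text \<open>Since \<open>S v0\<close> lies in \<open>F\<close>, the base vertex of the copy
  \<open>g'\<close> also belongs to the adjacent copy \<open>g\<close>. Adjacent copies are compared
  at this vertex in \<open>exists_cut\<close> and joined at it in \<open>connected'\<close>.\<close>

lemma P_step: "(g, g') \<in> step \<Longrightarrow> g \<in> P (\<phi> g' v0) \<and> g' \<in> P (\<phi> g' v0)"
  using S_F[of "inv g \<otimes> g'"] v0_F v0 act_inv
  by (auto simp: P_def step_def composition_rule)

lemma P_mem: "g \<in> carrier G \<Longrightarrow> x \<in> F \<Longrightarrow> g \<in> P (\<phi> g x)"
  using F(1) by (auto simp: P_def act_inv subsetD)

section \<open>Components in the Cayley graph and the vertices they define\<close>

lemma compo_self: "g \<in> compo A g"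
  by (simp add: compo_def)

lemma compo_subset: "g \<in> A \<Longrightarrow> compo A g \<subseteq> A"
  by (auto simp: compo_def elim: rtranclE)

lemma compo_eq:
  assumes "h \<in> compo A g" shows "compo A h = compo A g"
proof -
  have "sym (step \<inter> A \<times> A)" using step_sym by (auto simp: sym_def)
  then have "(h, g) \<in> (step \<inter> A \<times> A)\<^sup>*"
    using assms sym_rtrancl symD unfolding compo_def by (metis mem_Collect_eq)
  then show ?thesis using assms unfolding compo_def by (auto intro: rtrancl_trans)
qed

lemma compo_step: "h \<in> compo A g \<Longrightarrow> (h, h') \<in> step \<Longrightarrow> h \<in> A \<Longrightarrow> h' \<in> A \<Longrightarrow> h' \<in> compo A g"
  unfolding compo_def by (auto intro: rtrancl_into_rtrancl)

lemma compo_mono: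
  assumes "A \<subseteq> B" shows "compo A g \<subseteq> compo B g"
proof -
  have "(step \<inter> A \<times> A)\<^sup>* \<subseteq> (step \<inter> B \<times> B)\<^sup>*" by (rule rtrancl_mono) (use assms in auto)
  then show ?thesis unfolding compo_def by blast
qed

lemma compo_translate_subset:
  assumes "h \<in> carrier G" "x \<in> compo A g"
  shows "h \<otimes> x \<in> compo ((\<otimes>) h ` A) (h \<otimes> g)"
proof -
  have "(g, x) \<in> (step \<inter> A \<times> A)\<^sup>*" using assms by (simp add: compo_def)
  then have "(h \<otimes> g, h \<otimes> x) \<in> (step \<inter> ((\<otimes>) h ` A) \<times> ((\<otimes>) h ` A))\<^sup>*"
  proof induction
    case (step x y)
    then have "(h \<otimes> x, h \<otimes> y) \<in> step \<inter> ((\<otimes>) h ` A) \<times> ((\<otimes>) h ` A)"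
      using step_translate assms(1) by auto
    then show ?case using step.IH by (auto intro: rtrancl_into_rtrancl)
  qed auto
  then show ?thesis by (simp add: compo_def)
qed

lemma compo_translate:
  assumes "h \<in> carrier G" "A \<subseteq> carrier G" "g \<in> A"
  shows "(\<otimes>) h ` compo A g = compo ((\<otimes>) h ` A) (h \<otimes> g)"
proof
  have hh: "inv h \<otimes> (h \<otimes> x) = x" if "x \<in> A" for x
    using that assms by (simp add: m_assoc[symmetric] subsetD)
  show "(\<otimes>) h ` compo A g \<subseteq> compo ((\<otimes>) h ` A) (h \<otimes> g)"
    using compo_translate_subset assms by blast
  show "compo ((\<otimes>) h ` A) (h \<otimes> g) \<subseteq> (\<otimes>) h ` compo A g"
  proof
    fix x assume x: "x \<in> compo ((\<otimes>) h ` A) (h \<otimes> g)"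
    then have "x \<in> (\<otimes>) h ` A" using compo_subset[of "h \<otimes> g" "(\<otimes>) h ` A"] assms by auto
    then obtain a where a: "x = h \<otimes> a" "a \<in> A" by blast
    have "(\<otimes>) (inv h) ` (\<otimes>) h ` A = A"
      using hh by (force simp: image_image)
    then have "inv h \<otimes> x \<in> compo A g"
      using compo_translate_subset[OF _ x, of "inv h"] assms hh by auto
    then show "x \<in> (\<otimes>) h ` compo A g" using a hh by auto
  qed
qed

lemma vx_eq_iff: "g \<in> P y \<Longrightarrow> g' \<in> P y' \<Longrightarrow> vx y g = vx y' g' \<longleftrightarrow> y = y' \<and> g' \<in> compo (P y) g"
  unfolding vx_def using compo_eq compo_self by blast

lemma vx_V': "y \<in> V \<Longrightarrow> g \<in> P y \<Longrightarrow> vx y g \<in> V'"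
  by (auto simp: V'_def)

lemma V'E: assumes "v \<in> V'" obtains y g where "v = vx y g" "y \<in> V" "g \<in> P y" "g \<in> carrier G"
  using assms P_carrier by (auto simp: V'_def)

lemma E'I: "{y, z} \<in> E \<Longrightarrow> g \<in> P y \<Longrightarrow> g \<in> P z \<Longrightarrow> {vx y g, vx z g} \<in> E'"
  by (auto simp: E'_def)

lemma E'E:
  assumes "e \<in> E'"
  obtains y z g where "e = {vx y g, vx z g}" "{y, z} \<in> E" "y \<in> V" "z \<in> V" "g \<in> P y" "g \<in> P z" "g \<in> carrier G"
  using assms P_carrier T.edge_in_V unfolding E'_def by blast

lemma act'_vx:
  assumes "h \<in> carrier G" "y \<in> V" "g \<in> P y"
  shows "act' h (vx y g) = vx (\<phi> h y) (h \<otimes> g)"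
proof -
  have "(\<otimes>) h ` P y = P (\<phi> h y)"
  proof
    show "(\<otimes>) h ` P y \<subseteq> P (\<phi> h y)" using assms P_translate P_carrier by blast
    show "P (\<phi> h y) \<subseteq> (\<otimes>) h ` P y"
    proof
      fix x assume x: "x \<in> P (\<phi> h y)"
      have c: "x \<in> carrier G" using x P_carrier by blast
      then have e: "x = h \<otimes> (inv h \<otimes> x)" using assms by (simp add: m_assoc[symmetric])
      then have "inv h \<otimes> x \<in> P y"
        using x P_translate[of h "inv h \<otimes> x" y] assms c by simp
      then show "x \<in> (\<otimes>) h ` P y" using e by blast
    qed
  qed
  moreover have "P y \<subseteq> carrier G" using P_carrier by blast
  ultimately have "(\<otimes>) h ` compo (P y) g = compo (P (\<phi> h y)) (h \<otimes> g)"
    using compo_translate assms by metis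
  then show ?thesis using vx_V'[OF assms(2,3)] by (simp add: act'_def vx_def)
qed

text \<open>Copies of \<open>F\<close> are convex. An edge separating two vertices of
  \<open>F\<close> separates \<open>v0\<close> from one of them, and a path inside \<open>F\<close>
  from \<open>v0\<close> to that vertex has to cross it.\<close>

lemma P_walls:
  assumes "{y, z} \<in> T.walls x w" "x \<in> V" "w \<in> V" "g \<in> P x" "g \<in> P w"
  shows "g \<in> P y" "g \<in> P z"
proof -
  have F_walls: "e \<subseteq> F" if e: "e \<in> T.walls a b" "a \<in> F" "b \<in> F" for e a b
  proof -
    have "e \<in> T.walls v0 a \<or> e \<in> T.walls v0 b"
      using e(1) T.walls_triangle[of a b v0] T.walls_commute[of v0 a] by blast
    then obtain c where c: "c \<in> F" "e \<in> T.walls v0 c" using e by blast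
    then obtain p where p: "edge_path V E p" "set p \<subseteq> F" "hd p = v0" "last p = c"
      using F_connected by metis
    have "e \<in> path_edges p"
      using c(2) is_cut_path[OF p(1) T.is_cut_cut] p unfolding T.walls_def by blast
    then show ?thesis using path_edges_subset_set p(2) by blast
  qed
  have yz: "y \<in> V" "z \<in> V" using assms(1) T.walls_subset T.edge_in_V by blast+
  have g: "g \<in> carrier G" using assms P_carrier by blast
  have "{\<phi> (inv g) y, \<phi> (inv g) z} \<in> T.walls (\<phi> (inv g) x) (\<phi> (inv g) w)"
    using mem_walls_act[of "inv g" x w y z] assms yz g by simp
  then have "{\<phi> (inv g) y, \<phi> (inv g) z} \<subseteq> F"
    using F_walls assms(4,5) by (auto simp: P_def)
  then show "g \<in> P y" "g \<in> P z" using g by (auto simp: P_def)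
qed

text \<open>Let \<open>B\<close> be the component that defines the edge and let \<open>\<sigma>\<close> colour \<open>T\<close> across \<open>{y, z}\<close>.
  On the copy with index \<open>g\<close> the colouring is \<open>\<sigma>\<close> if \<open>g \<in> B\<close> and constant otherwise, up to a
  swap \<open>\<kappa> g\<close> of the colours. Two adjacent copies determine each other's swap, because \<open>\<sigma>\<close> is
  constant on their overlap unless both or none of them contain the edge.\<close>

lemma exists_cut:
  assumes yz: "{y, z} \<in> E" and g0: "g0 \<in> P y" "g0 \<in> P z"
  shows "\<exists>c. is_cut E' {vx y g0, vx z g0} c"
    and "g \<in> P y \<Longrightarrow> g \<in> P z \<Longrightarrow> vx y g = vx y g0 \<Longrightarrow> vx z g = vx z g0 \<Longrightarrow> g \<in> compo (P y \<inter> P z) g0"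
proof -
  define B where "B = compo (P y \<inter> P z) g0"
  define \<sigma> where "\<sigma> = T.cut {y, z}"
  have \<sigma>: "is_cut E {y, z} \<sigma>" unfolding \<sigma>_def by (rule T.is_cut_cut[OF yz])
  have B_sub: "B \<subseteq> P y" "B \<subseteq> P z" using compo_subset[of g0 "P y \<inter> P z"] g0 by (auto simp: B_def)
  \<comment> \<open>Records whether the unswapped colourings of the two copies disagree, tested at
    one vertex of the overlap; by \<open>eps\<close> every common vertex gives the same
    answer.\<close>
  define \<epsilon> where "\<epsilon> g g' \<longleftrightarrow> ((g \<in> B \<and> \<sigma> (\<phi> g' v0)) \<noteq> (g' \<in> B \<and> \<sigma> (\<phi> g' v0)))" for g g'
  have eps: "((g \<in> B \<and> \<sigma> w) \<noteq> (g' \<in> B \<and> \<sigma> w)) \<longleftrightarrow> \<epsilon> g g'"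
    if s: "(g, g') \<in> step" and w: "w \<in> V" "g \<in> P w" "g' \<in> P w" for g g' w
  proof (cases "\<sigma> w = \<sigma> (\<phi> g' v0)")
    case False
    have x: "g \<in> P (\<phi> g' v0)" "g' \<in> P (\<phi> g' v0)" "\<phi> g' v0 \<in> V"
      using P_step[OF s] stepE[OF s] act_closed v0 by auto
    have "{y, z} \<in> T.walls w (\<phi> g' v0)"
      using False yz by (simp add: T.walls_def \<sigma>_def)
    then have "g \<in> P y \<inter> P z" "g' \<in> P y \<inter> P z"
      using P_walls[of y z w "\<phi> g' v0"] x w by auto
    then have "g \<in> B \<longleftrightarrow> g' \<in> B"
      using compo_step s step_sym unfolding B_def by metis
    then show ?thesis by (simp add: \<epsilon>_def)
  qed (simp add: \<epsilon>_def)
  have "\<exists>\<kappa> :: 'g \<Rightarrow> bool. \<forall>g\<in>carrier G. \<forall>s\<in>S. \<epsilon> g (g \<otimes> s) = (\<kappa> g \<noteq> \<kappa> (g \<otimes> s))"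
  proof (rule steps_cocycle)
    fix g s t assume g: "g \<in> carrier G" and st: "s \<in> S" "t \<in> S" "s \<otimes> t \<in> S"
    have 1: "(g, g \<otimes> s) \<in> step" using step_mult g st by simp
    have 2: "(g \<otimes> s, g \<otimes> (s \<otimes> t)) \<in> step"
      using step_mult[of "g \<otimes> s" t] g st S(2) by (simp add: m_assoc subsetD)
    have 3: "(g, g \<otimes> (s \<otimes> t)) \<in> step" using step_mult g st by simp
    \<comment> \<open>The base vertex of the last copy lies in all three copies. With the three
      disagreements tested there, the cocycle identity is propositional.\<close>
    let ?w = "\<phi> (g \<otimes> (s \<otimes> t)) v0"
    have w: "?w \<in> V" "g \<in> P ?w" "g \<otimes> s \<in> P ?w" "g \<otimes> (s \<otimes> t) \<in> P ?w"
      using P_step[OF 2] P_step[OF 3] stepE[OF 3] act_closed v0 by blast+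
    show "\<epsilon> g (g \<otimes> (s \<otimes> t)) = (\<epsilon> g (g \<otimes> s) \<noteq> \<epsilon> (g \<otimes> s) (g \<otimes> (s \<otimes> t)))"
      using eps[OF 1 w(1-3)] eps[OF 2 w(1,3,4)] eps[OF 3 w(1,2,4)] by blast
  qed
  then obtain \<kappa> :: "'g \<Rightarrow> bool" where "\<forall>g\<in>carrier G. \<forall>s\<in>S. \<epsilon> g (g \<otimes> s) = (\<kappa> g \<noteq> \<kappa> (g \<otimes> s))" ..
  then have \<kappa>: "\<epsilon> g (g \<otimes> s) = (\<kappa> g \<noteq> \<kappa> (g \<otimes> s))" if "g \<in> carrier G" "s \<in> S" for g s
    using that by blast
  have \<kappa>_step: "\<epsilon> g g' = (\<kappa> g \<noteq> \<kappa> g')" if "(g, g') \<in> step" for g g'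
    using \<kappa>[of g "inv g \<otimes> g'"] stepE[OF that] by metis
  \<comment> \<open>A vertex of \<open>T'\<close> is coloured through an arbitrary copy in its
    component. Adjacent copies containing \<open>w\<close> agree by \<open>eps\<close> and
    \<open>\<kappa>_step\<close>, so the choice is immaterial.\<close>
  define c where "c = (\<lambda>(w, C). let h = SOME h. h \<in> C in \<kappa> h \<noteq> (h \<in> B \<and> \<sigma> w))"
  have c: "c (vx w g) \<longleftrightarrow> \<kappa> g \<noteq> (g \<in> B \<and> \<sigma> w)" if w: "w \<in> V" "g \<in> P w" for w g
  proof -
    have const: "(\<kappa> h \<noteq> (h \<in> B \<and> \<sigma> w)) \<longleftrightarrow> (\<kappa> g \<noteq> (g \<in> B \<and> \<sigma> w))" if h: "h \<in> compo (P w) g" for h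
    proof -
      have "(g, h) \<in> (step \<inter> P w \<times> P w)\<^sup>*" using h by (simp add: compo_def)
      then show ?thesis
      proof induction
        case (step h h')
        then have s: "(h, h') \<in> local.step" "h \<in> P w" "h' \<in> P w" by auto
        show ?case using eps[OF s(1) w(1) s(2,3)] \<kappa>_step[OF s(1)] step.IH by blast
      qed simp
    qed
    have "(SOME h. h \<in> compo (P w) g) \<in> compo (P w) g" using compo_self by (rule someI)
    then show ?thesis using const by (simp add: c_def vx_def Let_def)
  qed
  have V: "y \<in> V" "z \<in> V" using T.edge_in_V yz by blast+
  have \<sigma>yz: "\<sigma> y \<noteq> \<sigma> z" using \<sigma> yz by (simp add: is_cut_def)
  have g0B: "g0 \<in> B" by (simp add: B_def compo_self)
  have c0: "c (vx y g0) \<noteq> c (vx z g0)" using c V g0 g0B \<sigma>yz by simp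
  \<comment> \<open>The colouring changes on the copy \<open>g\<close> only if
    \<open>g \<in> B\<close>. Hence distinct components of \<open>P y \<inter> P z\<close> never
    give the same pair of ends, although the ends only see the larger components of
    \<open>P y\<close> and \<open>P z\<close>.\<close>
  show "g \<in> compo (P y \<inter> P z) g0"
    if g: "g \<in> P y" "g \<in> P z" "vx y g = vx y g0" "vx z g = vx z g0"
  proof -
    have "c (vx y g) \<noteq> c (vx z g)" using c0 g by simp
    then have "g \<in> B" using c[of y g] c[of z g] g V by auto
    then show ?thesis by (simp add: B_def)
  qed
  show "\<exists>c. is_cut E' {vx y g0, vx z g0} c"
  proof (intro exI[of _ c], unfold is_cut_def, intro allI impI)
    fix u v assume "{u, v} \<in> E'"
    then obtain a b h where uv: "{u, v} = {vx a h, vx b h}" and ab: "{a, b} \<in> E" "a \<in> V" "b \<in> V"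
      and h: "h \<in> P a" "h \<in> P b" "h \<in> carrier G" by (rule E'E)
    have "c u \<noteq> c v \<longleftrightarrow> c (vx a h) \<noteq> c (vx b h)" using uv by (auto simp: doubleton_eq_iff)
    also have "\<dots> \<longleftrightarrow> h \<in> B \<and> \<sigma> a \<noteq> \<sigma> b" using c ab h by auto
    also have "\<dots> \<longleftrightarrow> h \<in> B \<and> {a, b} = {y, z}" using \<sigma> ab by (simp add: is_cut_def)
    also have "\<dots> \<longleftrightarrow> {vx a h, vx b h} = {vx y g0, vx z g0}"
    proof
      assume L: "h \<in> B \<and> {a, b} = {y, z}"
      have "h \<in> compo (P y) g0" "h \<in> compo (P z) g0"
        using L compo_mono[of "P y \<inter> P z"] unfolding B_def by blast+
      then have "vx y h = vx y g0" "vx z h = vx z g0" by (simp_all add: vx_def compo_eq)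
      then show "{vx a h, vx b h} = {vx y g0, vx z g0}" using L by (auto simp: doubleton_eq_iff)
    next
      assume R: "{vx a h, vx b h} = {vx y g0, vx z g0}"
      then have "c (vx a h) \<noteq> c (vx b h)" using c0 by (auto simp: doubleton_eq_iff)
      then have "h \<in> B \<and> \<sigma> a \<noteq> \<sigma> b" using c ab h by auto
      then show "h \<in> B \<and> {a, b} = {y, z}" using \<sigma> ab by (simp add: is_cut_def)
    qed
    finally show "c u \<noteq> c v \<longleftrightarrow> {u, v} = {vx y g0, vx z g0}" using uv by simp
  qed
qed

section \<open>The resolution as a tree with an action\<close>

lemma simplicial': "simplicial_graph V' E'"
proof -
  have "card e = 2 \<and> e \<subseteq> V'" if "e \<in> E'" for e
  proof -
    obtain y z g where e: "e = {vx y g, vx z g}" "{y, z} \<in> E" "y \<in> V" "z \<in> V" "g \<in> P y" "g \<in> P z" "g \<in> carrier G"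
      using \<open>e \<in> E'\<close> by (rule E'E)
    then have "vx y g \<noteq> vx z g" using T.edge_neq by (auto simp: vx_def)
    then show ?thesis using e vx_V' by auto
  qed
  then show ?thesis by (simp add: simplicial_graph_def)
qed

text \<open>Inside one copy follow a path of \<open>F\<close>. The copies \<open>g\<close> and
  \<open>g \<otimes> s\<close> share the vertex of \<open>T'\<close> over
  \<open>\<phi> (g \<otimes> s) v0\<close>, so induction on steps reaches every copy from the one
  with index \<open>\<one>\<close>.\<close>

lemma connected': "graph_connected V' E'"
proof -
  have A: "(vx (\<phi> g v0) g, vx (\<phi> g x) g) \<in> (adjacency E')\<^sup>*" if g: "g \<in> carrier G" and x: "x \<in> F" for g x
  proof -
    obtain p where p: "edge_path V E p" "set p \<subseteq> F" "hd p = v0" "last p = x"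
      using F_connected x by metis
    have "(vx (\<phi> g (hd p)) g, vx (\<phi> g (last p)) g) \<in> (adjacency E')\<^sup>*"
      using p(1,2)
    proof (induction p)
      case (Cons a p)
      show ?case
      proof (cases "p = []")
        case False
        then have e: "{a, hd p} \<in> E" "a \<in> F" "hd p \<in> F" "edge_path V E p" "set p \<subseteq> F"
          using Cons.prems by (auto simp: edge_path_Cons)
        then have "{vx (\<phi> g a) g, vx (\<phi> g (hd p)) g} \<in> E'"
          using g act_edge P_mem by (intro E'I) auto
        then have "(vx (\<phi> g a) g, vx (\<phi> g (hd p)) g) \<in> adjacency E'" by simp
        then show ?thesis using Cons.IH e False by (auto intro: converse_rtrancl_into_rtrancl)
      qed auto
    qed (simp add: edge_path_def)
    then show ?thesis using p by simp
  qed
  have B: "(vx v0 \<one>, vx (\<phi> g v0) g) \<in> (adjacency E')\<^sup>*" if "g \<in> carrier G" for g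
    using _ _ that
  proof (rule steps_induct)
    show "(vx v0 \<one>, vx (\<phi> \<one> v0) \<one>) \<in> (adjacency E')\<^sup>*" using act_one v0 by simp
    fix g s assume g: "g \<in> carrier G" and s: "s \<in> S"
      and IH: "(vx v0 \<one>, vx (\<phi> g v0) g) \<in> (adjacency E')\<^sup>*"
    have st: "(g, g \<otimes> s) \<in> step" using step_mult g s by simp
    have 1: "vx (\<phi> (g \<otimes> s) v0) g = vx (\<phi> (g \<otimes> s) v0) (g \<otimes> s)"
      using P_step[OF st] compo_step[OF compo_self st] vx_eq_iff by auto
    have 2: "\<phi> (g \<otimes> s) v0 = \<phi> g (\<phi> s v0)"
      using composition_rule[OF v0 g subsetD[OF S(2) s]] .
    show "(vx v0 \<one>, vx (\<phi> (g \<otimes> s) v0) (g \<otimes> s)) \<in> (adjacency E')\<^sup>*"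
      using rtrancl_trans[OF IH A[OF g S_F[OF s]]] unfolding 1[symmetric] unfolding 2 .
  qed
  have C: "(vx v0 \<one>, v) \<in> (adjacency E')\<^sup>*" if v: "v \<in> V'" for v
  proof -
    obtain y g where y: "v = vx y g" "y \<in> V" "g \<in> P y" "g \<in> carrier G" using v by (rule V'E)
    then have "(vx (\<phi> g v0) g, vx (\<phi> g (\<phi> (inv g) y)) g) \<in> (adjacency E')\<^sup>*"
      using A by (simp add: P_def)
    then show ?thesis using B y act_inv' by (auto intro: rtrancl_trans)
  qed
  show ?thesis unfolding graph_connected_iff[OF simplicial']
    by (intro ballI rtrancl_trans[OF sym_adjacency_rtrancl[OF C] C])
qed

lemma tree': "is_tree V' E'"
proof (rule cuts_imp_tree)
  have "vx v0 \<one> \<in> V'" using P_mem[of \<one> v0] v0_F v0 act_one by (intro vx_V') auto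
  then show "V' \<noteq> {}" by blast
  show "\<exists>c. is_cut E' e c" if "e \<in> E'" for e
    using that exists_cut(1) by (metis E'E)
qed (rule simplicial' connected')+

lemma group_action': "group_action G V' act'"
proof (rule group_actionI)
  show "group G" by (rule is_group)
  show "act' g \<in> extensional V'" for g by (simp add: act'_def)
  fix x assume x: "x \<in> V'"
  then obtain y k where y: "x = vx y k" "y \<in> V" "k \<in> P y" "k \<in> carrier G" by (rule V'E)
  show "act' \<one> x = x" using y act'_vx act_one by simp
  fix g assume g: "g \<in> carrier G"
  show "act' g x \<in> V'" using y g act'_vx P_translate act_closed vx_V' by simp
  fix h assume h: "h \<in> carrier G"
  show "act' (g \<otimes> h) x = act' g (act' h x)"
    using y g h act'_vx P_translate act_closed composition_rule by (simp add: m_assoc)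
qed

lemma act'_edge:
  assumes "h \<in> carrier G" "{y, z} \<in> E" "g \<in> P y" "g \<in> P z"
  shows "act' h ` {vx y g, vx z g} = {vx (\<phi> h y) (h \<otimes> g), vx (\<phi> h z) (h \<otimes> g)}"
  using assms T.edge_in_V[OF assms(2)] act'_vx by simp

lemma tree_action': "tree_action G V' E' act'"
proof -
  interpret A: group_action G V' act' by (rule group_action')
  show ?thesis
  proof
    show "is_tree V' E'" by (rule tree')
    fix g assume g: "g \<in> carrier G"
    show "act' g ` e \<in> E'" if "e \<in> E'" for e
    proof -
      obtain y z h where e: "e = {vx y h, vx z h}" "{y, z} \<in> E" "y \<in> V" "z \<in> V"
        "h \<in> P y" "h \<in> P z" "h \<in> carrier G" using \<open>e \<in> E'\<close> by (rule E'E)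
      have "{vx (\<phi> g y) (g \<otimes> h), vx (\<phi> g z) (g \<otimes> h)} \<in> E'"
        using g e P_translate act_edge by (intro E'I) auto
      then show ?thesis
        unfolding e(1) using act'_edge[OF g e(2,5,6)] by simp
    qed
    show "\<not> (act' g u = v \<and> act' g v = u)" if "{u, v} \<in> E'" for u v
    proof -
      obtain y z h where e: "{u, v} = {vx y h, vx z h}" "{y, z} \<in> E" "y \<in> V" "z \<in> V"
        "h \<in> P y" "h \<in> P z" "h \<in> carrier G" using \<open>{u, v} \<in> E'\<close> by (rule E'E)
      have "\<not> (act' g (vx y h) = vx z h \<and> act' g (vx z h) = vx y h)"
        using act'_vx g e no_inversion[OF g e(2)] by (auto simp: vx_def)
      then show ?thesis using e(1) by (auto simp: doubleton_eq_iff)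
    qed
  qed
qed

lemma fst_V': "v \<in> V' \<Longrightarrow> fst v \<in> V"
  by (auto simp: V'_def vx_def)

lemma fst_act': "g \<in> carrier G \<Longrightarrow> v \<in> V' \<Longrightarrow> fst (act' g v) = \<phi> g (fst v)"
  by (auto simp: act'_def case_prod_unfold)

lemma fst_E': "e \<in> E' \<Longrightarrow> fst ` e \<in> E"
  by (auto simp: E'_def vx_def)

lemma cofinite_edges':
  "\<exists>R. finite R \<and> R \<subseteq> E' \<and> (\<forall>e\<in>E'. \<exists>g\<in>carrier G. \<exists>r\<in>R. e = act' g ` r)"
proof (intro exI conjI ballI)
  let ?R = "{{vx y \<one>, vx z \<one>} | y z. y \<in> F \<and> z \<in> F \<and> {y, z} \<in> E}"
  have "?R \<subseteq> (\<lambda>(y, z). {vx y \<one>, vx z \<one>}) ` (F \<times> F)" by auto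
  then show "finite ?R" by (rule finite_subset) (simp add: F(2))
  have one: "\<one> \<in> P y" if "y \<in> F" for y
    using P_mem[of \<one> y] that F(1) act_one by auto
  then have "{vx y \<one>, vx z \<one>} \<in> E'" if "y \<in> F" "z \<in> F" "{y, z} \<in> E" for y z
    using E'I that by simp
  then show "?R \<subseteq> E'" by auto
  fix e assume "e \<in> E'"
  then obtain y z g where e: "e = {vx y g, vx z g}" "{y, z} \<in> E" "y \<in> V" "z \<in> V"
    "g \<in> P y" "g \<in> P z" "g \<in> carrier G" by (rule E'E)
  let ?y = "\<phi> (inv g) y" and ?z = "\<phi> (inv g) z"
  have yz: "?y \<in> F" "?z \<in> F" "{?y, ?z} \<in> E" using e act_edge by (auto simp: P_def)
  then have "e = act' g ` {vx ?y \<one>, vx ?z \<one>}"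
    using act'_edge[OF e(7) yz(3)] one e act_inv' by simp
  moreover have "{vx ?y \<one>, vx ?z \<one>} \<in> ?R" using yz by auto
  ultimately show "\<exists>g\<in>carrier G. \<exists>r\<in>?R. e = act' g ` r" using e(7) by (intro bexI)
qed

text \<open>The stabiliser acts on the component of \<open>P y \<inter> P z\<close> that defines the
  edge. The label of \<open>d\<close> is the position of \<open>(y, z)\<close> in \<open>F\<close>
  as seen from the copy \<open>d\<close>: finitely many labels occur, and copies with equal labels
  differ by an element of the stabiliser.\<close>

lemma fg_edge_stabs': "fg_edge_stabs G E' act'"
  unfolding fg_edge_stabs_def
proof
  interpret A: tree_action G V' E' act' by (rule tree_action')
  fix e assume eE: "e \<in> E'"
  then obtain y z g where e: "e = {vx y g, vx z g}" "{y, z} \<in> E" "y \<in> V" "z \<in> V"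
    "g \<in> P y" "g \<in> P z" "g \<in> carrier G" by (rule E'E)
  let ?H = "edge_stab G act' e" and ?D = "compo (P y \<inter> P z) g"
  let ?l = "\<lambda>d. (\<phi> (inv d) y, \<phi> (inv d) z)"
  have H: "?H = {h \<in> carrier G. act' h (vx y g) = vx y g \<and> act' h (vx z g) = vx z g}"
    using A.edge_stab_eq eE unfolding e(1) by blast
  have D_sub: "?D \<subseteq> P y \<inter> P z" using e by (intro compo_subset) simp
  then have Dc: "?D \<subseteq> carrier G" using P_carrier by blast
  have D_vx: "vx y d = vx y g" "vx z d = vx z g" if "d \<in> ?D" for d
  proof -
    have "d \<in> compo (P y) g" "d \<in> compo (P z) g" using that compo_mono[of "P y \<inter> P z"] by blast+
    then show "vx y d = vx y g" "vx z d = vx z g" by (simp_all add: vx_def compo_eq)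
  qed
  show "fg_subgroup ?H G"
  proof (rule fg_subgroupI_connected[where D = "?D" and ?d0.0 = g and l = "?l" and S = S])
    show "subgroup ?H G" using A.edge_stab_subgroup eE by blast
    show "finite S" "S \<subseteq> carrier G" using S by auto
    show "?D \<subseteq> carrier G" by (rule Dc)
    show "g \<in> ?D" by (rule compo_self)
    show "(g, d) \<in> {(a, b). a \<in> ?D \<and> b \<in> ?D \<and> inv a \<otimes> b \<in> S}\<^sup>*" if "d \<in> ?D" for d
    proof -
      have "(g, d) \<in> (step \<inter> (P y \<inter> P z) \<times> (P y \<inter> P z))\<^sup>*" using that by (simp add: compo_def)
      then have "d \<in> ?D \<and> (g, d) \<in> {(a, b). a \<in> ?D \<and> b \<in> ?D \<and> inv a \<otimes> b \<in> S}\<^sup>*"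
      proof induction
        case (step a b)
        then have "b \<in> ?D" using compo_step by blast
        moreover have "inv a \<otimes> b \<in> S" using step(2) by (simp add: step_def)
        ultimately show ?case using step.IH by (auto intro: rtrancl_into_rtrancl)
      qed (simp add: compo_self)
      then show ?thesis ..
    qed
    show "finite (?l ` ?D)"
    proof (rule finite_subset)
      show "?l ` ?D \<subseteq> F \<times> F" using D_sub by (auto simp: P_def)
    qed (simp add: F(2))
    show "h \<otimes> d \<in> ?D \<and> ?l (h \<otimes> d) = ?l d" if h: "h \<in> ?H" and d: "d \<in> ?D" for h d
    proof -
      have hc: "h \<in> carrier G" and dc: "d \<in> carrier G" using h H d Dc by auto
      have dP: "d \<in> P y" "d \<in> P z" using d D_sub by auto
      have v: "act' h (vx y d) = vx y d" "act' h (vx z d) = vx z d" using h H D_vx[OF d] by auto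
      then have v': "vx (\<phi> h y) (h \<otimes> d) = vx y d" "vx (\<phi> h z) (h \<otimes> d) = vx z d"
        using act'_vx hc dP e by auto
      then have fx: "\<phi> h y = y" "\<phi> h z = z" by (auto simp: vx_def)
      then have hP: "h \<otimes> d \<in> P y" "h \<otimes> d \<in> P z"
        using P_translate[OF hc dc e(3)] P_translate[OF hc dc e(4)] dP by auto
      have "vx y (h \<otimes> d) = vx y g" "vx z (h \<otimes> d) = vx z g"
        using v' fx D_vx[OF d] by auto
      \<comment> \<open>Fixing both ends only gives membership in the components of
        \<open>P y\<close> and of \<open>P z\<close>; \<open>exists_cut(2)\<close> upgrades it to
        the component of the intersection.\<close>
      then have "h \<otimes> d \<in> ?D" using exists_cut(2)[OF e(2,5,6) hP] by blast
      moreover have "\<phi> (inv (h \<otimes> d)) x = \<phi> (inv d) x" if x: "x \<in> V" "\<phi> h x = x" for x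
      proof -
        have "\<phi> (inv h) x = x" using act_inv[OF hc x(1)] x(2) by simp
        then show ?thesis using composition_rule[of x "inv d" "inv h"] hc dc x by (simp add: inv_mult_group)
      qed
      ultimately show ?thesis using fx e by simp
    qed
    show "d' \<otimes> inv d \<in> ?H" if d: "d \<in> ?D" "d' \<in> ?D" "?l d = ?l d'" for d d'
    proof -
      have c: "d \<in> carrier G" "d' \<in> carrier G" using d Dc by auto
      have fx: "\<phi> (d' \<otimes> inv d) y = y" "\<phi> (d' \<otimes> inv d) z = z"
        using d(3) c e composition_rule[of y d' "inv d"] composition_rule[of z d' "inv d"] act_inv'
        by auto
      have dd: "d' \<otimes> inv d \<otimes> d = d'" using c by (simp add: m_assoc)
      have "d \<in> P y" "d \<in> P z" using d D_sub by auto
      then have "act' (d' \<otimes> inv d) (vx y d) = vx y d'" "act' (d' \<otimes> inv d) (vx z d) = vx z d'"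
        using act'_vx fx dd c e by auto
      then show ?thesis using H D_vx d c by simp
    qed
  qed
qed

end

section \<open>Renaming the vertices of a tree action\<close>

lemma (in simplicial_tree) is_tree_inj_image:
  assumes inj: "inj_on \<iota> V"
  shows "is_tree (\<iota> ` V) ((`) \<iota> ` E)"
proof (rule cuts_imp_tree)
  show "\<iota> ` V \<noteq> {}" using tree by (simp add: is_tree_def)
  show simp: "simplicial_graph (\<iota> ` V) ((`) \<iota> ` E)"
    unfolding simplicial_graph_def
  proof
    fix e assume "e \<in> (`) \<iota> ` E"
    then obtain d where d: "e = \<iota> ` d" "d \<in> E" by blast
    then have "d \<subseteq> V" "card d = 2" using simplicial by (auto simp: simplicial_graph_def)
    then show "e \<subseteq> \<iota> ` V \<and> card e = 2"
      using d(1) card_image[OF inj_on_subset[OF inj]] by auto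
  qed
  have "(\<iota> x, \<iota> y) \<in> (adjacency ((`) \<iota> ` E))\<^sup>*" if "(x, y) \<in> (adjacency E)\<^sup>*" for x y
    using that
  proof induction
    case (step y z)
    then have "{\<iota> y, \<iota> z} \<in> (`) \<iota> ` E" by (intro image_eqI[of _ _ "{y, z}"]) auto
    then show ?case using step.IH by (auto intro: rtrancl_into_rtrancl)
  qed auto
  then show "graph_connected (\<iota> ` V) ((`) \<iota> ` E)"
    unfolding graph_connected_iff[OF simp] using rtrancl_adjacency by blast
  fix e assume "e \<in> (`) \<iota> ` E"
  then obtain d where d: "e = \<iota> ` d" "d \<in> E" by blast
  have "is_cut ((`) \<iota> ` E) e (cut d \<circ> inv_into V \<iota>)"
    unfolding is_cut_def
  proof (intro allI impI)
    fix x y assume "{x, y} \<in> (`) \<iota> ` E"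
    then obtain c where c: "{x, y} = \<iota> ` c" "c \<in> E" by blast
    then obtain a b where ab: "c = {a, b}" "a \<in> V" "b \<in> V" using edge_obtain by metis
    have "{a, b} = d \<longleftrightarrow> \<iota> ` {a, b} = \<iota> ` d"
      using inj_on_image_eq_iff[OF inj, of "{a, b}" d] ab d(2) edge_subset by auto
    moreover have "cut d a \<noteq> cut d b \<longleftrightarrow> {a, b} = d"
      using is_cut_cut[OF d(2)] c(2) ab(1) by (simp add: is_cut_def)
    ultimately have "(cut d \<circ> inv_into V \<iota>) (\<iota> a) \<noteq> (cut d \<circ> inv_into V \<iota>) (\<iota> b) \<longleftrightarrow> \<iota> ` {a, b} = \<iota> ` d"
      using ab inj by simp
    moreover have "{x, y} = {\<iota> a, \<iota> b}" using c ab by simp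
    ultimately show "(cut d \<circ> inv_into V \<iota>) x \<noteq> (cut d \<circ> inv_into V \<iota>) y \<longleftrightarrow> {x, y} = e"
      using d(1) by (auto simp: doubleton_eq_iff)
  qed
  then show "\<exists>\<sigma>. is_cut ((`) \<iota> ` E) e \<sigma>" by blast
qed

lemma (in tree_action) tree_action_inj_image:
  assumes inj: "inj_on \<iota> V"
    and \<psi>_def: "\<psi> = (\<lambda>g. restrict (\<lambda>x. \<iota> (\<phi> g (inv_into V \<iota> x))) (\<iota> ` V))"
  shows "tree_action G (\<iota> ` V) ((`) \<iota> ` E) \<psi>"
    and "\<And>g x. x \<in> V \<Longrightarrow> \<psi> g (\<iota> x) = \<iota> (\<phi> g x)"
    and "\<And>g e. g \<in> carrier G \<Longrightarrow> e \<in> E \<Longrightarrow> \<psi> g ` \<iota> ` e = \<iota> ` \<phi> g ` e"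
    and "\<And>e. e \<in> E \<Longrightarrow> edge_stab G \<psi> (\<iota> ` e) = edge_stab G \<phi> e"
proof -
  show \<psi>: "\<psi> g (\<iota> x) = \<iota> (\<phi> g x)" if "x \<in> V" for g x
    using that inj by (simp add: \<psi>_def)
  show \<psi>e: "\<psi> g ` \<iota> ` e = \<iota> ` \<phi> g ` e" if "g \<in> carrier G" "e \<in> E" for g e
    using \<psi> T.edge_subset[OF that(2)] by (force simp: image_image subset_iff)
  show "edge_stab G \<psi> (\<iota> ` e) = edge_stab G \<phi> e" if e: "e \<in> E" for e
  proof -
    have "\<psi> g ` \<iota> ` e = \<iota> ` e \<longleftrightarrow> \<phi> g ` e = e" if g: "g \<in> carrier G" for g
      unfolding \<psi>e[OF g e] using inj_on_image_eq_iff[OF inj] edge_closed[OF g e] e T.edge_subset by metis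
    then show ?thesis unfolding stabilizer_def by blast
  qed
  have "group_action G (\<iota> ` V) \<psi>"
  proof (rule group_actionI)
    show "\<psi> g \<in> extensional (\<iota> ` V)" for g by (simp add: \<psi>_def)
  qed (auto simp: \<psi> act_closed act_one composition_rule)
  then interpret A: group_action G "\<iota> ` V" \<psi> .
  show "tree_action G (\<iota> ` V) ((`) \<iota> ` E) \<psi>"
  proof
    show "is_tree (\<iota> ` V) ((`) \<iota> ` E)" by (rule T.is_tree_inj_image[OF inj])
    fix g assume g: "g \<in> carrier G"
    show "\<psi> g ` e \<in> (`) \<iota> ` E" if "e \<in> (`) \<iota> ` E" for e
      using that \<psi>e g edge_closed by auto
    show "\<not> (\<psi> g u = v \<and> \<psi> g v = u)" if "{u, v} \<in> (`) \<iota> ` E" for u v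
    proof -
      obtain c where c: "{u, v} = \<iota> ` c" "c \<in> E" using \<open>{u, v} \<in> (`) \<iota> ` E\<close> by blast
      then obtain a b where ab: "c = {a, b}" "a \<in> V" "b \<in> V" using T.edge_obtain by metis
      have "\<not> (\<psi> g (\<iota> a) = \<iota> b \<and> \<psi> g (\<iota> b) = \<iota> a)"
        using \<psi> ab no_inversion[OF g, of a b] c(2) inj act_closed[OF g] by (auto dest: inj_onD)
      then show ?thesis using c(1) ab(1) by (auto simp: doubleton_eq_iff)
    qed
  qed
qed

lemma edge_path_prefix:
  assumes "edge_path V E p" "x \<in> set p"
  shows "\<exists>q. edge_path V E q \<and> set q \<subseteq> set p \<and> hd q = hd p \<and> last q = x"
proof -
  obtain r s where rs: "p = r @ x # s" using assms(2) by (meson split_list)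
  have "edge_path V E (r @ [x])"
    using assms(1) rs edge_path_append[of "r @ [x]" s V E] by (cases "s = []") auto
  then show ?thesis using rs by (intro exI[of _ "r @ [x]"]) (cases r; auto)
qed

text \<open>\<open>F\<close> is a union of paths from \<open>v0\<close> to the points
  \<open>\<phi> s v0\<close>; prefixes of these paths connect each of its vertices to
  \<open>v0\<close> inside \<open>F\<close>.\<close>

lemma (in tree_action) exists_resolution:
  assumes "simply_connected_steps G S"
  obtains v0 F where "resolution G V E \<phi> S v0 F"
proof -
  obtain v0 where v0: "v0 \<in> V" using tree by (auto simp: is_tree_def)
  have S: "finite S" "S \<subseteq> carrier G" using assms by (auto simp: simply_connected_steps_def)
  have "\<forall>s\<in>S. \<exists>p. edge_path V E p \<and> hd p = v0 \<and> last p = \<phi> s v0"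
    using T.connected v0 S act_closed unfolding graph_connected_def by blast
  then obtain p where p: "\<And>s. s \<in> S \<Longrightarrow> edge_path V E (p s) \<and> hd (p s) = v0 \<and> last (p s) = \<phi> s v0"
    by metis
  define F where "F = (\<Union>s\<in>S. set (p s))"
  have "resolution G V E \<phi> S v0 F"
  proof
    show "simply_connected_steps G S" "v0 \<in> V" by fact+
    show "F \<subseteq> V" using p by (auto simp: F_def edge_path_def)
    show "finite F" using S by (simp add: F_def)
    show "\<exists>q. edge_path V E q \<and> set q \<subseteq> F \<and> hd q = v0 \<and> last q = x" if "x \<in> F" for x
    proof -
      obtain s where s: "s \<in> S" "x \<in> set (p s)" using \<open>x \<in> F\<close> by (auto simp: F_def)
      then show ?thesis using edge_path_prefix[of V E "p s" x] p[OF s(1)] unfolding F_def by blast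
    qed
    show "\<phi> s v0 \<in> F" if "s \<in> S" for s
    proof -
      have "p s \<noteq> []" using p[OF that] by (auto simp: edge_path_def)
      then have "\<phi> s v0 \<in> set (p s)" using p[OF that] last_in_set by metis
      then show ?thesis using that by (auto simp: F_def)
    qed
  qed
  then show ?thesis using that by blast
qed

text \<open>What later arguments retain of the resolution: an equivariant map \<open>f\<close> that
  collapses no edge, finitely generated edge stabilisers upstairs, and a finite set \<open>R\<close>
  meeting every orbit of edges.\<close>

locale tree_morphism = T: tree_action G V E \<phi> + T': tree_action G V' E' \<phi>'
  for G :: "('g, 'b) monoid_scheme" (structure)
    and V' :: "'w set" and E' :: "'w set set" and \<phi>' :: "'g \<Rightarrow> 'w \<Rightarrow> 'w"
    and V :: "'v set" and E :: "'v set set" and \<phi> :: "'g \<Rightarrow> 'v \<Rightarrow> 'v" +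
  fixes f :: "'w \<Rightarrow> 'v" and R :: "'w set set"
  assumes f_V: "v \<in> V' \<Longrightarrow> f v \<in> V" and f_E: "e \<in> E' \<Longrightarrow> f ` e \<in> E"
    and f_equiv: "g \<in> carrier G \<Longrightarrow> v \<in> V' \<Longrightarrow> f (\<phi>' g v) = \<phi> g (f v)"
    and fg: "fg_edge_stabs G E' \<phi>'"
    and R: "finite R" "R \<subseteq> E'" "e \<in> E' \<Longrightarrow> \<exists>g\<in>carrier G. \<exists>r\<in>R. e = \<phi>' g ` r"

lemma (in tree_action) exists_dunwoody_resolution:
  assumes "finitely_presented G"
  shows "\<exists>(V' :: nat set) E' \<phi>' f R. tree_morphism G V' E' \<phi>' V E \<phi> f R"
proof -
  obtain S where S: "simply_connected_steps G S" and cnt: "countable (carrier G)"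
    using finitely_presented_simply_connected[OF assms] by metis
  obtain v0 F where "resolution G V E \<phi> S v0 F" using exists_resolution[OF S] by metis
  then interpret X: resolution G V E \<phi> S v0 F .
  interpret Y: tree_action G X.V' X.E' X.act' by (rule X.tree_action')
  define \<iota> where "\<iota> = to_nat_on X.V'"
  have "X.V' \<subseteq> (\<lambda>(g, x). X.vx (\<phi> g x) g) ` (carrier G \<times> F)"
  proof
    fix v assume "v \<in> X.V'"
    then obtain y g where y: "v = X.vx y g" "y \<in> V" "g \<in> X.P y" "g \<in> carrier G" by (rule X.V'E)
    then have "v = X.vx (\<phi> g (\<phi> (inv g) y)) g" "\<phi> (inv g) y \<in> F"
      by (auto simp: act_inv' X.P_def)
    then show "v \<in> (\<lambda>(g, x). X.vx (\<phi> g x) g) ` (carrier G \<times> F)"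
      using y(4) by (intro image_eqI[of _ _ "(g, \<phi> (inv g) y)"]) auto
  qed
  then have "countable X.V'"
    by (rule countable_subset) (auto intro: cnt countable_finite X.F(2))
  then have inj: "inj_on \<iota> X.V'" unfolding \<iota>_def by (rule inj_on_to_nat_on)
  define \<psi> where "\<psi> = (\<lambda>g. restrict (\<lambda>x. \<iota> (X.act' g (inv_into X.V' \<iota> x))) (\<iota> ` X.V'))"
  note trans = Y.tree_action_inj_image[OF inj \<psi>_def]
  interpret Z: tree_action G "\<iota> ` X.V'" "(`) \<iota> ` X.E'" \<psi> by (rule trans(1))
  obtain R where R: "finite R" "R \<subseteq> X.E'" "\<And>e. e \<in> X.E' \<Longrightarrow> \<exists>g\<in>carrier G. \<exists>r\<in>R. e = X.act' g ` r"
    using X.cofinite_edges' by metis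
  have inv\<iota>: "inv_into X.V' \<iota> (\<iota> v) = v" if "v \<in> X.V'" for v using inj that by simp
  have "tree_morphism G (\<iota> ` X.V') ((`) \<iota> ` X.E') \<psi> V E \<phi> (fst \<circ> inv_into X.V' \<iota>) ((`) \<iota> ` R)"
  proof
    show "(fst \<circ> inv_into X.V' \<iota>) v \<in> V" if "v \<in> \<iota> ` X.V'" for v
      using that inv\<iota> X.fst_V' by auto
    show "(fst \<circ> inv_into X.V' \<iota>) ` e \<in> E" if "e \<in> (`) \<iota> ` X.E'" for e
    proof -
      obtain d where d: "e = \<iota> ` d" "d \<in> X.E'" using \<open>e \<in> (`) \<iota> ` X.E'\<close> by blast
      then have "(fst \<circ> inv_into X.V' \<iota>) ` e = fst ` d"
        using Y.T.edge_subset[OF d(2)] inv\<iota> by (force simp: image_image subset_iff)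
      then show ?thesis using X.fst_E' d by simp
    qed
    show "(fst \<circ> inv_into X.V' \<iota>) (\<psi> g v) = \<phi> g ((fst \<circ> inv_into X.V' \<iota>) v)"
      if g: "g \<in> carrier G" and "v \<in> \<iota> ` X.V'" for g v
    proof -
      obtain w where w: "v = \<iota> w" "w \<in> X.V'" using \<open>v \<in> \<iota> ` X.V'\<close> by blast
      then show ?thesis using trans(2) inv\<iota> Y.act_closed[OF g w(2)] X.fst_act'[OF g w(2)] by simp
    qed
    show "fg_edge_stabs G ((`) \<iota> ` X.E') \<psi>"
      using X.fg_edge_stabs' trans(4) by (auto simp: fg_edge_stabs_def)
    show "finite ((`) \<iota> ` R)" "(`) \<iota> ` R \<subseteq> (`) \<iota> ` X.E'" using R by auto
    show "\<exists>g\<in>carrier G. \<exists>r\<in>(`) \<iota> ` R. e = \<psi> g ` r" if "e \<in> (`) \<iota> ` X.E'" for e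
    proof -
      obtain d where d: "e = \<iota> ` d" "d \<in> X.E'" using \<open>e \<in> (`) \<iota> ` X.E'\<close> by blast
      then obtain g r where gr: "g \<in> carrier G" "r \<in> R" "d = X.act' g ` r" using R(3) by blast
      then have "e = \<psi> g ` \<iota> ` r" using d(1) trans(3)[OF gr(1) subsetD[OF R(2) gr(2)]] by simp
      then show ?thesis using gr by blast
    qed
  qed
  then show ?thesis by blast
qed

section \<open>Height\<close>

lemma (in group) mem_conjugate_iff:
  assumes "subgroup H G" "a \<in> carrier G" "x \<in> carrier G"
  shows "x \<in> a <# H #> inv a \<longleftrightarrow> inv a \<otimes> x \<otimes> a \<in> H"
proof
  interpret H: subgroup H G by fact
  show "inv a \<otimes> x \<otimes> a \<in> H" if "x \<in> a <# H #> inv a"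
  proof -
    obtain h where h: "h \<in> H" "x = a \<otimes> h \<otimes> inv a"
      using \<open>x \<in> a <# H #> inv a\<close> by (auto simp: l_coset_def r_coset_def)
    then have "inv a \<otimes> x \<otimes> a = h" using assms by (simp add: m_assoc inv_cancel)
    then show ?thesis using h by simp
  qed
  show "x \<in> a <# H #> inv a" if "inv a \<otimes> x \<otimes> a \<in> H"
  proof -
    have "x = a \<otimes> (inv a \<otimes> x \<otimes> a) \<otimes> inv a" using assms by (simp add: m_assoc inv_cancel)
    then show ?thesis using that by (auto simp: l_coset_def r_coset_def)
  qed
qed

lemma (in group) l_coset_eq_iff:
  assumes "subgroup H G" "a \<in> carrier G" "b \<in> carrier G"
  shows "a <# H = b <# H \<longleftrightarrow> inv a \<otimes> b \<in> H"
proof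
  interpret H: subgroup H G by fact
  show "inv a \<otimes> b \<in> H" if "a <# H = b <# H"
  proof -
    have "b \<otimes> \<one> \<in> a <# H" unfolding that by (auto simp: l_coset_def)
    then obtain h where "h \<in> H" "b = a \<otimes> h" using assms by (auto simp: l_coset_def)
    then show ?thesis using assms by (simp add: inv_cancel)
  qed
  show "a <# H = b <# H" if "inv a \<otimes> b \<in> H"
  proof (rule l_repr_independence)
    have "b = a \<otimes> (inv a \<otimes> b)" using assms by (simp add: inv_cancel)
    then show "b \<in> a <# H" using that by (auto simp: l_coset_def)
  qed fact+
qed

text \<open>Finite height without intersections: an infinite set \<open>X\<close> contained in the
  conjugates of \<open>H\<close> by the elements of \<open>A\<close> bounds \<open>card A\<close>.
  The operations are those of \<open>G\<close> even when \<open>K\<close> is a proper subgroup, so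
  that heights in \<open>K\<close> and in \<open>G\<close> can be compared directly.\<close>

definition conj_bound :: "('g, 'b) monoid_scheme \<Rightarrow> 'g set \<Rightarrow> 'g set \<Rightarrow> nat \<Rightarrow> bool" where
  "conj_bound G K H n \<longleftrightarrow>
    (\<forall>X A. X \<subseteq> K \<and> infinite X \<and> A \<subseteq> K \<and> finite A \<and> inj_on (\<lambda>a. a <#\<^bsub>G\<^esub> H) A \<and>
       (\<forall>a\<in>A. \<forall>x\<in>X. inv\<^bsub>G\<^esub> a \<otimes>\<^bsub>G\<^esub> x \<otimes>\<^bsub>G\<^esub> a \<in> H) \<longrightarrow> card A \<le> n)"

lemma conj_boundD:
  "conj_bound G K H n \<Longrightarrow> X \<subseteq> K \<Longrightarrow> infinite X \<Longrightarrow> A \<subseteq> K \<Longrightarrow> finite A \<Longrightarrow>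
    inj_on (\<lambda>a. a <#\<^bsub>G\<^esub> H) A \<Longrightarrow>
    (\<And>a x. a \<in> A \<Longrightarrow> x \<in> X \<Longrightarrow> inv\<^bsub>G\<^esub> a \<otimes>\<^bsub>G\<^esub> x \<otimes>\<^bsub>G\<^esub> a \<in> H) \<Longrightarrow> card A \<le> n"
  unfolding conj_bound_def by blast

lemma finite_height_iff: "finite_height G H \<longleftrightarrow> (\<exists>n. height_at_most G H n)"
proof -
  have "Inf (enat ` S) < \<infinity> \<longleftrightarrow> S \<noteq> {}" for S
  proof (cases "S = {}")
    case False
    then obtain s where "s \<in> S" by blast
    then have "Inf (enat ` S) \<le> enat s" by (intro Inf_lower) simp
    also have "enat s < \<infinity>" by simp
    finally show ?thesis using False by simp
  qed (simp add: top_enat_def)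
  then show ?thesis by (auto simp: finite_height_def height_def)
qed

lemma (in group) finite_height_iff_conj_bound:
  assumes H: "subgroup H G"
  shows "finite_height G H \<longleftrightarrow> (\<exists>n. conj_bound G (carrier G) H n)"
proof
  assume "finite_height G H"
  then obtain n where n: "height_at_most G H n" using finite_height_iff by blast
  have "conj_bound G (carrier G) H n"
    unfolding conj_bound_def
  proof (intro allI impI, elim conjE)
    fix X A assume X: "X \<subseteq> carrier G" "infinite X" and A: "A \<subseteq> carrier G" "inj_on (\<lambda>a. a <# H) A"
      and c: "\<forall>a\<in>A. \<forall>x\<in>X. inv a \<otimes> x \<otimes> a \<in> H"
    let ?Y = "{x \<in> carrier G. \<forall>a\<in>A. x \<in> a <# H #> inv a}"
    have "x \<in> ?Y" if x: "x \<in> X" for x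
    proof -
      have "x \<in> carrier G" using x X(1) by (rule rev_subsetD)
      moreover have "x \<in> a <# H #> inv a" if a: "a \<in> A" for a
        using mem_conjugate_iff[OF H subsetD[OF A(1) a] \<open>x \<in> carrier G\<close>] c a x by simp
      ultimately show ?thesis by simp
    qed
    then have "X \<subseteq> ?Y" ..
    then have "infinite ?Y" using X(2) by (rule infinite_super)
    moreover have "A \<subseteq> carrier G \<longrightarrow> inj_on (\<lambda>a. a <# H) A \<and> (infinite A \<or> n \<le> card A) \<longrightarrow> finite ?Y"
      using n unfolding height_at_most_def by (rule spec)
    ultimately show "card A \<le> n" using A nat_le_linear[of "card A" n] by argo
  qed
  then show "\<exists>n. conj_bound G (carrier G) H n" ..
next
  assume "\<exists>n. conj_bound G (carrier G) H n"
  then obtain n where n: "conj_bound G (carrier G) H n" ..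
  \<comment> \<open>Up to \<open>n\<close> conjugates may have infinite intersection, hence the
    successor. An infinite family is handled through a subset of size \<open>Suc n\<close>.\<close>
  have "height_at_most G H (Suc n)"
    unfolding height_at_most_def
  proof (intro allI impI, elim conjE, rule ccontr)
    fix A assume A: "A \<subseteq> carrier G" "inj_on (\<lambda>a. a <# H) A" "infinite A \<or> Suc n \<le> card A"
    let ?Y = "{x \<in> carrier G. \<forall>a\<in>A. x \<in> a <# H #> inv a}"
    assume inf: "infinite ?Y"
    obtain B where B: "B \<subseteq> A" "card B = Suc n" "finite B"
      using A(3) infinite_arbitrarily_large[of A "Suc n"] obtain_subset_with_card_n[of "Suc n" A] by metis
    have "card B \<le> n"
    proof (rule conj_boundD[OF n _ inf])
      show "?Y \<subseteq> carrier G" "B \<subseteq> carrier G" "finite B" "inj_on (\<lambda>a. a <# H) B"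
        using A B by (auto intro: inj_on_subset)
      show "inv a \<otimes> x \<otimes> a \<in> H" if "a \<in> B" "x \<in> ?Y" for a x
      proof -
        have "a \<in> A" "a \<in> carrier G" "x \<in> carrier G" "x \<in> a <# H #> inv a" using that A B by auto
        then show ?thesis using mem_conjugate_iff[OF H] by blast
      qed
    qed
    then show False using B(2) by simp
  qed
  then show "finite_height G H" using finite_height_iff by blast
qed

lemma (in group) finite_height_subgroup_iff_conj_bound:
  assumes H: "subgroup H G" and K: "subgroup K G" and HK: "H \<subseteq> K"
  shows "finite_height (G\<lparr>carrier := K\<rparr>) H \<longleftrightarrow> (\<exists>n. conj_bound G K H n)"
proof -
  interpret GK: group "G\<lparr>carrier := K\<rparr>" by (rule subgroup_imp_group[OF K])
  have "conj_bound (G\<lparr>carrier := K\<rparr>) K H n \<longleftrightarrow> conj_bound G K H n" for n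
  proof -
    have inv: "inv\<^bsub>G\<lparr>carrier := K\<rparr>\<^esub> a = inv a" if "A \<subseteq> K" "a \<in> A" for A a
      using m_inv_consistent[OF K] that by blast
    have "(\<forall>a\<in>A. \<forall>x\<in>X. inv\<^bsub>G\<lparr>carrier := K\<rparr>\<^esub> a \<otimes> x \<otimes> a \<in> H) \<longleftrightarrow> (\<forall>a\<in>A. \<forall>x\<in>X. inv a \<otimes> x \<otimes> a \<in> H)"
      if "A \<subseteq> K" for A X
      using inv[OF that] by simp
    moreover have "(\<lambda>a. a <#\<^bsub>G\<lparr>carrier := K\<rparr>\<^esub> H) = (\<lambda>a. a <# H)"
      by (simp add: l_coset_def)
    ultimately show ?thesis unfolding conj_bound_def by auto
  qed
  then show ?thesis
    using GK.finite_height_iff_conj_bound[OF subgroup_incl[OF H K HK]] by simp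
qed

text \<open>By \<open>AK\<close> the set \<open>A\<close> lies in one left coset \<open>b K\<close>.
  Translating \<open>A\<close> by \<open>inv b\<close> and conjugating \<open>X\<close> accordingly
  moves both into \<open>K\<close> and leaves the elements
  \<open>inv a \<otimes> x \<otimes> a\<close> unchanged.\<close>

lemma (in group) conj_bound_coset:
  assumes n: "conj_bound G K H n" and H: "subgroup H G" and K: "subgroup K G" and HK: "H \<subseteq> K"
    and A: "A \<subseteq> carrier G" "finite A" "inj_on (\<lambda>a. a <# H) A"
    and AK: "\<And>a b. a \<in> A \<Longrightarrow> b \<in> A \<Longrightarrow> inv a \<otimes> b \<in> K"
    and X: "X \<subseteq> carrier G" "infinite X"
    and c: "\<And>a x. a \<in> A \<Longrightarrow> x \<in> X \<Longrightarrow> inv a \<otimes> x \<otimes> a \<in> H"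
  shows "card A \<le> n"
proof (cases "A = {}")
  case False
  then obtain b where b: "b \<in> A" by blast
  have bG: "b \<in> carrier G" using b A by blast
  have AG: "a \<in> carrier G" if "a \<in> A" for a using that A by blast
  have XG: "x \<in> carrier G" if "x \<in> X" for x using that X by blast
  let ?A = "(\<lambda>a. inv b \<otimes> a) ` A" and ?X = "(\<lambda>x. inv b \<otimes> x \<otimes> b) ` X"
  have injA: "inj_on (\<lambda>a. inv b \<otimes> a) A" using AG bG by (auto simp: inj_on_def)
  have injX: "inj_on (\<lambda>x. inv b \<otimes> x \<otimes> b) X" using XG bG by (auto simp: inj_on_def m_assoc)
  have "card ?A \<le> n"
  proof (rule conj_boundD[OF n])
    show "?X \<subseteq> K" using c[OF b] HK by auto
    show "infinite ?X" using X(2) injX finite_imageD by blast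
    show "?A \<subseteq> K" using AK[OF b] by auto
    show "finite ?A" using A by simp
    show "inj_on (\<lambda>a. a <# H) ?A"
    proof (rule inj_onI)
      fix u v assume "u \<in> ?A" "v \<in> ?A" and eq: "u <# H = v <# H"
      then obtain a a' where a: "u = inv b \<otimes> a" "v = inv b \<otimes> a'" "a \<in> A" "a' \<in> A" by blast
      have "inv u \<otimes> v \<in> H"
        using l_coset_eq_iff[OF H, of u v] eq a AG bG by auto
      moreover have "inv u \<otimes> v = inv a \<otimes> a'"
        using a AG bG by (simp add: inv_mult_group m_assoc inv_cancel)
      ultimately have "a <# H = a' <# H" using l_coset_eq_iff[OF H] a AG by simp
      then have "a = a'" using A(3) a by (auto dest: inj_onD)
      then show "u = v" using a by simp
    qed
    show "inv u \<otimes> y \<otimes> u \<in> H" if "u \<in> ?A" "y \<in> ?X" for u y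
    proof -
      obtain a x where ax: "u = inv b \<otimes> a" "y = inv b \<otimes> x \<otimes> b" "a \<in> A" "x \<in> X" using \<open>u \<in> ?A\<close> \<open>y \<in> ?X\<close> by blast
      have "inv u \<otimes> y \<otimes> u = inv a \<otimes> x \<otimes> a"
        using ax AG XG bG by (simp add: inv_mult_group m_assoc inv_cancel)
      then show ?thesis using c ax by simp
    qed
  qed
  then show ?thesis using card_image[OF injA] by simp
qed auto

text \<open>Sort the elements of \<open>A\<close> by their left cosets of \<open>K\<close>. The
  bound for \<open>K\<close> in \<open>G\<close> allows at most \<open>m\<close> cosets, and
  \<open>conj_bound_coset\<close> allows at most \<open>n\<close> elements in each.\<close>

lemma (in group) finite_height_trans:
  assumes H: "subgroup H G" and K: "subgroup K G" and HK: "H \<subseteq> K"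
    and fK: "finite_height G K" and fH: "finite_height (G\<lparr>carrier := K\<rparr>) H"
  shows "finite_height G H"
proof -
  obtain m where m: "conj_bound G (carrier G) K m"
    using fK finite_height_iff_conj_bound[OF K] by blast
  obtain n where n: "conj_bound G K H n"
    using fH finite_height_subgroup_iff_conj_bound[OF H K HK] by blast
  have "conj_bound G (carrier G) H (m * n)"
    unfolding conj_bound_def
  proof (intro allI impI, elim conjE)
    fix X A assume X: "X \<subseteq> carrier G" "infinite X"
      and A: "A \<subseteq> carrier G" "finite A" "inj_on (\<lambda>a. a <# H) A"
      and c: "\<forall>a\<in>A. \<forall>x\<in>X. inv a \<otimes> x \<otimes> a \<in> H"
    obtain B where B: "B \<subseteq> A" "inj_on (\<lambda>a. a <# K) B" "(\<lambda>a. a <# K) ` A = (\<lambda>a. a <# K) ` B"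
      using subset_image_inj[of "(\<lambda>a. a <# K) ` A" "\<lambda>a. a <# K" A] by auto
    have finB: "finite B" using B(1) A(2) by (rule finite_subset)
    have cB: "card B \<le> m"
    proof (rule conj_boundD[OF m X _ finB B(2)])
      show "B \<subseteq> carrier G" using B(1) A(1) by (rule subset_trans)
      show "inv a \<otimes> x \<otimes> a \<in> K" if "a \<in> B" "x \<in> X" for a x
        using that c B(1) HK by blast
    qed
    have "card {a \<in> A. a <# K = b <# K} \<le> n" (is "card ?C \<le> n") for b
    proof (rule conj_bound_coset[OF n H K HK _ _ _ _ X])
      show "?C \<subseteq> carrier G" "finite ?C" "inj_on (\<lambda>a. a <# H) ?C"
        using A by (auto intro: inj_on_subset)
      show "inv a \<otimes> a' \<in> K" if "a \<in> ?C" "a' \<in> ?C" for a a'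
        using that l_coset_eq_iff[OF K, of a a'] A by auto
      show "inv a \<otimes> x \<otimes> a \<in> H" if "a \<in> ?C" "x \<in> X" for a x using that c by blast
    qed
    then have "(\<Sum>b\<in>B. card {a \<in> A. a <# K = b <# K}) \<le> card B * n"
      by (metis (no_types, lifting) sum_bounded_above of_nat_id)
    moreover have "A = (\<Union>b\<in>B. {a \<in> A. a <# K = b <# K})" using B(3) by blast
    then have "card A \<le> (\<Sum>b\<in>B. card {a \<in> A. a <# K = b <# K})"
      using card_UN_le[OF finB] by metis
    ultimately show "card A \<le> m * n" using cB by (meson le_trans mult_le_mono1)
  qed
  then show ?thesis using finite_height_iff_conj_bound[OF H] by blast
qed

section \<open>Isomorphism invariance of quasi-convexity\<close>

lemma iso_finite_generating_set:
  assumes "group G" "group K" "h \<in> iso G K" "finite_generating_set G S"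
  shows "finite_generating_set K (h ` S)"
proof -
  interpret group_hom G K h
    using assms by (auto simp: group_hom_def group_hom_axioms_def iso_def)
  have "h ` carrier G = carrier K" using assms(3) by (auto simp: iso_def bij_betw_def)
  then show ?thesis
    using assms(4) generate_img[of S] by (auto simp: finite_generating_set_def)
qed

lemma iso_word_dist:
  assumes "group G" "group K" "h \<in> iso G K" "S \<subseteq> carrier G" "x \<in> carrier G" "y \<in> carrier G"
  shows "word_dist K (h ` S) (h x) (h y) = word_dist G S x y"
proof -
  interpret group_hom G K h
    using assms by (auto simp: group_hom_def group_hom_axioms_def iso_def)
  let ?B = "S \<union> m_inv G ` S"
  have B: "?B \<subseteq> carrier G" using assms(4) by auto
  have img: "h ` S \<union> m_inv K ` h ` S = h ` ?B"
    using assms(4) by (force simp: image_Un image_image subset_iff intro!: image_eqI)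
  have fold: "foldr (\<otimes>\<^bsub>K\<^esub>) (map h w) \<one>\<^bsub>K\<^esub> = h (foldr (\<otimes>\<^bsub>G\<^esub>) w \<one>\<^bsub>G\<^esub>) \<and> foldr (\<otimes>\<^bsub>G\<^esub>) w \<one>\<^bsub>G\<^esub> \<in> carrier G"
    if "w \<in> lists ?B" for w
    using that
  proof (induction w)
    case (Cons a w)
    then have "a \<in> carrier G" using B by auto
    then show ?case using Cons by simp
  qed simp
  have inj: "inj_on h (carrier G)" using assms(3) by (auto simp: iso_def bij_betw_def)
  have "(\<exists>w\<in>lists (h ` S \<union> m_inv K ` h ` S). length w = n \<and>
           foldr (\<otimes>\<^bsub>K\<^esub>) w \<one>\<^bsub>K\<^esub> = inv\<^bsub>K\<^esub> (h x) \<otimes>\<^bsub>K\<^esub> h y) \<longleftrightarrow>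
        (\<exists>w\<in>lists ?B. length w = n \<and> foldr (\<otimes>\<^bsub>G\<^esub>) w \<one>\<^bsub>G\<^esub> = inv\<^bsub>G\<^esub> x \<otimes>\<^bsub>G\<^esub> y)" for n
  proof -
    have "foldr (\<otimes>\<^bsub>K\<^esub>) (map h w) \<one>\<^bsub>K\<^esub> = inv\<^bsub>K\<^esub> (h x) \<otimes>\<^bsub>K\<^esub> h y \<longleftrightarrow>
        foldr (\<otimes>\<^bsub>G\<^esub>) w \<one>\<^bsub>G\<^esub> = inv\<^bsub>G\<^esub> x \<otimes>\<^bsub>G\<^esub> y" if "w \<in> lists ?B" for w
    proof -
      have e: "inv\<^bsub>K\<^esub> (h x) \<otimes>\<^bsub>K\<^esub> h y = h (inv\<^bsub>G\<^esub> x \<otimes>\<^bsub>G\<^esub> y)" using assms by simp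
      have "inv\<^bsub>G\<^esub> x \<otimes>\<^bsub>G\<^esub> y \<in> carrier G" using assms by simp
      note inj_on_eq_iff[OF inj conjunct2[OF fold[OF that]] this]
      then show ?thesis unfolding e conjunct1[OF fold[OF that]] .
    qed
    then show ?thesis unfolding img lists_image by (auto simp: image_iff)
  qed
  then show ?thesis by (simp add: word_dist_def)
qed

lemma iso_hyperbolic_group:
  assumes "group K" "h \<in> iso G K" "hyperbolic_group G"
  shows "hyperbolic_group K"
proof -
  have G: "group G" using assms by (simp add: hyperbolic_group_def)
  obtain S where S: "finite_generating_set G S" "gromov_hyperbolic_on (carrier G) (word_dist G S)"
    using assms by (auto simp: hyperbolic_group_def)
  have SG: "S \<subseteq> carrier G" using S by (auto simp: finite_generating_set_def)
  have c: "carrier K = h ` carrier G" using assms(2) by (auto simp: iso_def bij_betw_def)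
  have "gromov_hyperbolic_on (carrier K) (word_dist K (h ` S))"
    using S(2) unfolding gromov_hyperbolic_on_def c gromov_product_def
    by (simp add: iso_word_dist[OF G assms(1,2) SG])
  then show ?thesis
    using assms(1) iso_finite_generating_set[OF G assms(1,2) S(1)] by (auto simp: hyperbolic_group_def)
qed

lemma iso_restrict:
  assumes "h \<in> iso G K" "H \<subseteq> carrier G"
  shows "h \<in> iso (G\<lparr>carrier := H\<rparr>) (K\<lparr>carrier := h ` H\<rparr>)"
  using assms by (auto simp: iso_def hom_def bij_betw_def subset_iff intro: inj_on_subset)

lemma iso_subgroup:
  assumes "group G" "group K" "h \<in> iso G K" "subgroup H G"
  shows "subgroup (h ` H) K"
proof -
  interpret group_hom G K h
    using assms by (auto simp: group_hom_def group_hom_axioms_def iso_def)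
  show ?thesis by (rule subgroup_img_is_subgroup[OF assms(4)])
qed

lemma iso_fg_subgroup:
  assumes "group G" "group K" "h \<in> iso G K" "fg_subgroup H G"
  shows "fg_subgroup (h ` H) K"
proof -
  have H: "subgroup H G" using assms by (simp add: fg_subgroup_def)
  have HK: "subgroup (h ` H) K" by (rule iso_subgroup[OF assms(1-3) H])
  have i: "h \<in> iso (G\<lparr>carrier := H\<rparr>) (K\<lparr>carrier := h ` H\<rparr>)"
    by (rule iso_restrict[OF assms(3) subgroup.subset[OF H]])
  show ?thesis
    using assms(4) HK iso_finite_generating_set[OF group.subgroup_imp_group[OF assms(1) H]
        group.subgroup_imp_group[OF assms(2) HK] i] group.subgroup_imp_group[OF assms(2) HK]
    by (auto simp: fg_subgroup_def finitely_generated_def)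
qed

lemma iso_quasi_convex:
  assumes G: "group G" and K: "group K" and h: "h \<in> iso G K" and qc: "quasi_convex G H"
  shows "quasi_convex K (h ` H)"
proof -
  have H: "subgroup H G" using qc by (simp add: quasi_convex_def fg_subgroup_def)
  have HK: "subgroup (h ` H) K" by (rule iso_subgroup[OF G K h H])
  have i: "h \<in> iso (G\<lparr>carrier := H\<rparr>) (K\<lparr>carrier := h ` H\<rparr>)"
    by (rule iso_restrict[OF h subgroup.subset[OF H]])
  note gH = group.subgroup_imp_group[OF G H] and gK = group.subgroup_imp_group[OF K HK]
  obtain S X where S: "finite_generating_set (G\<lparr>carrier := H\<rparr>) S"
    and X: "finite_generating_set G X"
    and q: "quasi_isometric_embedding_on H (word_dist (G\<lparr>carrier := H\<rparr>) S) (word_dist G X) id"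
    using qc by (auto simp: quasi_convex_def)
  have SX: "S \<subseteq> H" "X \<subseteq> carrier G" using S X by (auto simp: finite_generating_set_def)
  have HG: "H \<subseteq> carrier G" using H by (rule subgroup.subset)
  have d1: "word_dist (K\<lparr>carrier := h ` H\<rparr>) (h ` S) (h x) (h y) = word_dist (G\<lparr>carrier := H\<rparr>) S x y"
    if "x \<in> H" "y \<in> H" for x y
    using iso_word_dist[OF gH gK i, of S x y] SX that by simp
  have d2: "word_dist K (h ` X) (h x) (h y) = word_dist G X x y" if "x \<in> H" "y \<in> H" for x y
    using iso_word_dist[OF G K h, of X x y] SX that HG by blast
  have "quasi_isometric_embedding_on (h ` H) (word_dist (K\<lparr>carrier := h ` H\<rparr>) (h ` S))
      (word_dist K (h ` X)) id"
    using q unfolding quasi_isometric_embedding_on_def by (simp add: d1 d2)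
  then show ?thesis
    unfolding quasi_convex_def
    using iso_fg_subgroup[OF G K h] qc iso_finite_generating_set[OF gH gK i S]
      iso_finite_generating_set[OF G K h X] by (auto simp: quasi_convex_def)
qed

lemma iso_finite_height:
  assumes G: "group G" and K: "group K" and h: "h \<in> iso G K"
    and H: "subgroup H G" and fh: "finite_height G H"
  shows "finite_height K (h ` H)"
proof -
  interpret G: group G by fact
  interpret K: group K by fact
  interpret h: group_hom G K h
    using assms by (auto simp: group_hom_def group_hom_axioms_def iso_def)
  have HK: "subgroup (h ` H) K" by (rule iso_subgroup[OF G K h H])
  have bij: "bij_betw h (carrier G) (carrier K)" using h by (simp add: iso_def)
  obtain n where n: "conj_bound G (carrier G) H n"
    using fh G.finite_height_iff_conj_bound[OF H] by blast
  have mem: "h x \<in> h ` H \<longleftrightarrow> x \<in> H" if "x \<in> carrier G" for x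
    using inj_on_image_mem_iff[of h "carrier G" x H] bij that subgroup.subset[OF H]
    by (simp add: bij_betw_def)
  have "conj_bound K (carrier K) (h ` H) n"
    unfolding conj_bound_def
  proof (intro allI impI, elim conjE)
    fix X A assume X: "X \<subseteq> carrier K" "infinite X"
      and A: "A \<subseteq> carrier K" "finite A" "inj_on (\<lambda>a. a <#\<^bsub>K\<^esub> h ` H) A"
      and c: "\<forall>a\<in>A. \<forall>x\<in>X. inv\<^bsub>K\<^esub> a \<otimes>\<^bsub>K\<^esub> x \<otimes>\<^bsub>K\<^esub> a \<in> h ` H"
    have sub: "X \<subseteq> h ` carrier G" "A \<subseteq> h ` carrier G" using X A bij by (auto simp: bij_betw_def)
    obtain X' where X': "X' \<subseteq> carrier G" "X = h ` X'" using sub(1) by (auto simp: subset_image_iff)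
    obtain A' where A': "A' \<subseteq> carrier G" "A = h ` A'" using sub(2) by (auto simp: subset_image_iff)
    have injA: "inj_on h A'" using bij A'(1) by (auto simp: bij_betw_def intro: inj_on_subset)
    have "card A' \<le> n"
    proof (rule conj_boundD[OF n X'(1) _ A'(1)])
      show "infinite X'" using X X' by auto
      show "finite A'" using A A' finite_imageD injA by blast
      show "inj_on (\<lambda>a. a <#\<^bsub>G\<^esub> H) A'"
      proof (rule inj_onI)
        fix a b assume ab: "a \<in> A'" "b \<in> A'" "a <#\<^bsub>G\<^esub> H = b <#\<^bsub>G\<^esub> H"
        have abG: "a \<in> carrier G" "b \<in> carrier G" using ab A' by auto
        then have "inv\<^bsub>G\<^esub> a \<otimes>\<^bsub>G\<^esub> b \<in> H" using G.l_coset_eq_iff[OF H] ab by blast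
        then have "h (inv\<^bsub>G\<^esub> a \<otimes>\<^bsub>G\<^esub> b) \<in> h ` H" by blast
        then have "inv\<^bsub>K\<^esub> (h a) \<otimes>\<^bsub>K\<^esub> h b \<in> h ` H" using abG by simp
        then have "h a <#\<^bsub>K\<^esub> h ` H = h b <#\<^bsub>K\<^esub> h ` H" using K.l_coset_eq_iff[OF HK] abG by simp
        then have "h a = h b" using A(3) A'(2) ab by (auto dest: inj_onD)
        then show "a = b" using injA ab by (auto dest: inj_onD)
      qed
      show "inv\<^bsub>G\<^esub> a \<otimes>\<^bsub>G\<^esub> x \<otimes>\<^bsub>G\<^esub> a \<in> H" if "a \<in> A'" "x \<in> X'" for a x
      proof -
        have ax: "a \<in> carrier G" "x \<in> carrier G" using that A' X' by auto
        have "inv\<^bsub>K\<^esub> (h a) \<otimes>\<^bsub>K\<^esub> h x \<otimes>\<^bsub>K\<^esub> h a \<in> h ` H" using c that A' X' by blast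
        then have "h (inv\<^bsub>G\<^esub> a \<otimes>\<^bsub>G\<^esub> x \<otimes>\<^bsub>G\<^esub> a) \<in> h ` H" using ax by simp
        moreover have "inv\<^bsub>G\<^esub> a \<otimes>\<^bsub>G\<^esub> x \<otimes>\<^bsub>G\<^esub> a \<in> carrier G" using ax by simp
        ultimately show ?thesis using mem by blast
      qed
    qed
    then show "card A \<le> n" using A' card_image[OF injA] by simp
  qed
  then show ?thesis using K.finite_height_iff_conj_bound[OF HK] by blast
qed

text \<open>\<open>finite_height_imp_quasi_convex\<close> speaks of groups of natural numbers. A
  countable \<open>G\<close> is copied onto such a group, and quasi-convexity is brought back by the
  inverse isomorphism.\<close>

lemma finite_height_quasi_convex:
  assumes "finite_height_imp_quasi_convex" "hyperbolic_group G" "countable (carrier G)"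
    and "fg_subgroup H G" "finite_height G H"
  shows "quasi_convex G H"
proof -
  interpret group G using assms by (simp add: hyperbolic_group_def)
  define \<iota> where "\<iota> = to_nat_on (carrier G)"
  have inj: "inj_on \<iota> (carrier G)" unfolding \<iota>_def using assms(3) by (rule inj_on_to_nat_on)
  let ?K = "image_group \<iota> G"
  have K: "group ?K" by (rule inj_imp_image_group_is_group[OF inj])
  have i: "\<iota> \<in> iso G ?K" by (rule inj_imp_image_group_iso[OF inj])
  have H: "subgroup H G" using assms by (simp add: fg_subgroup_def)
  have "quasi_convex ?K (\<iota> ` H)"
    using assms(1) iso_hyperbolic_group[OF K i assms(2)] iso_fg_subgroup[OF is_group K i assms(4)]
      iso_finite_height[OF is_group K i H assms(5)]
    unfolding finite_height_imp_quasi_convex_def by blast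
  then have "quasi_convex G (inv_into (carrier G) \<iota> ` \<iota> ` H)"
    by (rule iso_quasi_convex[OF K is_group iso_set_sym[OF i]])
  moreover have "inv_into (carrier G) \<iota> ` \<iota> ` H = H"
    using inv_into_image_cancel[OF inj subgroup.subset[OF H]] .
  ultimately show ?thesis by simp
qed

section \<open>Edges fixed by infinite subsets\<close>

text \<open>The one estimate behind both finite height and acylindricity of the resolution. Testing
  finite sets \<open>Q\<close> makes finiteness of the whole fixed set a consequence instead of a
  premise.\<close>

definition fixed_edges_bound ::
  "('g, 'b) monoid_scheme \<Rightarrow> 'v set set \<Rightarrow> ('g \<Rightarrow> 'v \<Rightarrow> 'v) \<Rightarrow> nat \<Rightarrow> bool" where
  "fixed_edges_bound G E \<phi> N \<longleftrightarrow>
    (\<forall>X Q. X \<subseteq> carrier G \<and> infinite X \<and> Q \<subseteq> E \<and> finite Q \<and> (\<forall>q\<in>Q. \<forall>x\<in>X. \<phi> x ` q = q) \<longrightarrow>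
       card Q \<le> N)"

lemma fixed_edges_boundD:
  assumes "fixed_edges_bound G E \<phi> N" "X \<subseteq> carrier G" "infinite X" "Q \<subseteq> E" "finite Q"
    and "\<And>q x. q \<in> Q \<Longrightarrow> x \<in> X \<Longrightarrow> \<phi> x ` q = q"
  shows "card Q \<le> N"
  using assms(1)[unfolded fixed_edges_bound_def, THEN spec, THEN spec, of X Q] assms(2-6) by simp

lemma (in simplicial_tree) distinct_path_unique:
  assumes "edge_path V E p" "distinct p" "edge_path V E q" "distinct q" "hd p = hd q" "last p = last q"
  shows "p = q"
  using assms
proof (induction p arbitrary: q)
  case (Cons x p)
  obtain q' where q: "q = x # q'" using Cons.prems by (cases q) (auto simp: edge_path_def)
  show ?case
  proof (cases "p = [] \<or> q' = []")
    case True
    then show ?thesis using Cons.prems q by (cases "p = []"; cases "q' = []") auto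
  next
    case False
    have p: "{x, hd p} \<in> path_edges (x # p)" "{x, hd q'} \<in> path_edges (x # q')"
      using False by (auto simp: path_edges_Cons)
    moreover have "path_edges (x # p) = walls x (last p)" "path_edges (x # q') = walls x (last p)"
      using walls_path[OF Cons.prems(1,2)] walls_path[OF Cons.prems(3,4)] Cons.prems(6) q False by auto
    moreover have "x \<in> V" "last p \<in> V"
      using Cons.prems(1) False last_in_set[of p] by (auto simp: edge_path_def)
    ultimately have "hd p = hd q'" using toward_unique by metis
    then have "p = q'" using Cons False q by (auto simp: edge_path_Cons)
    then show ?thesis using q by simp
  qed
qed (simp add: edge_path_def)

context tree_action
begin

lemma act_image_mult:
  "g \<in> carrier G \<Longrightarrow> h \<in> carrier G \<Longrightarrow> e \<in> E \<Longrightarrow> \<phi> (g \<otimes> h) ` e = \<phi> g ` \<phi> h ` e"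
  using composition_rule T.edge_subset by (force simp: image_image subset_iff)

lemma act_image_one: "e \<in> E \<Longrightarrow> \<phi> \<one> ` e = e"
  using act_one T.edge_subset by (force simp: subset_iff)

lemma fixes_path:
  assumes g: "g \<in> carrier G" and p: "edge_path V E p" "distinct p"
    and "\<phi> g (hd p) = hd p" "\<phi> g (last p) = last p" and v: "v \<in> set p"
  shows "\<phi> g v = v"
proof -
  have ne: "p \<noteq> []" and V: "set p \<subseteq> V" using p by (auto simp: edge_path_def)
  have "map (\<phi> g) p = p"
  proof (rule T.distinct_path_unique[OF act_edge_path[OF g p(1)] _ p])
    show "distinct (map (\<phi> g) p)"
      using p(2) V inj_prop[OF g] by (auto simp: distinct_map intro: inj_on_subset)
  qed (use assms ne in \<open>auto simp: hd_map last_map\<close>)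
  then show ?thesis using v by (metis map_eq_conv map_ident)
qed

lemma fixes_edge:
  "g \<in> carrier G \<Longrightarrow> e \<in> E \<Longrightarrow> \<phi> g ` e = e \<Longrightarrow> x \<in> e \<Longrightarrow> \<phi> g x = x"
  using edge_stab_fixes by (simp add: stabilizer_def)

text \<open>An infinite pointwise stabiliser would fix more than \<open>N\<close> edges of the path.
  So it is a finite subgroup, and the bound on finite subgroups is uniform in the path.\<close>

lemma fixed_edges_bound_imp_acylindrical:
  assumes N: "fixed_edges_bound G E \<phi> N" and "bounded_finite_subgroups G"
  shows "acylindrical G V E \<phi>"
proof -
  obtain M where M: "\<And>F. subgroup F G \<Longrightarrow> finite F \<Longrightarrow> card F < M"
    using assms(2) by (auto simp: bounded_finite_subgroups_def)
  \<comment> \<open>A path of length \<open>Suc N\<close> has more than \<open>N\<close> edges;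
    \<open>Suc M\<close> is visibly positive.\<close>
  have "kC_acylindrical G V E \<phi> (Suc N) (Suc M)"
    unfolding kC_acylindrical_def
  proof (intro allI impI, elim conjE)
    fix p assume p: "edge_path V E p" "distinct p" "Suc N \<le> length p - 1"
    have V: "set p \<subseteq> V" using p by (auto simp: edge_path_def)
    let ?K = "{g \<in> carrier G. \<forall>v\<in>set p. \<phi> g v = v}"
    have fin: "finite ?K"
    proof (rule ccontr)
      assume inf: "infinite ?K"
      have "card (path_edges p) \<le> N"
      proof (rule fixed_edges_boundD[OF N _ inf path_edges_subset[OF p(1)] finite_path_edges])
        show "\<phi> x ` q = q" if "q \<in> path_edges p" "x \<in> ?K" for q x
          using that path_edges_subset_set[OF that(1)] by (force simp: subset_iff)
      qed auto
      then show False using card_path_edges[OF p(2)] p(3) by simp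
    qed
    have "subgroup ?K G"
    proof (rule subgroupI)
      have "\<one> \<in> ?K" using act_one V by auto
      then show "?K \<noteq> {}" by blast
      show "inv a \<in> ?K" if "a \<in> ?K" for a
        using that act_inv V by (fastforce simp: subset_iff)
      show "a \<otimes> b \<in> ?K" if "a \<in> ?K" "b \<in> ?K" for a b
        using that composition_rule V by (auto simp: subset_iff)
    qed auto
    then have "card ?K < M" using M fin by blast
    then show "finite ?K \<and> card ?K \<le> Suc M" using fin by simp
  qed
  then show ?thesis unfolding acylindrical_def by blast
qed

text \<open>Cosets \<open>a H\<close> of the stabiliser \<open>H\<close> of \<open>e\<close>
  correspond to translates \<open>a e\<close>, and \<open>X\<close> lies in the conjugate of
  \<open>H\<close> by \<open>a\<close> exactly when it fixes \<open>a e\<close>.\<close>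

lemma fixed_edges_bound_imp_finite_height:
  assumes N: "fixed_edges_bound G E \<phi> N" and e: "e \<in> E"
  shows "finite_height G (edge_stab G \<phi> e)"
proof -
  let ?H = "edge_stab G \<phi> e"
  have H: "subgroup ?H G" by (rule edge_stab_subgroup[OF e])
  have "conj_bound G (carrier G) ?H N"
    unfolding conj_bound_def
  proof (intro allI impI, elim conjE)
    fix X A assume X: "X \<subseteq> carrier G" "infinite X"
      and A: "A \<subseteq> carrier G" "finite A" "inj_on (\<lambda>a. a <# ?H) A"
      and c: "\<forall>a\<in>A. \<forall>x\<in>X. inv a \<otimes> x \<otimes> a \<in> ?H"
    have AG: "a \<in> carrier G" if "a \<in> A" for a using that A by blast
    have XG: "x \<in> carrier G" if "x \<in> X" for x using that X by blast
    have "inj_on (\<lambda>a. \<phi> a ` e) A"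
    proof (rule inj_onI)
      fix a b assume ab: "a \<in> A" "b \<in> A" "\<phi> a ` e = \<phi> b ` e"
      have "\<phi> (inv a \<otimes> b) ` e = \<phi> (inv a) ` \<phi> a ` e"
        using act_image_mult[of "inv a" b e] AG ab e by simp
      also have "\<dots> = e" using act_image_mult[of "inv a" a e] act_image_one AG ab e by simp
      finally have "inv a \<otimes> b \<in> ?H" using AG ab by (simp add: stabilizer_def)
      then have "a <# ?H = b <# ?H" using l_coset_eq_iff[OF H] AG ab by blast
      then show "a = b" using A(3) ab by (auto dest: inj_onD)
    qed
    moreover have "card ((\<lambda>a. \<phi> a ` e) ` A) \<le> N"
    proof (rule fixed_edges_boundD[OF N X])
      show "(\<lambda>a. \<phi> a ` e) ` A \<subseteq> E" using edge_closed AG e by blast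
      show "finite ((\<lambda>a. \<phi> a ` e) ` A)" using A by simp
      show "\<phi> x ` q = q" if "q \<in> (\<lambda>a. \<phi> a ` e) ` A" "x \<in> X" for q x
      proof -
        obtain a where a: "a \<in> A" "q = \<phi> a ` e" using \<open>q \<in> (\<lambda>a. \<phi> a ` e) ` A\<close> by blast
        have "\<phi> a ` e = \<phi> a ` \<phi> (inv a \<otimes> x \<otimes> a) ` e"
          using c a \<open>x \<in> X\<close> by (simp add: stabilizer_def)
        also have "\<dots> = \<phi> (a \<otimes> (inv a \<otimes> x \<otimes> a)) ` e"
          using act_image_mult[of a "inv a \<otimes> x \<otimes> a" e] AG XG a \<open>x \<in> X\<close> e by simp
        also have "a \<otimes> (inv a \<otimes> x \<otimes> a) = x \<otimes> a"
          using AG XG a \<open>x \<in> X\<close> by (simp add: m_assoc inv_cancel)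
        also have "\<phi> (x \<otimes> a) ` e = \<phi> x ` \<phi> a ` e"
          using act_image_mult AG XG a \<open>x \<in> X\<close> e by blast
        finally show ?thesis using a by simp
      qed
    qed
    ultimately show "card A \<le> N" by (simp add: card_image)
  qed
  then show ?thesis using finite_height_iff_conj_bound[OF H] by blast
qed

text \<open>The correspondence of \<open>fixed_edges_bound_imp_finite_height\<close> read backwards:
  a height bound counts the translates of \<open>e\<close> fixed by \<open>X\<close>. If the
  translating elements lie in one left coset of \<open>K\<close>, the height of the stabiliser in
  \<open>K\<close> is enough.\<close>

lemma card_translates_le:
  assumes e: "e \<in> E" and K: "subgroup K G" and HK: "edge_stab G \<phi> e \<subseteq> K"
    and n: "conj_bound G K (edge_stab G \<phi> e) n"
    and X: "X \<subseteq> carrier G" "infinite X" and Q: "finite Q"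
    and b: "\<And>q. q \<in> Q \<Longrightarrow> b q \<in> carrier G \<and> q = \<phi> (b q) ` e"
    and bK: "\<And>q q'. q \<in> Q \<Longrightarrow> q' \<in> Q \<Longrightarrow> inv (b q) \<otimes> b q' \<in> K"
    and fxd: "\<And>q x. q \<in> Q \<Longrightarrow> x \<in> X \<Longrightarrow> \<phi> x ` q = q"
  shows "card Q \<le> n"
proof -
  let ?H = "edge_stab G \<phi> e"
  have H: "subgroup ?H G" by (rule edge_stab_subgroup[OF e])
  have injb: "inj_on b Q" using b by (metis inj_onI)
  have "card (b ` Q) \<le> n"
  proof (rule conj_bound_coset[OF n H K HK _ _ _ _ X])
    show "b ` Q \<subseteq> carrier G" using b by blast
    show "finite (b ` Q)" using Q by simp
    show "inj_on (\<lambda>a. a <# ?H) (b ` Q)"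
    proof (rule inj_onI, elim imageE, simp)
      fix q q' assume q: "q \<in> Q" "q' \<in> Q" and "b q <# ?H = b q' <# ?H"
      then have "inv (b q) \<otimes> b q' \<in> ?H" using l_coset_eq_iff[OF H] b by blast
      then have "\<phi> (inv (b q) \<otimes> b q') ` e = e" by (simp add: stabilizer_def)
      then have "\<phi> (b q) ` e = \<phi> (b q \<otimes> (inv (b q) \<otimes> b q')) ` e"
        using act_image_mult[of "b q" "inv (b q) \<otimes> b q'" e] b q e by simp
      also have "b q \<otimes> (inv (b q) \<otimes> b q') = b q'" using b q by (simp add: inv_cancel)
      finally show "b q = b q'" using b q by metis
    qed
    show "inv a \<otimes> a' \<in> K" if "a \<in> b ` Q" "a' \<in> b ` Q" for a a' using that bK by blast
    show "inv a \<otimes> x \<otimes> a \<in> ?H" if "a \<in> b ` Q" "x \<in> X" for a x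
    proof -
      obtain q where q: "q \<in> Q" "a = b q" using \<open>a \<in> b ` Q\<close> by blast
      have aG: "a \<in> carrier G" and xG: "x \<in> carrier G" and qe: "q = \<phi> a ` e" using b q X \<open>x \<in> X\<close> by auto
      have "\<phi> (inv a \<otimes> (x \<otimes> a)) ` e = \<phi> (inv a) ` \<phi> x ` \<phi> a ` e"
        using act_image_mult[of "inv a" "x \<otimes> a" e] act_image_mult[of x a e] aG xG e by simp
      also have "\<dots> = \<phi> (inv a) ` \<phi> a ` e" using fxd[OF q(1) \<open>x \<in> X\<close>] qe by simp
      also have "\<dots> = e" using act_image_mult[of "inv a" a e] act_image_one aG e by simp
      finally show ?thesis using aG xG by (simp add: stabilizer_def m_assoc)
    qed
  qed
  then show ?thesis using card_image[OF injb] by simp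
qed

end

lemma fg_subgroup_restrict:
  assumes "group G" "fg_subgroup H G" "subgroup K G" "H \<subseteq> K"
  shows "fg_subgroup H (G\<lparr>carrier := K\<rparr>)"
  using assms group.subgroup_incl[of G H K] by (simp add: fg_subgroup_def)

lemma card_UN_le_sum:
  assumes "finite I" "Q \<subseteq> (\<Union>i\<in>I. B i)" "\<And>i. i \<in> I \<Longrightarrow> finite (B i) \<and> card (B i) \<le> n i"
  shows "finite Q \<and> card Q \<le> (\<Sum>i\<in>I. n i)"
proof -
  have fin: "finite (\<Union>i\<in>I. B i)" using assms(1,3) by simp
  have "card Q \<le> card (\<Union>i\<in>I. B i)" by (rule card_mono[OF fin assms(2)])
  also have "\<dots> \<le> (\<Sum>i\<in>I. card (B i))" by (rule card_UN_le[OF assms(1)])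
  also have "\<dots> \<le> (\<Sum>i\<in>I. n i)" using assms(3) by (intro sum_mono) simp
  finally show ?thesis using finite_subset[OF assms(2) fin] by simp
qed

lemma finite_card_le_if_subsets:
  assumes "\<And>Q. Q \<subseteq> S \<Longrightarrow> finite Q \<Longrightarrow> card Q \<le> n"
  shows "finite S \<and> card S \<le> n"
proof -
  have "finite S"
  proof (rule ccontr)
    assume "infinite S"
    then obtain Q where "Q \<subseteq> S" "finite Q" "card Q = Suc n"
      using infinite_arbitrarily_large by metis
    then show False using assms[of Q] by simp
  qed
  then show ?thesis using assms by simp
qed

section \<open>Counting fixed edges of the resolution\<close>

context tree_morphism
begin

lemma vertex_stab_mono:
  assumes "e \<in> E'" "u \<in> e"
  shows "edge_stab G \<phi>' e \<subseteq> vertex_stab G \<phi> (f u)"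
proof
  fix g assume g: "g \<in> edge_stab G \<phi>' e"
  then have "\<phi>' g u = u" "g \<in> carrier G"
    using T'.edge_stab_fixes assms by (auto simp: stabilizer_def)
  moreover have "u \<in> V'" using T'.T.edge_subset assms by blast
  ultimately show "g \<in> vertex_stab G \<phi> (f u)"
    using f_equiv[of g u] by (simp add: stabilizer_def)
qed

lemma edge_stab_mono:
  assumes "e \<in> E'" shows "edge_stab G \<phi>' e \<subseteq> edge_stab G \<phi> (f ` e)"
proof
  fix g assume g: "g \<in> edge_stab G \<phi>' e"
  then have "\<phi> g (f u) = f u" if "u \<in> e" for u
    using vertex_stab_mono[OF assms that] by (auto simp: stabilizer_def)
  then show "g \<in> edge_stab G \<phi> (f ` e)" using g by (force simp: stabilizer_def)
qed

text \<open>The stabiliser upstairs is finitely generated, so by \<open>lfh\<close> it has finite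
  height in the stabiliser of the image edge; heights compose by
  \<open>finite_height_trans\<close>.\<close>

lemma finite_height_edges:
  assumes "e \<in> E'" "finite_height G (edge_stab G \<phi> (f ` e))"
    and lfh: "locally_finite_height (G\<lparr>carrier := edge_stab G \<phi> (f ` e)\<rparr>)"
  shows "finite_height G (edge_stab G \<phi>' e)"
proof (rule T.finite_height_trans[OF _ _ edge_stab_mono[OF assms(1)] assms(2)])
  show "subgroup (edge_stab G \<phi>' e) G" by (rule T'.edge_stab_subgroup[OF assms(1)])
  show K: "subgroup (edge_stab G \<phi> (f ` e)) G" by (rule T.edge_stab_subgroup[OF f_E[OF assms(1)]])
  have "fg_subgroup (edge_stab G \<phi>' e) G" using fg assms(1) by (simp add: fg_edge_stabs_def)
  then show "finite_height (G\<lparr>carrier := edge_stab G \<phi> (f ` e)\<rparr>) (edge_stab G \<phi>' e)"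
    using lfh fg_subgroup_restrict[OF T.is_group _ K edge_stab_mono[OF assms(1)]]
    by (simp add: locally_finite_height_def)
qed

lemma image_act:
  assumes "g \<in> carrier G" "e \<in> E'" shows "f ` \<phi>' g ` e = \<phi> g ` f ` e"
  using f_equiv[OF assms(1)] T'.T.edge_subset[OF assms(2)] by (force simp: image_image subset_iff)

text \<open>Sum the height bounds over the representatives in \<open>R\<close>. The hypothesis asks
  for some translate of each edge because in the collapsed tree control is given at one edge of a
  single orbit.\<close>

lemma exists_bound_edges:
  assumes fh: "\<And>e. e \<in> E \<Longrightarrow> \<exists>g\<in>carrier G. finite_height G (edge_stab G \<phi> (\<phi> g ` e)) \<and>
      locally_finite_height (G\<lparr>carrier := edge_stab G \<phi> (\<phi> g ` e)\<rparr>)"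
  shows "\<exists>N. fixed_edges_bound G E' \<phi>' N"
proof -
  have "\<forall>r\<in>R. \<exists>c n. c \<in> carrier G \<and> conj_bound G (carrier G) (edge_stab G \<phi>' (\<phi>' c ` r)) n"
  proof
    fix r assume "r \<in> R"
    then have r: "r \<in> E'" using R(2) by blast
    obtain c where c: "c \<in> carrier G" "finite_height G (edge_stab G \<phi> (\<phi> c ` f ` r))"
      "locally_finite_height (G\<lparr>carrier := edge_stab G \<phi> (\<phi> c ` f ` r)\<rparr>)"
      using fh[OF f_E[OF r]] by blast
    have cr: "\<phi>' c ` r \<in> E'" by (rule T'.edge_closed[OF c(1) r])
    have "finite_height G (edge_stab G \<phi>' (\<phi>' c ` r))"
      by (rule finite_height_edges[OF cr]) (use c image_act[OF c(1) r] in simp_all)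
    then show "\<exists>c n. c \<in> carrier G \<and> conj_bound G (carrier G) (edge_stab G \<phi>' (\<phi>' c ` r)) n"
      using T.finite_height_iff_conj_bound[OF T'.edge_stab_subgroup[OF cr]] c(1) by blast
  qed
  then obtain c n where c: "\<And>r. r \<in> R \<Longrightarrow> c r \<in> carrier G"
    and n: "\<And>r. r \<in> R \<Longrightarrow> conj_bound G (carrier G) (edge_stab G \<phi>' (\<phi>' (c r) ` r)) (n r)"
    by metis
  have "fixed_edges_bound G E' \<phi>' (\<Sum>r\<in>R. n r)"
    unfolding fixed_edges_bound_def
  proof (intro allI impI, elim conjE)
    fix X Q assume X: "X \<subseteq> carrier G" "infinite X" and Q: "Q \<subseteq> E'" "finite Q"
      and fxd: "\<forall>q\<in>Q. \<forall>x\<in>X. \<phi>' x ` q = q"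
    define B where "B r = {q \<in> Q. \<exists>g\<in>carrier G. q = \<phi>' g ` r}" for r
    have "finite Q \<and> card Q \<le> (\<Sum>r\<in>R. n r)"
    proof (rule card_UN_le_sum[OF R(1)])
      show "Q \<subseteq> (\<Union>r\<in>R. B r)" using R(3) Q(1) unfolding B_def by blast
      show "finite (B r) \<and> card (B r) \<le> n r" if r: "r \<in> R" for r
      proof
        show fin: "finite (B r)" using Q by (simp add: B_def)
        have rE: "r \<in> E'" using r R(2) by blast
        let ?r = "\<phi>' (c r) ` r"
        have rE': "?r \<in> E'" by (rule T'.edge_closed[OF c[OF r] rE])
        have r_eq: "\<phi>' (inv (c r)) ` ?r = r"
          using T'.act_image_mult[of "inv (c r)" "c r" r] T'.act_image_one[OF rE] c[OF r] rE by simp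
        \<comment> \<open>The orbit of \<open>r\<close> is counted from its controlled translate
          \<open>?r\<close>.\<close>
        have "\<forall>q\<in>B r. \<exists>g. g \<in> carrier G \<and> q = \<phi>' g ` ?r"
        proof
          fix q assume "q \<in> B r"
          then obtain g where g: "g \<in> carrier G" "q = \<phi>' g ` r" by (auto simp: B_def)
          then have "q = \<phi>' (g \<otimes> inv (c r)) ` ?r"
            using T'.act_image_mult[of g "inv (c r)" ?r] rE' c[OF r] r_eq by simp
          then show "\<exists>g. g \<in> carrier G \<and> q = \<phi>' g ` ?r" using g(1) c[OF r] by blast
        qed
        then obtain b where b: "\<And>q. q \<in> B r \<Longrightarrow> b q \<in> carrier G \<and> q = \<phi>' (b q) ` ?r" by metis
        show "card (B r) \<le> n r"
        proof (rule T'.card_translates_le[OF rE' T.subgroup_self _ n[OF r] X fin b])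
          show "edge_stab G \<phi>' ?r \<subseteq> carrier G" by (auto simp: stabilizer_def)
          show "inv (b q) \<otimes> b q' \<in> carrier G" if "q \<in> B r" "q' \<in> B r" for q q'
            using b that by simp
          show "\<phi>' x ` q = q" if "q \<in> B r" "x \<in> X" for q x using that fxd by (simp add: B_def)
        qed
      qed
    qed
    then show "card Q \<le> (\<Sum>r\<in>R. n r)" ..
  qed
  then show ?thesis ..
qed

lemma edge_path_image:
  assumes "edge_path V' E' p" shows "edge_path V E (map f p)"
  using assms
proof (induction p)
  case (Cons x p)
  then show ?case using f_V f_E[of "{x, hd p}"]
    by (cases "p = []") (auto simp: edge_path_Cons hd_map)
qed (simp add: edge_path_def)

text \<open>Two translates of an edge whose copies of one endpoint lie over \<open>w\<close> differ by an element of a vertex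
  stabiliser of \<open>T\<close>, so only the height in vertex stabilisers matters for edges over one star.\<close>

lemma exists_star_bound:
  assumes "\<And>v. v \<in> V \<Longrightarrow> locally_finite_height (G\<lparr>carrier := vertex_stab G \<phi> v\<rparr>)"
  shows "\<exists>D. \<forall>X w Q. X \<subseteq> carrier G \<and> infinite X \<and> Q \<subseteq> E' \<and> finite Q \<and>
      (\<forall>q\<in>Q. w \<in> f ` q \<and> (\<forall>x\<in>X. \<phi>' x ` q = q)) \<longrightarrow> card Q \<le> D"
proof -
  \<comment> \<open>Flags of the representatives: the end carried over \<open>w\<close> has to be
    remembered, as translating elements are compared in the stabiliser of its image.\<close>
  define I where "I = (SIGMA r:R. r)"
  have finI: "finite I"
  proof -
    have "finite r" if "r \<in> R" for r
    proof -
      have "card r = 2" using that R(2) T'.T.simplicial by (auto simp: simplicial_graph_def)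
      then show ?thesis by (intro card_ge_0_finite) simp
    qed
    then show ?thesis using R(1) unfolding I_def by blast
  qed
  have "\<exists>n. conj_bound G (vertex_stab G \<phi> (f u)) (edge_stab G \<phi>' r) n" if "(r, u) \<in> I" for r u
  proof -
    have r: "r \<in> E'" "u \<in> r" using that R(2) by (auto simp: I_def)
    have u: "f u \<in> V" using r T'.T.edge_subset f_V by blast
    note K = T.vertex_stab_subgroup[OF u] and H = T'.edge_stab_subgroup[OF r(1)]
    have "fg_subgroup (edge_stab G \<phi>' r) G" using fg r by (simp add: fg_edge_stabs_def)
    then have "finite_height (G\<lparr>carrier := vertex_stab G \<phi> (f u)\<rparr>) (edge_stab G \<phi>' r)"
      using assms[OF u] fg_subgroup_restrict[OF T.is_group _ K vertex_stab_mono[OF r]]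
      by (simp add: locally_finite_height_def)
    then show ?thesis
      using T.finite_height_subgroup_iff_conj_bound[OF H K vertex_stab_mono[OF r]] by blast
  qed
  then have "\<forall>i\<in>I. \<exists>n. conj_bound G (vertex_stab G \<phi> (f (snd i))) (edge_stab G \<phi>' (fst i)) n"
    by auto
  then obtain n where n: "\<And>i. i \<in> I \<Longrightarrow>
      conj_bound G (vertex_stab G \<phi> (f (snd i))) (edge_stab G \<phi>' (fst i)) (n i)"
    by metis
  show ?thesis
  proof (intro exI[of _ "\<Sum>i\<in>I. n i"] allI impI, elim conjE)
    fix X w Q assume X: "X \<subseteq> carrier G" "infinite X" and Q: "Q \<subseteq> E'" "finite Q"
      and fxd: "\<forall>q\<in>Q. w \<in> f ` q \<and> (\<forall>x\<in>X. \<phi>' x ` q = q)"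
    define B where "B i = {q \<in> Q. \<exists>g\<in>carrier G. q = \<phi>' g ` fst i \<and> \<phi> g (f (snd i)) = w}" for i
    have "finite Q \<and> card Q \<le> (\<Sum>i\<in>I. n i)"
    proof (rule card_UN_le_sum[OF finI])
      show "Q \<subseteq> (\<Union>i\<in>I. B i)"
      proof
        fix q assume q: "q \<in> Q"
        then obtain g r where gr: "g \<in> carrier G" "r \<in> R" "q = \<phi>' g ` r" using R(3) Q(1) by blast
        have "w \<in> f ` \<phi>' g ` r" using fxd q gr by blast
        then obtain u where u: "u \<in> r" "w = f (\<phi>' g u)" by blast
        have "u \<in> V'" using u(1) gr(2) R(2) T'.T.edge_subset by blast
        then have "q \<in> B (r, u)" using gr u q f_equiv by (auto simp: B_def)
        then show "q \<in> (\<Union>i\<in>I. B i)" using gr u by (auto simp: I_def)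
      qed
      show "finite (B i) \<and> card (B i) \<le> n i" if i: "i \<in> I" for i
      proof
        show fin: "finite (B i)" using Q by (simp add: B_def)
        obtain r u where ru: "i = (r, u)" by (cases i)
        have r: "r \<in> E'" "u \<in> r" using i ru R(2) by (auto simp: I_def)
        have u: "f u \<in> V" using r T'.T.edge_subset f_V by blast
        have "\<forall>q\<in>B i. \<exists>g. (g \<in> carrier G \<and> q = \<phi>' g ` r) \<and> \<phi> g (f u) = w"
          by (auto simp: B_def ru)
        then obtain b where b: "\<And>q. q \<in> B i \<Longrightarrow> b q \<in> carrier G \<and> q = \<phi>' (b q) ` r"
          and bw: "\<And>q. q \<in> B i \<Longrightarrow> \<phi> (b q) (f u) = w" by metis
        have n': "conj_bound G (vertex_stab G \<phi> (f u)) (edge_stab G \<phi>' r) (n i)"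
          using n[OF i] by (simp add: ru)
        show "card (B i) \<le> n i"
        proof (rule T'.card_translates_le[OF r(1) T.vertex_stab_subgroup[OF u]
              vertex_stab_mono[OF r] n' X fin b])
          show "inv (b q) \<otimes> b q' \<in> vertex_stab G \<phi> (f u)" if q: "q \<in> B i" "q' \<in> B i" for q q'
          proof -
            have g: "b q \<in> carrier G" "b q' \<in> carrier G" using b q by auto
            have "\<phi> (inv (b q) \<otimes> b q') (f u) = \<phi> (inv (b q)) (\<phi> (b q) (f u))"
              using T.composition_rule[OF u, of "inv (b q)" "b q'"] bw q g by simp
            then show ?thesis using T.act_inv g u by (simp add: stabilizer_def)
          qed
          show "\<phi>' x ` q = q" if "q \<in> B i" "x \<in> X" for q x using that fxd by (simp add: B_def)
        qed
      qed
    qed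
    then show "card Q \<le> (\<Sum>i\<in>I. n i)" ..
  qed
qed

text \<open>An infinite \<open>X\<close> that fixes two vertices of \<open>T\<close> fixes the
  geodesic between them, so acylindricity bounds the radius of the image of its fixed subtree. Over
  each vertex of the image lie at most \<open>D\<close> fixed edges, so the level at distance
  \<open>j\<close> has at most \<open>D ^ j\<close> vertices.\<close>

lemma exists_bound_vertices:
  assumes lfh: "\<And>v. v \<in> V \<Longrightarrow> locally_finite_height (G\<lparr>carrier := vertex_stab G \<phi> v\<rparr>)"
    and acyl: "acylindrical G V E \<phi>"
  shows "\<exists>N. fixed_edges_bound G E' \<phi>' N"
proof -
  obtain k C where kC: "kC_acylindrical G V E \<phi> k C" using acyl by (auto simp: acylindrical_def)
  obtain D where D: "\<And>X w Q. X \<subseteq> carrier G \<Longrightarrow> infinite X \<Longrightarrow> Q \<subseteq> E' \<Longrightarrow> finite Q \<Longrightarrow>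
      \<forall>q\<in>Q. w \<in> f ` q \<and> (\<forall>x\<in>X. \<phi>' x ` q = q) \<Longrightarrow> card Q \<le> D"
    using exists_star_bound[OF lfh] by metis
  \<comment> \<open>At most the geometric sum of image vertices, and at most \<open>D\<close> fixed
    edges over each.\<close>
  have "fixed_edges_bound G E' \<phi>' ((\<Sum>j<k. D ^ j) * D)"
    unfolding fixed_edges_bound_def
  proof (intro allI impI, elim conjE)
    fix X Q0 assume X: "X \<subseteq> carrier G" "infinite X" and Q0: "Q0 \<subseteq> E'" "finite Q0"
      and fix0: "\<forall>q\<in>Q0. \<forall>x\<in>X. \<phi>' x ` q = q"
    show "card Q0 \<le> (\<Sum>j<k. D ^ j) * D"
    proof (cases "Q0 = {}")
      case False
      define FV where "FV = {v \<in> V'. \<forall>x\<in>X. \<phi>' x v = v}"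
      define FE where "FE w = {q \<in> E'. w \<in> f ` q \<and> (\<forall>x\<in>X. \<phi>' x ` q = q)}" for w
      have FE: "finite (FE w) \<and> card (FE w) \<le> D" for w
      proof (rule finite_card_le_if_subsets)
        show "card Q \<le> D" if "Q \<subseteq> FE w" "finite Q" for Q
          by (rule D[OF X _ that(2), of w]) (use that FE_def in blast)+
      qed
      have edge_FV: "u \<in> FV" if "q \<in> E'" "\<forall>x\<in>X. \<phi>' x ` q = q" "u \<in> q" for q u
        using that X T'.fixes_edge T'.T.edge_subset unfolding FV_def by blast
      obtain q0 where "q0 \<in> Q0" using False by blast
      then obtain u0 where u0: "u0 \<in> FV"
        using edge_FV fix0 Q0 T'.T.edge_obtain by (metis insertI1 subsetD)
      define x0 where "x0 = f u0"
      have FVV: "u \<in> V'" if "u \<in> FV" for u using that by (simp add: FV_def)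
      have fixT: "\<phi> x (f u) = f u" if "u \<in> FV" "x \<in> X" for u x
        using f_equiv[of x u] that X(1) by (auto simp: FV_def)
      define L where "L j = {w \<in> f ` FV. T.T.td x0 w = j}" for j
      \<comment> \<open>Otherwise the geodesic from \<open>x0\<close> to \<open>f u\<close> has
        length at least \<open>k\<close> while its pointwise stabiliser contains the infinite set
        \<open>X\<close>.\<close>
      have lt: "T.T.td x0 (f u) < k" if u: "u \<in> FV" for u
      proof (rule ccontr)
        assume nlt: "\<not> T.T.td x0 (f u) < k"
        have V: "x0 \<in> V" "f u \<in> V" using u0 u FVV f_V x0_def by auto
        obtain p where p: "edge_path V E p" "hd p = x0" "last p = f u" "distinct p"
          "length p = Suc (T.T.td x0 (f u))" using T.T.distinct_path[OF V] by metis
        let ?K = "{g \<in> carrier G. \<forall>v\<in>set p. \<phi> g v = v}"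
        have "finite ?K" using kC p nlt unfolding kC_acylindrical_def by simp
        moreover have "X \<subseteq> ?K"
        proof
          fix x assume x: "x \<in> X"
          then have xG: "x \<in> carrier G" using X by blast
          have "\<phi> x v = v" if "v \<in> set p" for v
            by (rule T.fixes_path[OF xG p(1,4) _ _ that]) (use p fixT u u0 x x0_def in auto)
          then show "x \<in> ?K" using xG by blast
        qed
        ultimately show False using X(2) finite_subset by blast
      qed
      have Lstep: "L (Suc j) \<subseteq> (\<Union>w'\<in>L j. \<Union>q\<in>FE w'. f ` q - {w'})" for j
      proof
        fix w assume "w \<in> L (Suc j)"
        then obtain u where u: "u \<in> FV" "w = f u" "T.T.td x0 w = Suc j" by (auto simp: L_def)
        have V: "x0 \<in> V" "w \<in> V" using u0 u FVV f_V x0_def by auto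
        have "w \<noteq> x0" using u(3) by auto
        then obtain w' where w': "{w, w'} \<in> T.T.walls w x0" using T.T.toward_exists V by metis
        obtain p where p: "edge_path V' E' p" "hd p = u0" "last p = u" "distinct p"
          using T'.T.distinct_path[OF FVV[OF u0] FVV[OF u(1)]] by metis
        have ne: "p \<noteq> []" using p by (auto simp: edge_path_def)
        have pFV: "v \<in> FV" if v: "v \<in> set p" for v
        proof -
          have "\<phi>' x v = v" if "x \<in> X" for x
            by (rule T'.fixes_path[OF _ p(1,4) _ _ v]) (use that p u u0 X in \<open>auto simp: FV_def\<close>)
          then show ?thesis using v p(1) by (auto simp: FV_def edge_path_def)
        qed
        have "{w, w'} \<in> T.T.walls x0 w" using w' T.T.walls_commute by metis
        \<comment> \<open>The image of the fixed path from \<open>u0\<close> to \<open>u\<close> may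
          backtrack, but it crosses every edge that separates \<open>x0\<close> from
          \<open>w\<close>. So the last edge of the geodesic to \<open>w\<close> is the image of a
          fixed edge.\<close>
        moreover have "T.T.walls x0 w \<subseteq> path_edges (map f p)"
        proof -
          have "hd (map f p) = x0" "last (map f p) = w" using p u ne by (auto simp: hd_map last_map x0_def)
          then show ?thesis using is_cut_path[OF edge_path_image[OF p(1)] T.T.is_cut_cut]
            unfolding T.T.walls_def by blast
        qed
        ultimately obtain q where q: "q \<in> path_edges p" "{w, w'} = f ` q"
          unfolding path_edges_map by blast
        have qE: "q \<in> E'" using path_edges_subset[OF p(1)] q(1) by blast
        have qF: "v \<in> FV" if "v \<in> q" for v using that pFV path_edges_subset_set[OF q(1)] by blast
        have "\<phi>' x ` q = q" if "x \<in> X" for x using qF that by (force simp: FV_def)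
        then have "q \<in> FE w'" using qE q(2) by (auto simp: FE_def)
        moreover have "w' \<in> L j"
        proof -
          have "w' \<in> f ` FV" using q(2) qF by blast
          moreover have "T.T.td x0 w' = j"
            using T.T.toward_walls(2)[OF V(2,1) w'] u(3) T.T.td_commute by simp
          ultimately show ?thesis by (simp add: L_def)
        qed
        moreover have "w \<in> f ` q - {w'}"
          using q(2) w' T.T.walls_subset T.T.edge_neq by blast
        ultimately show "w \<in> (\<Union>w'\<in>L j. \<Union>q\<in>FE w'. f ` q - {w'})" by blast
      qed
      have cardL: "finite (L j) \<and> card (L j) \<le> D ^ j" for j
      proof (induction j)
        case 0
        have "L 0 \<subseteq> {x0}" using T.T.td_eq_0 u0 FVV f_V x0_def by (auto simp: L_def)
        then show ?case using card_mono[of "{x0}" "L 0"] finite_subset by auto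
      next
        case (Suc j)
        have one: "finite (f ` q - {w'}) \<and> card (f ` q - {w'}) \<le> 1" if "q \<in> FE w'" for q w'
        proof -
          have "f ` q \<in> E" "w' \<in> f ` q" using that f_E by (auto simp: FE_def)
          then have "card (f ` q) = 2" using T.T.simplicial by (auto simp: simplicial_graph_def)
          moreover from this have "finite (f ` q)" by (intro card_ge_0_finite) simp
          ultimately show ?thesis using \<open>w' \<in> f ` q\<close> by (simp add: card_Diff_singleton)
        qed
        have "finite (\<Union>q\<in>FE w'. f ` q - {w'}) \<and> card (\<Union>q\<in>FE w'. f ` q - {w'}) \<le> D" for w'
        proof -
          have "finite (\<Union>q\<in>FE w'. f ` q - {w'}) \<and> card (\<Union>q\<in>FE w'. f ` q - {w'}) \<le> (\<Sum>q\<in>FE w'. 1)"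
            using FE[of w'] one by (intro card_UN_le_sum[where B = "\<lambda>q. f ` q - {w'}"]) auto
          then show ?thesis using FE[of w'] by simp
        qed
        then have "finite (L (Suc j)) \<and> card (L (Suc j)) \<le> (\<Sum>w'\<in>L j. D)"
          using Suc by (intro card_UN_le_sum[OF _ Lstep]) auto
        then show ?case using Suc by (auto intro: order_trans mult_le_mono1)
      qed
      have "finite (\<Union>j<k. L j) \<and> card (\<Union>j<k. L j) \<le> (\<Sum>j<k. D ^ j)"
        using cardL by (intro card_UN_le_sum[where B = L]) auto
      moreover have "f ` FV = (\<Union>j<k. L j)" using lt by (auto simp: L_def)
      ultimately have Im: "finite (f ` FV)" "card (f ` FV) \<le> (\<Sum>j<k. D ^ j)" by auto
      have "finite Q0 \<and> card Q0 \<le> (\<Sum>w\<in>f ` FV. D)"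
      proof (rule card_UN_le_sum[OF Im(1)])
        show "Q0 \<subseteq> (\<Union>w\<in>f ` FV. FE w)"
        proof
          fix q assume q: "q \<in> Q0"
          then obtain u where u: "u \<in> q" using Q0 T'.T.edge_obtain by (metis insertI1 subsetD)
          have "u \<in> FV" using edge_FV q u Q0 fix0 by blast
          moreover have "q \<in> FE (f u)" using q u Q0 fix0 by (auto simp: FE_def)
          ultimately show "q \<in> (\<Union>w\<in>f ` FV. FE w)" by blast
        qed
      qed (rule FE)
      then show ?thesis using Im(2) by (auto intro: order_trans mult_le_mono1)
    qed simp
  qed
  then show ?thesis ..
qed

end

section \<open>Elementary actions\<close>

lemma path_edges_nth: "Suc i < length p \<Longrightarrow> {p ! i, p ! Suc i} \<in> path_edges p"
proof (induction p arbitrary: i rule: path_edges.induct)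
  case (1 x y p)
  then show ?case by (cases i) auto
qed auto

context simplicial_tree
begin

lemma reduced_walk_walls_range:
  fixes \<gamma> :: "int \<Rightarrow> 'v"
  assumes e: "\<And>i. {\<gamma> i, \<gamma> (i + 1)} \<in> E" and red: "\<And>i. \<gamma> (i + 2) \<noteq> \<gamma> i"
    and d: "d \<in> walls (\<gamma> a) (\<gamma> b)"
  shows "d \<subseteq> range \<gamma>"
proof -
  have *: "d \<subseteq> range \<gamma>" if "d \<in> walls (\<gamma> a) (\<gamma> b)" "a \<le> b" for a b
  proof -
    have "walls (\<gamma> a) (\<gamma> (a + int (nat (b - a)))) =
        {{\<gamma> j, \<gamma> (j + 1)} | j. a \<le> j \<and> j < a + int (nat (b - a))}"
      by (rule reduced_walk_td(1)) (fact e red)+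
    then have "d \<in> {{\<gamma> j, \<gamma> (j + 1)} | j. a \<le> j \<and> j < b}" using that by simp
    then show ?thesis by auto
  qed
  show ?thesis
  proof (cases "a \<le> b")
    case False
    then show ?thesis using *[of b a] d walls_commute by simp
  qed (use * d in blast)
qed

text \<open>Near \<open>\<delta> c\<close> the two walks cannot diverge, because both ends of \<open>\<delta>\<close> stay within
  distance \<open>D\<close> of \<open>\<gamma>\<close>.\<close>

lemma parallel_walks:
  fixes \<gamma> \<delta> :: "int \<Rightarrow> 'v" and \<tau> :: int
  assumes e: "\<And>i. {\<gamma> i, \<gamma> (i + 1)} \<in> E" and red: "\<And>i. \<gamma> (i + 2) \<noteq> \<gamma> i"
    and e': "\<And>i. {\<delta> i, \<delta> (i + 1)} \<in> E" and red': "\<And>i. \<delta> (i + 2) \<noteq> \<delta> i"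
    and \<tau>: "\<tau> > 0" and par: "\<And>j. \<exists>a. td (\<gamma> a) (\<delta> (c + \<tau> * j)) \<le> D"
  shows "\<delta> c \<in> range \<gamma>"
proof -
  have V: "\<gamma> i \<in> V" "\<delta> i \<in> V" for i using e e' edge_in_V by blast+
  \<comment> \<open>A multiple of \<tau>, so that \<open>c + m\<close> and \<open>c - m\<close> are
    points at which \<open>par\<close> applies, and larger than \<open>D\<close>.\<close>
  define m where "m = nat (\<tau> * (int D + 1))"
  have m: "int m = \<tau> * (int D + 1)" using \<tau> by (simp add: m_def)
  have "int D < int m"
  proof -
    have "int D + 1 \<le> \<tau> * (int D + 1)" using mult_right_mono[of 1 \<tau> "int D + 1"] \<tau> by simp
    then show ?thesis unfolding m by (rule add1_zle_eq[THEN iffD1])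
  qed
  then have Dm: "D < m" by simp
  obtain a where a: "td (\<gamma> a) (\<delta> (c + int m)) \<le> D"
    using par[of "int D + 1"] unfolding m by blast
  obtain b where b: "td (\<gamma> b) (\<delta> (c - int m)) \<le> D"
  proof -
    have "c + \<tau> * (- (int D + 1)) = c - int m"
      unfolding m by (simp only: mult_minus_right add_uminus_conv_diff)
    then show ?thesis using that par[of "- (int D + 1)"] by metis
  qed
  let ?d = "{\<delta> c, \<delta> (c + 1)}"
  have "?d \<in> walls (\<delta> (c - int m)) (\<delta> (c + int m))"
  proof -
    have w: "walls (\<delta> (c - int m)) (\<delta> (c - int m + int (2 * m))) =
        {{\<delta> j, \<delta> (j + 1)} | j. c - int m \<le> j \<and> j < c - int m + int (2 * m)}"
      by (rule reduced_walk_td(1)) (fact e' red')+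
    have "c - int m \<le> c \<and> c < c - int m + int (2 * m)" using Dm by simp
    then have "?d \<in> walls (\<delta> (c - int m)) (\<delta> (c - int m + int (2 * m)))" unfolding w by blast
    then show ?thesis by (simp add: algebra_simps)
  qed
  \<comment> \<open>An edge at \<open>\<delta> c\<close> that separates \<open>\<delta> z\<close>
    from \<open>\<gamma> y\<close> would put \<open>\<gamma> y\<close> at distance at least
    \<open>m > D\<close> from \<open>\<delta> z\<close>.\<close>
  moreover have far: "?d \<notin> walls (\<delta> z) (\<gamma> y)"
    if "td (\<gamma> y) (\<delta> z) \<le> D" "td (\<delta> z) (\<delta> c) = m" for y z
  proof
    assume "?d \<in> walls (\<delta> z) (\<gamma> y)"
    then have "walls (\<delta> z) (\<delta> c) \<subseteq> walls (\<delta> z) (\<gamma> y)"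
      using walls_mono_endpoint V by blast
    then have "td (\<delta> z) (\<delta> c) \<le> td (\<delta> z) (\<gamma> y)"
      unfolding td_def using finite_walls V by (intro card_mono) auto
    then show False using that Dm td_commute by simp
  qed
  have "td (\<delta> (c - int m)) (\<delta> (c - int m + int m)) = m" "td (\<delta> c) (\<delta> (c + int m)) = m"
    by (rule reduced_walk_td(2)[OF e' red'])+
  then have "?d \<notin> walls (\<delta> (c - int m)) (\<gamma> b)" "?d \<notin> walls (\<delta> (c + int m)) (\<gamma> a)"
    using far a b td_commute by auto
  \<comment> \<open>The edge separates the two far points of \<delta> but neither of them from its
    nearby point on \<gamma>; so it separates two points of \<gamma> and lies on \<gamma>.\<close>
  ultimately have "?d \<in> walls (\<gamma> b) (\<gamma> a)" by (auto simp: walls_def)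
  then show ?thesis using reduced_walk_walls_range[OF e red] by blast
qed

end

section \<open>Axes and finite orbits\<close>

context tree_action
begin

text \<open>The axis passes through a point of minimal displacement.\<close>

lemma exists_axis:
  assumes g: "g \<in> carrier G" and nofix: "\<And>v. v \<in> V \<Longrightarrow> \<phi> g v \<noteq> v"
  obtains \<gamma> :: "int \<Rightarrow> 'v" and \<tau> :: int where "\<tau> > 0" "\<And>i. {\<gamma> i, \<gamma> (i + 1)} \<in> E"
    "\<And>i. \<gamma> (i + 2) \<noteq> \<gamma> i" "\<And>i. \<phi> g (\<gamma> i) = \<gamma> (i + \<tau>)"
proof -
  obtain v0 where "v0 \<in> V" using tree by (auto simp: is_tree_def)
  then obtain v where v: "v \<in> V" and min: "\<And>u. u \<in> V \<Longrightarrow> T.td v (\<phi> g v) \<le> T.td u (\<phi> g u)"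
    using ex_has_least_nat[of "\<lambda>v. v \<in> V" v0 "\<lambda>v. T.td v (\<phi> g v)"] by blast
  have gv: "\<phi> g v \<in> V" using act_closed g v by blast
  obtain p where p: "edge_path V E p" "hd p = v" "last p = \<phi> g v" "distinct p"
    "T.walls v (\<phi> g v) = path_edges p" "length p = Suc (T.td v (\<phi> g v))"
    using T.distinct_path[OF v gv] by metis
  define t where "t = T.td v (\<phi> g v)"
  have t0: "t > 0" using T.td_eq_0[OF v gv] nofix[OF v] by (auto simp: t_def)
  have len: "length p = Suc t" using p by (simp add: t_def)
  then have "p \<noteq> []" by auto
  then have p0: "p ! 0 = v" and pt: "p ! t = \<phi> g v"
    using p len by (auto simp: hd_conv_nth last_conv_nth)
  have pV: "p ! r \<in> V" if "r \<le> t" for r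
    using p(1) len that nth_mem[of r p] by (auto simp: edge_path_def)
  have pE: "{p ! r, p ! Suc r} \<in> path_edges p" if "r < t" for r
    using path_edges_nth[of r p] len that by simp
  have pE': "{p ! r, p ! Suc r} \<in> E" if "r < t" for r
    using pE[OF that] path_edges_subset[OF p(1)] by blast
  have pneq: "p ! r = p ! s \<longleftrightarrow> r = s" if "r \<le> t" "s \<le> t" for r s
    using nth_eq_iff_index_eq[OF p(4)] that len by simp
  \<comment> \<open>The path \<open>p\<close> and its translate by \<open>g\<close> meet without
    backtracking. Otherwise \<open>p ! 1\<close> would be displaced by less than \<open>t\<close>,
    or, for \<open>t = 1\<close>, the edge \<open>{v, \<phi> g v}\<close> would be inverted.\<close>
  have turn: "\<phi> g (p ! 1) \<noteq> p ! (t - 1)"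
  proof
    assume eq: "\<phi> g (p ! 1) = p ! (t - 1)"
    show False
    proof (cases "t = 1")
      case True
      then have "\<phi> g (\<phi> g v) = v" "{v, \<phi> g v} \<in> E" using eq p0 pt pE'[of 0] by auto
      then show False using no_inversion[OF g] by blast
    next
      case False
      then have t2: "t \<ge> 2" using t0 by simp
      let ?u = "p ! 1" and ?y = "p ! (t - 1)" and ?w = "\<phi> g v"
      have u: "{v, ?u} \<in> T.walls v ?w" using pE[of 0] t0 p0 p(5) by simp
      have y: "{?w, ?y} \<in> T.walls v ?w" using pE[of "t - 1"] t0 pt p(5) by (simp add: insert_commute)
      have uV: "?u \<in> V" using pV t2 by simp
      have "?w \<noteq> v" "?w \<noteq> ?u" using pneq[of t 0] pneq[of t 1] p0 pt t2 by auto
      then have "{?w, ?y} \<noteq> {v, ?u}" by (auto simp: doubleton_eq_iff)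
      then have "{?w, ?y} \<in> T.walls ?w ?u"
        unfolding T.walls_commute[of ?w ?u] T.toward_walls(1)[OF v gv u] using y by blast
      then have "T.td ?w ?u = Suc (T.td ?y ?u)" using T.toward_walls(2)[OF gv uV] by blast
      moreover have "t = Suc (T.td ?u ?w)" using T.toward_walls(2)[OF v gv u] by (simp add: t_def)
      ultimately have "T.td ?u (\<phi> g ?u) < t" using eq T.td_commute by simp
      then show False using min[OF uV] by (simp add: t_def)
    qed
  qed
  \<comment> \<open>The concatenation of the translates of \<open>p\<close> by powers of
    \<open>g\<close>. Allowing \<open>r = t\<close> in the next formula for \<gamma> says that
    consecutive translates fit together.\<close>
  define \<gamma> where "\<gamma> i = \<phi> (g [^] (i div int t)) (p ! nat (i mod int t))" for i
  have pc: "g [^] d \<in> carrier G" for d :: int using g by simp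
  have psuc: "g [^] (d + 1) = g [^] d \<otimes> g" "g [^] (d + 1) = g \<otimes> g [^] d" for d :: int
    using int_pow_mult[OF g, of d 1] int_pow_mult[OF g, of 1 d] g by (auto simp: add.commute)
  have \<gamma>: "\<gamma> (d * int t + int r) = \<phi> (g [^] d) (p ! r)" if r: "r \<le> t" for d r
  proof (cases "r = t")
    case True
    have "\<gamma> (d * int t + int r) = \<gamma> ((d + 1) * int t)" using True by (simp add: algebra_simps)
    also have "\<dots> = \<phi> (g [^] (d + 1)) v" using t0 p0 by (simp add: \<gamma>_def)
    also have "\<dots> = \<phi> (g [^] d) (\<phi> g v)" unfolding psuc(1) using composition_rule[OF v pc g] .
    finally show ?thesis using True pt by simp
  next
    case False
    then show ?thesis using r t0 by (simp add: \<gamma>_def)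
  qed
  have split: "\<exists>d r. i = d * int t + int r \<and> r < t" for i
  proof (intro exI conjI)
    show "i = (i div int t) * int t + int (nat (i mod int t))" using t0 by simp
    show "nat (i mod int t) < t" using t0 by (simp add: nat_less_iff)
  qed
  show ?thesis
  proof (rule that[of "int t" \<gamma>])
    show "int t > 0" using t0 by simp
    fix i
    obtain d r where i: "i = d * int t + int r" "r < t" using split by blast
    have i0: "\<gamma> i = \<phi> (g [^] d) (p ! r)" using i \<gamma> by simp
    have i1: "\<gamma> (i + 1) = \<phi> (g [^] d) (p ! Suc r)" using \<gamma>[of "Suc r" d] i by (simp add: algebra_simps)
    show "{\<gamma> i, \<gamma> (i + 1)} \<in> E" unfolding i0 i1 using act_edge[OF pc pE'[OF i(2)]] .
    show "\<phi> g (\<gamma> i) = \<gamma> (i + int t)"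
    proof -
      have "\<gamma> (i + int t) = \<phi> (g [^] (d + 1)) (p ! r)"
        using \<gamma>[of r "d + 1"] i by (simp add: algebra_simps)
      then show ?thesis unfolding i0 psuc(2) using composition_rule[OF pV g pc] i by simp
    qed
    show "\<gamma> (i + 2) \<noteq> \<gamma> i"
    proof (cases "Suc (Suc r) \<le> t")
      case True
      then have "\<gamma> (i + 2) = \<phi> (g [^] d) (p ! Suc (Suc r))"
        using \<gamma>[of "Suc (Suc r)" d] i by (simp add: algebra_simps)
      then show ?thesis unfolding i0 using True act_inject[OF pc pV pV] pneq by simp
    next
      case False
      then have r: "r = t - 1" using i by simp
      have i2: "i + 2 = (d + 1) * int t + int 1" using i r t0 by (simp add: algebra_simps)
      have "\<gamma> (i + 2) = \<phi> (g [^] (d + 1)) (p ! 1)"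
        unfolding i2 using \<gamma>[of 1 "d + 1"] t0 by simp
      also have "\<dots> = \<phi> (g [^] d) (\<phi> g (p ! 1))"
        unfolding psuc(1) using composition_rule[OF pV pc g] t0 by simp
      finally show ?thesis unfolding i0 r
        using turn act_inject[OF pc act_closed[OF g pV] pV] t0 by simp
    qed
  qed
qed

text \<open>From a point \<open>v\<close> whose orbit has positive radius, all other points of the orbit
  lie behind the same neighbour \<open>u\<close>, and the orbit of \<open>u\<close> has smaller radius (if
  the radius is 1, the edge \<open>{v, u}\<close> is inverted).\<close>

lemma finite_orbit_imp_fixed_vertex:
  assumes v: "v \<in> V" "finite ((\<lambda>g. \<phi> g v) ` carrier G)"
  shows "\<exists>v\<in>V. \<forall>g\<in>carrier G. \<phi> g v = v"
proof -
  define orb where "orb v = (\<lambda>g. \<phi> g v) ` carrier G" for v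
  define rad where "rad v = Max (T.td v ` orb v)" for v
  have le: "T.td w (\<phi> g w) \<le> rad w" if "g \<in> carrier G" "finite (orb w)" for g w
    using that unfolding rad_def by (intro Max_ge) (auto simp: orb_def)
  obtain v where v: "v \<in> V" "finite (orb v)"
    and min: "\<And>u. u \<in> V \<Longrightarrow> finite (orb u) \<Longrightarrow> rad v \<le> rad u"
    using ex_has_least_nat[of "\<lambda>v. v \<in> V \<and> finite (orb v)" v rad] assms unfolding orb_def by blast
  define R where "R = rad v"
  have orb_ne: "T.td v ` orb v \<noteq> {}" using one_closed by (auto simp: orb_def)
  have "R \<in> T.td v ` orb v"
    unfolding R_def rad_def using v(2) orb_ne by (intro Max_in) auto
  then obtain g where g: "g \<in> carrier G" "T.td v (\<phi> g v) = R" by (auto simp: orb_def)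
  have cl: "\<phi> h v \<in> V" if "h \<in> carrier G" for h using act_closed that v(1) by blast
  have "R = 0"
  proof (rule ccontr)
    assume R0: "R \<noteq> 0"
    define y where "y = \<phi> g v"
    have y: "y \<in> V" "v \<noteq> y" using cl g R0 T.td_self by (auto simp: y_def)
    obtain u where u: "{v, u} \<in> T.walls v y" using T.toward_exists[OF v(1) y] by blast
    have uV: "u \<in> V" and uE: "{v, u} \<in> E" using T.toward_walls(3,4)[OF v(1) y(1) u] by auto
    \<comment> \<open>An orbit is homogeneous, so the radius at \<open>v\<close> bounds all
      distances within it.\<close>
    have dist_orb: "T.td (\<phi> h v) (\<phi> k v) \<le> R" if hk: "h \<in> carrier G" "k \<in> carrier G" for h k
    proof -
      have "\<phi> h (\<phi> (inv h \<otimes> k) v) = \<phi> k v"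
        using composition_rule[OF v(1), of h "inv h \<otimes> k"] hk by (simp add: inv_cancel)
      then have "T.td (\<phi> h v) (\<phi> k v) = T.td v (\<phi> (inv h \<otimes> k) v)"
        using td_act[of h v "\<phi> (inv h \<otimes> k) v"] hk v(1) cl by simp
      then show ?thesis using le[of "inv h \<otimes> k" v] hk v by (simp add: R_def)
    qed
    \<comment> \<open>By \<open>tripod\<close>, an orbit point in another branch at \<open>v\<close>
      would have distance from \<open>y\<close> equal to \<open>R\<close> plus a positive
      number.\<close>
    have toward: "{v, u} \<in> T.walls v (\<phi> h v)" if h: "h \<in> carrier G" "\<phi> h v \<noteq> v" for h
    proof (rule ccontr)
      assume "{v, u} \<notin> T.walls v (\<phi> h v)"
      then have "T.walls v y \<inter> T.walls v (\<phi> h v) = {}"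
        using T.tripod[OF v(1) y(1) cl[OF h(1)] u] by blast
      then have "T.td y (\<phi> h v) = T.td y v + T.td v (\<phi> h v)"
        using T.td_disjoint[OF y(1) v(1) cl[OF h(1)]] T.walls_commute by metis
      moreover have "T.td v (\<phi> h v) \<noteq> 0" using T.td_eq_0[OF v(1) cl[OF h(1)]] h(2) by auto
      moreover have "T.td y v = R" using g(2) T.td_commute by (simp add: y_def)
      ultimately show False using dist_orb[OF g(1) h(1)] by (simp add: y_def)
    qed
    have toward': "{\<phi> h v, \<phi> h u} \<in> T.walls (\<phi> h v) (\<phi> k v)"
      if hk: "h \<in> carrier G" "k \<in> carrier G" "\<phi> h v \<noteq> \<phi> k v" for h k
    proof -
      have k: "\<phi> h (\<phi> (inv h \<otimes> k) v) = \<phi> k v"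
        using composition_rule[OF v(1), of h "inv h \<otimes> k"] hk by (simp add: inv_cancel)
      then have "{v, u} \<in> T.walls v (\<phi> (inv h \<otimes> k) v)" using hk by (intro toward) auto
      then show ?thesis
        using mem_walls_act[OF hk(1) v(1) cl[of "inv h \<otimes> k"] v(1) uV] hk k by simp
    qed
    have fin_u: "finite (orb u)"
    proof (rule finite_subset)
      \<comment> \<open>Each translate of \<open>u\<close> lies on a geodesic between two points of
        the finite orbit of \<open>v\<close>.\<close>
      show "orb u \<subseteq> \<Union> (\<Union> ((\<lambda>(a, b). T.walls a b) ` (orb v \<times> orb v)))"
      proof
        fix w assume "w \<in> orb u"
        then obtain h where h: "h \<in> carrier G" "w = \<phi> h u" by (auto simp: orb_def)
        have hy: "\<phi> h y = \<phi> (h \<otimes> g) v" using composition_rule[OF v(1) h(1) g(1)] by (simp add: y_def)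
        have "\<phi> h v \<noteq> \<phi> (h \<otimes> g) v" using act_inject[OF h(1) v(1) y(1)] y(2) hy by simp
        then have "{\<phi> h v, w} \<in> T.walls (\<phi> h v) (\<phi> (h \<otimes> g) v)" using toward' h g(1) by simp
        moreover have "\<phi> h v \<in> orb v" "\<phi> (h \<otimes> g) v \<in> orb v" using h g by (auto simp: orb_def)
        ultimately show "w \<in> \<Union> (\<Union> ((\<lambda>(a, b). T.walls a b) ` (orb v \<times> orb v)))" by blast
      qed
      have "finite e" if "e \<in> T.walls a b" for e a b
        using that T.walls_subset[of a b] T.edge_obtain[of e] by (metis finite.simps subsetD)
      moreover have "finite (T.walls a b)" if "a \<in> orb v" "b \<in> orb v" for a b
        using that cl by (intro T.finite_walls) (auto simp: orb_def)
      ultimately show "finite (\<Union> (\<Union> ((\<lambda>(a, b). T.walls a b) ` (orb v \<times> orb v))))"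
        using v(2) by (intro finite_Union) auto
    qed
    have small: "T.td u (\<phi> h u) < R" if h: "h \<in> carrier G" for h
    proof (cases "R = 1")
      case True
      have vy: "{v, y} \<in> E" using T.td_eq_1[OF v(1) y(1)] g(2) True by (simp add: y_def)
      have gy: "\<phi> g y = \<phi> (g \<otimes> g) v" using composition_rule[OF v(1) g(1) g(1)] by (simp add: y_def)
      have "\<phi> g y \<noteq> v" using no_inversion[OF g(1) vy] by (auto simp: y_def)
      then have n: "{v, u} \<in> T.walls v (\<phi> g y)" unfolding gy using toward g(1) by simp
      have gyV: "\<phi> g y \<in> V" using act_closed g(1) y(1) by blast
      have "T.td v (\<phi> g y) = 1"
        using dist_orb[of \<one> "g \<otimes> g"] g(1) act_one[OF v(1)] gy True T.td_eq_0[OF v(1) gyV] \<open>\<phi> g y \<noteq> v\<close>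
        by (simp add: le_Suc_eq)
      then have "T.walls v (\<phi> g y) = {{v, \<phi> g y}}" using T.td_eq_1[OF v(1) gyV] T.walls_edge by blast
      moreover have "T.walls v y = {{v, y}}" using T.walls_edge[OF vy] .
      ultimately have "\<phi> g y = y" using n u by (auto simp: doubleton_eq_iff)
      moreover have "T.td y (\<phi> g y) = 1" using td_act[OF g(1) v(1) y(1)] T.td_edge[OF vy] by (simp add: y_def)
      ultimately show ?thesis by simp
    next
      case False
      then have R2: "R \<ge> 2" using R0 by simp
      have huV: "\<phi> h u \<in> V" using act_closed h uV by blast
      show ?thesis
      \<comment> \<open>If \<open>h\<close> fixes \<open>v\<close>, it also fixes the neighbour
        \<open>u\<close> towards the rest of the orbit. Otherwise the geodesic from \<open>v\<close>
        to \<open>\<phi> h v\<close> starts with \<open>{v, u}\<close> and ends with its translate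
        by \<open>h\<close>. Removing both shortens it by two, unless they are the same edge; that
        case uses \<open>R2\<close>.\<close>
      proof (cases "\<phi> h v = v")
        case True
        have hy: "\<phi> h y = \<phi> (h \<otimes> g) v" using composition_rule[OF v(1) h g(1)] by (simp add: y_def)
        have ne: "\<phi> h v \<noteq> \<phi> (h \<otimes> g) v" using act_inject[OF h v(1) y(1)] y(2) hy by simp
        then have "{v, \<phi> h u} \<in> T.walls v (\<phi> (h \<otimes> g) v)"
          using toward'[OF h, of "h \<otimes> g"] h g(1) True by simp
        moreover have "{v, u} \<in> T.walls v (\<phi> (h \<otimes> g) v)"
          using toward[of "h \<otimes> g"] ne True h g(1) by simp
        ultimately have "\<phi> h u = u" using T.toward_unique[OF v(1)] cl h g(1) by (metis m_closed)
        then show ?thesis using R0 by simp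
      next
        case hv: False
        have a: "{v, u} \<in> T.walls v (\<phi> h v)" using toward h hv by blast
        have b: "{\<phi> h v, \<phi> h u} \<in> T.walls (\<phi> h v) v"
          using toward'[OF h one_closed] hv act_one[OF v(1)] by simp
        have da: "T.td v (\<phi> h v) = Suc (T.td u (\<phi> h v))"
          using T.toward_walls(2)[OF v(1) cl[OF h] a] .
        show ?thesis
        proof (cases "u = \<phi> h v")
          case True
          then have "T.td (\<phi> h v) v = 1" using da T.td_commute by simp
          then have "T.td (\<phi> h u) v = 0" using T.toward_walls(2)[OF cl[OF h] v(1) b] by simp
          then have "\<phi> h u = v" using T.td_eq_0[OF huV v(1)] by simp
          then show ?thesis using True \<open>T.td (\<phi> h v) v = 1\<close> R2 by simp
        next
          case False
          then have "{\<phi> h v, \<phi> h u} \<noteq> {v, u}" using hv by (auto simp: doubleton_eq_iff)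
          then have "{\<phi> h v, \<phi> h u} \<in> T.walls (\<phi> h v) u"
            unfolding T.walls_commute[of "\<phi> h v" u] T.toward_walls(1)[OF v(1) cl[OF h] a]
            using b unfolding T.walls_commute[of "\<phi> h v" v] by blast
          then have "T.td (\<phi> h v) u = Suc (T.td (\<phi> h u) u)"
            using T.toward_walls(2)[OF cl[OF h] uV] by blast
          then have "T.td u (\<phi> h u) < T.td v (\<phi> h v)" using da T.td_commute by simp
          then show ?thesis using le[OF h v(2)] by (simp add: R_def)
        qed
      qed
    qed
    have "T.td u ` orb u \<noteq> {}" using one_closed by (auto simp: orb_def)
    then have "rad u < R" unfolding rad_def using fin_u small by (subst Max_less_iff) (auto simp: orb_def)
    then show False using min[OF uV fin_u] by (simp add: R_def)
  qed
  then have "\<phi> h v = v" if "h \<in> carrier G" for h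
    using le[OF that v(2)] T.td_eq_0[OF v(1) cl[OF that]] by (simp add: R_def)
  then show ?thesis using v(1) by blast
qed

end

text \<open>A property of \<open>G\<close> alone, so that it passes from one tree to another. Up to
  the finite error set \<open>N\<close>, every \<open>h\<close> conjugates \<open>g [^] j\<close> to
  \<open>g [^] (\<epsilon> * j)\<close>, and finitely many left translates of the powers of
  \<open>g\<close> cover \<open>G\<close>. One set \<open>N\<close> serves all \<open>j\<close>,
  which keeps translates of an axis of \<open>g\<close> at bounded distance from it.\<close>

definition virtually_cyclic_by ::
  "('g, 'b) monoid_scheme \<Rightarrow> 'g \<Rightarrow> 'g set \<Rightarrow> 'g set \<Rightarrow> bool" where
  "virtually_cyclic_by G g N B \<longleftrightarrow>
    g \<in> carrier G \<and> finite N \<and> N \<subseteq> carrier G \<and> finite B \<and> B \<subseteq> carrier G \<and>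
    (\<forall>h\<in>carrier G. \<exists>\<epsilon>::int. \<forall>j::int. \<exists>n\<in>N.
       h \<otimes>\<^bsub>G\<^esub> g [^]\<^bsub>G\<^esub> j = g [^]\<^bsub>G\<^esub> (\<epsilon> * j) \<otimes>\<^bsub>G\<^esub> n \<otimes>\<^bsub>G\<^esub> h) \<and>
    (\<forall>h\<in>carrier G. \<exists>b\<in>B. \<exists>n\<in>N. \<exists>j::int. h = b \<otimes>\<^bsub>G\<^esub> n \<otimes>\<^bsub>G\<^esub> g [^]\<^bsub>G\<^esub> j)"

text \<open>If \<open>g\<close> fixes a vertex, the orbit of that vertex is finite, so some vertex
  is fixed by \<open>G\<close>. Otherwise \<open>h\<close> maps the axis of \<open>g\<close> to a
  walk that stays near the axis, hence into it by \<open>parallel_walks\<close>; the inverse of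
  \<open>h\<close> gives the other inclusion.\<close>

lemma (in tree_action) virtually_cyclic_imp_elementary:
  assumes vc: "virtually_cyclic_by G g N B"
  shows "\<not> non_elementary G V E \<phi>"
proof -
  have g: "g \<in> carrier G" and N: "finite N" "N \<subseteq> carrier G" and B: "finite B" "B \<subseteq> carrier G"
    and tw: "\<And>h. h \<in> carrier G \<Longrightarrow> \<exists>\<epsilon>::int. \<forall>j::int. \<exists>n\<in>N. h \<otimes> g [^] j = g [^] (\<epsilon> * j) \<otimes> n \<otimes> h"
    and fi: "\<And>h. h \<in> carrier G \<Longrightarrow> \<exists>b\<in>B. \<exists>n\<in>N. \<exists>j::int. h = b \<otimes> n \<otimes> g [^] j"
    using vc by (auto simp: virtually_cyclic_by_def)
  have pc: "g [^] d \<in> carrier G" for d :: int using g by simp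
  show ?thesis
  proof (cases "\<exists>v\<in>V. \<phi> g v = v")
    case True
    then obtain v where v: "v \<in> V" "\<phi> g v = v" by blast
    have gj: "\<phi> (g [^] j) v = v" for j :: int
    proof -
      have "g [^] j \<in> vertex_stab G \<phi> v"
        using g v by (intro subgroup_int_pow_closed[OF vertex_stab_subgroup]) (auto simp: stabilizer_def)
      then show ?thesis by (simp add: stabilizer_def)
    qed
    have "(\<lambda>h. \<phi> h v) ` carrier G \<subseteq> (\<lambda>(b, n). \<phi> b (\<phi> n v)) ` (B \<times> N)"
    proof
      fix w assume "w \<in> (\<lambda>h. \<phi> h v) ` carrier G"
      then obtain h where h: "h \<in> carrier G" "w = \<phi> h v" by blast
      then obtain b n and j :: int where bn: "b \<in> B" "n \<in> N" "h = b \<otimes> n \<otimes> g [^] j" using fi by blast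
      have c: "b \<in> carrier G" "n \<in> carrier G" using bn N B by auto
      have "w = \<phi> b (\<phi> n v)"
        using composition_rule[OF v(1), of "b \<otimes> n" "g [^] j"] composition_rule[OF v(1) c] c pc gj
        unfolding h bn by simp
      then show "w \<in> (\<lambda>(b, n). \<phi> b (\<phi> n v)) ` (B \<times> N)" using bn by auto
    qed
    then have "finite ((\<lambda>h. \<phi> h v) ` carrier G)" by (rule finite_subset) (simp add: N B)
    then show ?thesis
      using finite_orbit_imp_fixed_vertex[OF v(1)] by (auto simp: non_elementary_def)
  next
    case False
    then obtain \<gamma> :: "int \<Rightarrow> 'v" and \<tau> :: int where \<tau>: "\<tau> > 0"
      and e: "\<And>i. {\<gamma> i, \<gamma> (i + 1)} \<in> E" and red: "\<And>i. \<gamma> (i + 2) \<noteq> \<gamma> i"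
      and tr: "\<And>i. \<phi> g (\<gamma> i) = \<gamma> (i + \<tau>)"
      using exists_axis[OF g] by metis
    have V: "\<gamma> i \<in> V" for i using e T.edge_in_V by blast
    have trn: "\<phi> (g [^] j) (\<gamma> i) = \<gamma> (i + \<tau> * j)" for i and j :: int
    proof (induction j arbitrary: i rule: int_induct[where k = 0])
      case base
      then show ?case using act_one V by simp
    next
      case (step1 j)
      have "g [^] (j + 1) = g [^] j \<otimes> g" using int_pow_mult[OF g, of j 1] g by simp
      then show ?case using composition_rule[OF V pc g] step1 tr by (simp add: algebra_simps)
    next
      case (step2 j)
      have "g [^] (j - 1) = g [^] j \<otimes> inv g"
        using int_pow_mult[OF g, of j "- 1"] g by (simp add: int_pow_neg)
      moreover have "\<phi> (inv g) (\<gamma> i) = \<gamma> (i - \<tau>)" using act_inv[OF g V, of "i - \<tau>"] tr by simp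
      ultimately show ?case using composition_rule[OF V pc, of "inv g"] g step2 by (simp add: algebra_simps)
    qed
    have sub: "\<phi> h (\<gamma> c) \<in> range \<gamma>" if h: "h \<in> carrier G" for h c
    proof -
      obtain \<epsilon> :: int where \<epsilon>: "\<And>j::int. \<exists>n\<in>N. h \<otimes> g [^] j = g [^] (\<epsilon> * j) \<otimes> n \<otimes> h"
        using tw[OF h] by blast
      \<comment> \<open>The points \<open>\<phi> h (\<gamma> (c + \<tau> * j))\<close> are
        translates, by powers of \<open>g\<close>, of the finitely many
        \<open>\<phi> n (\<phi> h (\<gamma> c))\<close>, so one maximum serves all
        \<open>j\<close>.\<close>
      define D where "D = Max ((\<lambda>n. T.td (\<gamma> c) (\<phi> n (\<phi> h (\<gamma> c)))) ` N)"
      have hV: "\<phi> h (\<gamma> c) \<in> V" using act_closed h V by blast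
      have "\<exists>a. T.td (\<gamma> a) (\<phi> h (\<gamma> (c + \<tau> * j))) \<le> D" for j
      proof -
        obtain n where n: "n \<in> N" "h \<otimes> g [^] j = g [^] (\<epsilon> * j) \<otimes> n \<otimes> h" using \<epsilon> by blast
        have nG: "n \<in> carrier G" using n N by blast
        have nV: "\<phi> n (\<phi> h (\<gamma> c)) \<in> V" using act_closed nG hV by blast
        have "\<phi> h (\<gamma> (c + \<tau> * j)) = \<phi> (h \<otimes> g [^] j) (\<gamma> c)"
          using composition_rule[OF V h pc] trn by simp
        also have "\<dots> = \<phi> (g [^] (\<epsilon> * j)) (\<phi> n (\<phi> h (\<gamma> c)))"
          unfolding n(2) using composition_rule[OF V, of "g [^] (\<epsilon> * j) \<otimes> n" h]
            composition_rule[OF hV pc nG] pc nG h by simp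
        finally have "T.td (\<gamma> (c + \<tau> * (\<epsilon> * j))) (\<phi> h (\<gamma> (c + \<tau> * j))) = T.td (\<gamma> c) (\<phi> n (\<phi> h (\<gamma> c)))"
          using td_act[OF pc V nV] trn by metis
        also have "\<dots> \<le> D" unfolding D_def using n N by (intro Max_ge) auto
        finally show ?thesis by blast
      qed
      moreover have "{\<phi> h (\<gamma> i), \<phi> h (\<gamma> (i + 1))} \<in> E" for i using act_edge[OF h e] .
      moreover have "\<phi> h (\<gamma> (i + 2)) \<noteq> \<phi> h (\<gamma> i)" for i using act_inject[OF h V V] red by simp
      ultimately show ?thesis
        using T.parallel_walks[OF e red, of "\<lambda>i. \<phi> h (\<gamma> i)" \<tau> c D] \<tau> by blast
    qed
    have "\<phi> h ` range \<gamma> = range \<gamma>" if h: "h \<in> carrier G" for h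
    proof
      show "\<phi> h ` range \<gamma> \<subseteq> range \<gamma>" using sub[OF h] by blast
      show "range \<gamma> \<subseteq> \<phi> h ` range \<gamma>"
      proof
        fix w assume "w \<in> range \<gamma>"
        then obtain c where c: "w = \<gamma> c" by blast
        have "\<phi> (inv h) (\<gamma> c) \<in> range \<gamma>" using sub h by simp
        moreover have "w = \<phi> h (\<phi> (inv h) (\<gamma> c))" using act_inv'[OF h V] c by simp
        ultimately show "w \<in> \<phi> h ` range \<gamma>" by blast
      qed
    qed
    then show ?thesis using T.reduced_walk_geodesic[OF e red] unfolding non_elementary_def by blast
  qed
qed

lemma int_isometry:
  fixes f :: "int \<Rightarrow> int"
  assumes "\<And>i j. \<bar>f i - f j\<bar> = \<bar>i - j\<bar>"
  shows "\<exists>\<epsilon> b. (\<epsilon> = 1 \<or> \<epsilon> = -1) \<and> (\<forall>i. f i = \<epsilon> * i + b)"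
proof (rule exI[of _ "f 1 - f 0"], rule exI[of _ "f 0"], intro conjI allI)
  show "f 1 - f 0 = 1 \<or> f 1 - f 0 = - 1" using assms[of 1 0] by arith
  show "f i = (f 1 - f 0) * i + f 0" for i
  proof (cases "f 1 - f 0 = 1")
    case True
    then show ?thesis using assms[of i 0] assms[of i 1] by (simp add: abs_if split: if_splits)
  next
    case False
    then have "f 1 - f 0 = - 1" using assms[of 1 0] by arith
    then show ?thesis using assms[of i 0] assms[of i 1] by (simp add: abs_if split: if_splits)
  qed
qed

text \<open>Elements act on the line by \<open>i \<mapsto> \<epsilon> * i + b\<close> with a sign
  \<epsilon>. A proper translation exists, since otherwise at most one reflection remains, and this
  fixes a vertex or inverts an edge. The elements trivial on the line form a finite set by
  acylindricity; modulo these and powers of the translation, an element is determined by its sign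
  and \<open>b mod t\<close>.\<close>

lemma (in tree_action) invariant_line_imp_virtually_cyclic:
  assumes acyl: "acylindrical G V E \<phi>" and nofix: "\<not> (\<exists>v\<in>V. \<forall>g\<in>carrier G. \<phi> g v = v)"
    and \<gamma>: "bi_infinite_geodesic V E \<gamma>" and inv\<gamma>: "\<And>g. g \<in> carrier G \<Longrightarrow> \<phi> g ` range \<gamma> = range \<gamma>"
  shows "\<exists>g N B. virtually_cyclic_by G g N B"
proof -
  have V: "\<gamma> i \<in> V" for i using \<gamma> by (auto simp: bi_infinite_geodesic_def)
  have d: "int (T.td (\<gamma> i) (\<gamma> j)) = \<bar>i - j\<bar>" for i j
    using \<gamma> V T.graph_dist_eq by (simp add: bi_infinite_geodesic_def)
  have inj: "\<gamma> i = \<gamma> j \<longleftrightarrow> i = j" for i j using d[of i j] by (cases "\<gamma> i = \<gamma> j") auto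
  define ty where "ty h \<epsilon> b \<longleftrightarrow> (\<forall>i. \<phi> h (\<gamma> i) = \<gamma> (\<epsilon> * i + b))" for h and \<epsilon> b :: int
  have ty_ex: "\<exists>\<epsilon> b. (\<epsilon> = 1 \<or> \<epsilon> = -1) \<and> ty h \<epsilon> b" if h: "h \<in> carrier G" for h
  proof -
    have "\<forall>i. \<exists>j. \<phi> h (\<gamma> i) = \<gamma> j" using inv\<gamma>[OF h] by blast
    then obtain f where f: "\<And>i. \<phi> h (\<gamma> i) = \<gamma> (f i)" by metis
    have "\<bar>f i - f j\<bar> = \<bar>i - j\<bar>" for i j
      using td_act[OF h V V, of i j] d[of i j] d[of "f i" "f j"] f by simp
    from int_isometry[OF this]
    obtain \<epsilon> b where "\<epsilon> = 1 \<or> \<epsilon> = -1" "\<forall>i. f i = \<epsilon> * i + b" by blast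
    then show ?thesis using f unfolding ty_def by auto
  qed
  have ty_mult: "ty (h \<otimes> k) (\<epsilon> * \<epsilon>') (\<epsilon> * b' + b)"
    if "h \<in> carrier G" "k \<in> carrier G" "ty h \<epsilon> b" "ty k \<epsilon>' b'" for h k \<epsilon> b \<epsilon>' b'
    using that composition_rule[OF V] by (simp add: ty_def algebra_simps)
  have ty_inv: "ty (inv h) \<epsilon> (- (\<epsilon> * b))"
    if h: "h \<in> carrier G" "ty h \<epsilon> b" "\<epsilon> = 1 \<or> \<epsilon> = -1" for h \<epsilon> b
    unfolding ty_def
  proof
    fix i
    have "\<phi> h (\<gamma> (\<epsilon> * i + - (\<epsilon> * b))) = \<gamma> i" using h(2,3) by (auto simp: ty_def)
    then show "\<phi> (inv h) (\<gamma> i) = \<gamma> (\<epsilon> * i + - (\<epsilon> * b))" using act_inv[OF h(1) V] by metis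
  qed
  obtain g t where g: "g \<in> carrier G" "ty g 1 t" and t: "t > 0"
  proof -
    have "\<exists>g t. g \<in> carrier G \<and> ty g 1 t \<and> t \<noteq> 0"
    proof (rule ccontr)
      assume no: "\<not> (\<exists>g t. g \<in> carrier G \<and> ty g 1 t \<and> t \<noteq> 0)"
      show False
      proof (cases "\<exists>r b. r \<in> carrier G \<and> ty r (-1) b")
        case False
        then have "ty h 1 0" if "h \<in> carrier G" for h using ty_ex[OF that] no that by metis
        then show False using nofix V[of 0] by (auto simp: ty_def)
      next
        case True
        then obtain r b where r: "r \<in> carrier G" "ty r (-1) b" by blast
        \<comment> \<open>Two reflections compose to a translation by \<open>b - b'\<close>, which
          has to vanish.\<close>
        have refl: "b' = b" if "h \<in> carrier G" "ty h (-1) b'" for h b'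
        proof -
          have "ty (r \<otimes> h) 1 (b - b')" using ty_mult[OF r(1) that(1) r(2) that(2)] by simp
          then have "b - b' = 0" using no r(1) that(1) m_closed by blast
          then show ?thesis by simp
        qed
        show False
        \<comment> \<open>The centre \<open>b / 2\<close> of the reflection is a vertex if
          \<open>b\<close> is even and the midpoint of an edge if \<open>b\<close> is odd.\<close>
        proof (cases "even b")
          case True
          then obtain c where c: "b = 2 * c" by blast
          have "\<phi> h (\<gamma> c) = \<gamma> c" if h: "h \<in> carrier G" for h
          proof -
            obtain \<epsilon> b' where t: "\<epsilon> = 1 \<or> \<epsilon> = -1" "ty h \<epsilon> b'" using ty_ex[OF h] by blast
            then consider "ty h 1 0" | "ty h (-1) b" using no h refl by metis
            then show ?thesis unfolding ty_def using c by cases auto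
          qed
          then show False using nofix V by blast
        next
          case False
          then obtain c where c: "b = 2 * c + 1" by (rule oddE)
          have "{\<gamma> c, \<gamma> (c + 1)} \<in> E" using T.td_eq_1[OF V V, of c "c + 1"] d[of c "c + 1"] by simp
          moreover have "\<phi> r (\<gamma> c) = \<gamma> (c + 1)" "\<phi> r (\<gamma> (c + 1)) = \<gamma> c"
            using r(2) c by (auto simp: ty_def)
          ultimately show False using no_inversion[OF r(1)] by blast
        qed
      qed
    qed
    then obtain g t where g: "g \<in> carrier G" "ty g 1 t" "t \<noteq> 0" by blast
    show ?thesis
    proof (cases "t > 0")
      case False
      then show ?thesis using that[of "inv g" "- t"] ty_inv[of g 1 t] g by simp
    qed (use that g in blast)
  qed
  have pc: "g [^] j \<in> carrier G" for j :: int using g by simp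
  have ty_pow: "ty (g [^] j) 1 (t * j)" for j :: int
  proof (induction j rule: int_induct[where k = 0])
    case base
    then show ?case using act_one[OF V] by (simp add: ty_def)
  next
    case (step1 j)
    have "g [^] (j + 1) = g [^] j \<otimes> g" using int_pow_mult[OF g(1), of j 1] g by simp
    then show ?case using ty_mult[OF pc g(1) step1(2) g(2)] by (simp add: algebra_simps)
  next
    case (step2 j)
    have "g [^] (j - 1) = g [^] j \<otimes> inv g"
      using int_pow_mult[OF g(1), of j "- 1"] g by (simp add: int_pow_neg)
    then show ?case
      using ty_mult[OF pc inv_closed[OF g(1)] step2(2) ty_inv[OF g]] by (simp add: algebra_simps)
  qed
  define N where "N = {n \<in> carrier G. ty n 1 0}"
  have finN: "finite N"
  proof -
    obtain k C where kC: "kC_acylindrical G V E \<phi> k C" using acyl by (auto simp: acylindrical_def)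
    have "T.td (\<gamma> 0) (\<gamma> (int k)) = k" using d[of 0 "int k"] by simp
    then obtain p where p: "edge_path V E p" "hd p = \<gamma> 0" "last p = \<gamma> (int k)" "distinct p" "length p = Suc k"
      using T.distinct_path[OF V V] by metis
    let ?K = "{g \<in> carrier G. \<forall>v\<in>set p. \<phi> g v = v}"
    have "finite ?K" using kC p unfolding kC_acylindrical_def by simp
    moreover have "N \<subseteq> ?K"
    proof
      fix n assume n: "n \<in> N"
      then have "\<phi> n v = v" if "v \<in> set p" for v
        by (intro fixes_path[OF _ p(1,4) _ _ that]) (auto simp: N_def ty_def p)
      then show "n \<in> ?K" using n by (simp add: N_def)
    qed
    ultimately show ?thesis using finite_subset by blast
  qed
  define cls where "cls \<epsilon> r = {h \<in> carrier G. \<exists>b. ty h \<epsilon> b \<and> b mod t = r}" for \<epsilon> r :: int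
  \<comment> \<open>One representative for each sign and residue that occurs, so at most
    \<open>2 * t\<close> of them.\<close>
  define B where "B = (\<lambda>(\<epsilon>, r). SOME h. h \<in> cls \<epsilon> r) ` {(\<epsilon>, r). \<epsilon> \<in> {1, -1} \<and> r \<in> {0..<t} \<and> cls \<epsilon> r \<noteq> {}}"
  have some: "(SOME h. h \<in> cls \<epsilon> r) \<in> cls \<epsilon> r" if "cls \<epsilon> r \<noteq> {}" for \<epsilon> r
    using that by (metis ex_in_conv someI_ex)
  have "virtually_cyclic_by G g N B"
    unfolding virtually_cyclic_by_def
  proof (intro conjI ballI)
    show "g \<in> carrier G" "finite N" by (fact g finN)+
    show "N \<subseteq> carrier G" by (auto simp: N_def)
    show "finite B" unfolding B_def
      by (rule finite_imageI, rule finite_subset[of _ "{1, -1} \<times> {0..<t}"]) auto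
    show "B \<subseteq> carrier G"
    proof
      fix a assume "a \<in> B"
      then obtain \<epsilon> r where "a = (SOME h. h \<in> cls \<epsilon> r)" "cls \<epsilon> r \<noteq> {}" by (auto simp: B_def)
      then have "a \<in> cls \<epsilon> r" using some by simp
      then show "a \<in> carrier G" by (simp add: cls_def)
    qed
    fix h assume h: "h \<in> carrier G"
    obtain \<epsilon> b where \<epsilon>: "\<epsilon> = 1 \<or> \<epsilon> = -1" and tyh: "ty h \<epsilon> b" using ty_ex[OF h] by blast
    have \<epsilon>\<epsilon>: "\<epsilon> * \<epsilon> = 1" using \<epsilon> by auto
    show "\<exists>\<epsilon>::int. \<forall>j::int. \<exists>n\<in>N. h \<otimes> g [^] j = g [^] (\<epsilon> * j) \<otimes> n \<otimes> h"
    proof (intro exI allI)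
      fix j :: int
      let ?n = "inv (g [^] (\<epsilon> * j)) \<otimes> (h \<otimes> g [^] j \<otimes> inv h)"
      have 1: "ty (h \<otimes> g [^] j \<otimes> inv h) (\<epsilon> * 1 * \<epsilon>) (\<epsilon> * 1 * (- (\<epsilon> * b)) + (\<epsilon> * (t * j) + b))"
        by (intro ty_mult m_closed h pc inv_closed tyh ty_pow ty_inv \<epsilon>)
      have 2: "\<epsilon> * 1 * (- (\<epsilon> * b)) + (\<epsilon> * (t * j) + b) = t * (\<epsilon> * j)"
        using \<epsilon>\<epsilon> by (simp add: algebra_simps)
      have "ty (h \<otimes> g [^] j \<otimes> inv h) 1 (t * (\<epsilon> * j))" using 1[unfolded 2] by (simp add: \<epsilon>\<epsilon>)
      moreover have "ty (inv (g [^] (\<epsilon> * j))) 1 (- (1 * (t * (\<epsilon> * j))))"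
        by (rule ty_inv[OF pc ty_pow]) simp
      ultimately have "ty ?n (1 * 1) (1 * (t * (\<epsilon> * j)) + - (1 * (t * (\<epsilon> * j))))"
        using h pc by (intro ty_mult) auto
      then have "?n \<in> N" using h pc by (simp add: N_def)
      moreover have "h \<otimes> g [^] j = g [^] (\<epsilon> * j) \<otimes> ?n \<otimes> h"
        using h pc by (simp add: m_assoc inv_cancel)
      ultimately show "\<exists>n\<in>N. h \<otimes> g [^] j = g [^] (\<epsilon> * j) \<otimes> n \<otimes> h" by blast
    qed
    show "\<exists>a\<in>B. \<exists>n\<in>N. \<exists>j::int. h = a \<otimes> n \<otimes> g [^] j"
    proof -
      define a where "a = (SOME a. a \<in> cls \<epsilon> (b mod t))"
      have hc: "h \<in> cls \<epsilon> (b mod t)" using h tyh by (auto simp: cls_def)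
      then have ac: "a \<in> cls \<epsilon> (b mod t)" unfolding a_def using some by blast
      have "(\<epsilon>, b mod t) \<in> {(\<epsilon>, r). \<epsilon> \<in> {1, -1} \<and> r \<in> {0..<t} \<and> cls \<epsilon> r \<noteq> {}}"
        using hc \<epsilon> t by auto
      then have aB: "a \<in> B" unfolding B_def a_def by (intro image_eqI[of _ _ "(\<epsilon>, b mod t)"]) auto
      obtain c where a: "a \<in> carrier G" "ty a \<epsilon> c" "c mod t = b mod t" using ac by (auto simp: cls_def)
      obtain m where m: "b - c = t * m" using a(3) by (metis mod_eq_dvd_iff dvd_def)
      \<comment> \<open>\<open>a\<close> and \<open>h\<close> have the same sign \<epsilon>, and a
        translation on the right of \<open>a\<close> counts with that sign; so the difference
        \<open>b - c = t * m\<close> needs the exponent \<open>\<epsilon> * m\<close>.\<close>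
      let ?j = "\<epsilon> * m"
      let ?n = "inv a \<otimes> (h \<otimes> inv (g [^] ?j))"
      have "ty (inv (g [^] ?j)) 1 (- (1 * (t * ?j)))" by (rule ty_inv[OF pc ty_pow]) simp
      note ty_mult[OF h inv_closed[OF pc] tyh this]
      note n = ty_mult[OF inv_closed[OF a(1)] m_closed[OF h inv_closed[OF pc]] ty_inv[OF a(1,2) \<epsilon>] this]
      have z: "\<epsilon> * (\<epsilon> * (- (1 * (t * ?j))) + b) + - (\<epsilon> * c) = 0"
      proof -
        have "b = c + t * m" using m by simp
        then show ?thesis using \<epsilon> by auto
      qed
      have "?n \<in> N" using n[unfolded z] \<epsilon>\<epsilon> h a pc by (simp add: N_def)
      moreover have "h = a \<otimes> ?n \<otimes> g [^] ?j" using h a pc by (simp add: m_assoc inv_cancel)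
      ultimately show ?thesis using aB by blast
    qed
  qed
  then show ?thesis by blast
qed

section \<open>Collapsing all edges outside one orbit\<close>

locale collapse = tree_action G V E \<phi>
  for G :: "('g, 'b) monoid_scheme" (structure) and V :: "'v set" and E :: "'v set set"
    and \<phi> :: "'g \<Rightarrow> 'v \<Rightarrow> 'v" +
  fixes e0 :: "'v set"
  assumes e0: "e0 \<in> E"
begin

definition Orb :: "'v set set" where
  "Orb = {\<phi> g ` e0 | g. g \<in> carrier G}"

text \<open>The component of \<open>x\<close> after deletion of the orbit edges. These components
  are the vertices of the collapsed tree.\<close>

definition cls :: "'v \<Rightarrow> 'v set" where
  "cls x = {y \<in> V. T.walls x y \<inter> Orb = {}}"

definition V1 :: "'v set set" where
  "V1 = cls ` V"

definition E1 :: "'v set set set" where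
  "E1 = {{cls a, cls b} | a b. {a, b} \<in> Orb}"

definition act1 :: "'g \<Rightarrow> 'v set \<Rightarrow> 'v set" where
  "act1 g = restrict (image (\<phi> g)) V1"

lemma Orb_E: "e \<in> Orb \<Longrightarrow> e \<in> E"
  using e0 edge_closed by (auto simp: Orb_def)

lemma Orb_V: "{a, b} \<in> Orb \<Longrightarrow> a \<in> V \<and> b \<in> V"
  using Orb_E T.edge_in_V by blast

lemma Orb_act:
  assumes "g \<in> carrier G" "{a, b} \<in> Orb" shows "{\<phi> g a, \<phi> g b} \<in> Orb"
proof -
  obtain h where h: "h \<in> carrier G" "{a, b} = \<phi> h ` e0" using assms by (auto simp: Orb_def)
  have "\<phi> (g \<otimes> h) ` e0 = \<phi> g ` {a, b}" using act_image_mult[OF assms(1) h(1) e0] h(2) by simp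
  then have "{\<phi> g a, \<phi> g b} = \<phi> (g \<otimes> h) ` e0" by simp
  then show ?thesis using assms(1) h(1) unfolding Orb_def by blast
qed

lemma Orb_act_iff:
  assumes "g \<in> carrier G" "a \<in> V" "b \<in> V"
  shows "{\<phi> g a, \<phi> g b} \<in> Orb \<longleftrightarrow> {a, b} \<in> Orb"
  using Orb_act[OF assms(1), of a b] Orb_act[OF inv_closed[OF assms(1)], of "\<phi> g a" "\<phi> g b"]
    act_inv[OF assms(1)] assms(2,3) by auto

lemma cls_self: "x \<in> V \<Longrightarrow> x \<in> cls x"
  by (simp add: cls_def)

lemma cls_eq_iff:
  assumes "x \<in> V" "y \<in> V"
  shows "cls x = cls y \<longleftrightarrow> T.walls x y \<inter> Orb = {}"
proof
  assume "cls x = cls y"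
  then have "y \<in> cls x" using cls_self assms by blast
  then show "T.walls x y \<inter> Orb = {}" by (simp add: cls_def)
next
  assume *: "T.walls x y \<inter> Orb = {}"
  have "T.walls x z \<inter> Orb = {} \<longleftrightarrow> T.walls y z \<inter> Orb = {}" for z
    using * by (auto simp: T.walls_def)
  then show "cls x = cls y" by (simp add: cls_def)
qed

lemma cls_cut: "cls x = cls y \<Longrightarrow> x \<in> V \<Longrightarrow> y \<in> V \<Longrightarrow> e \<in> Orb \<Longrightarrow> T.cut e x = T.cut e y"
  using cls_eq_iff[of x y] Orb_E[of e] unfolding T.walls_def by blast

lemma edge_cls_neq: "{a, b} \<in> Orb \<Longrightarrow> cls a \<noteq> cls b"
  using cls_eq_iff[of a b] Orb_V Orb_E T.walls_edge[of a b] by auto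

text \<open>The colouring across \<open>{a, b}\<close> is constant on classes, so it also separates
  \<open>c\<close> from \<open>d\<close>, and only the edge \<open>{c, d}\<close> does that. Cuts,
  absence of inversions and edge stabilisers of the collapsed tree all rest on this
  injectivity.\<close>

lemma edge_cls_unique:
  assumes "{a, b} \<in> Orb" "{c, d} \<in> Orb" "cls a = cls c" "cls b = cls d"
  shows "a = c" "b = d"
proof -
  have V: "a \<in> V" "b \<in> V" "c \<in> V" "d \<in> V" using assms Orb_V by auto
  have "{a, b} \<in> T.walls a b" unfolding T.walls_edge[OF Orb_E[OF assms(1)]] by simp
  then have "T.cut {a, b} c \<noteq> T.cut {a, b} d"
    using cls_cut[OF assms(3) V(1,3) assms(1)] cls_cut[OF assms(4) V(2,4) assms(1)]
    by (simp add: T.walls_def)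
  then have "{a, b} \<in> T.walls c d" using Orb_E assms(1) by (simp add: T.walls_def)
  then have "{a, b} = {c, d}" unfolding T.walls_edge[OF Orb_E[OF assms(2)]] by simp
  moreover have "a \<noteq> d" using edge_cls_neq[OF assms(1)] assms(4) by auto
  ultimately show "a = c" "b = d" by (auto simp: doubleton_eq_iff)
qed

lemma act_cls:
  assumes g: "g \<in> carrier G" and x: "x \<in> V"
  shows "\<phi> g ` cls x = cls (\<phi> g x)"
proof -
  have *: "\<phi> g y \<in> cls (\<phi> g x)" if g: "g \<in> carrier G" and x: "x \<in> V" and y: "y \<in> cls x" for g x y
  proof -
    have yV: "y \<in> V" and d: "T.walls x y \<inter> Orb = {}" using y by (auto simp: cls_def)
    have "T.walls (\<phi> g x) (\<phi> g y) \<inter> Orb = {}"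
    proof (rule ccontr)
      assume "T.walls (\<phi> g x) (\<phi> g y) \<inter> Orb \<noteq> {}"
      then obtain e where e: "e \<in> T.walls x y" "\<phi> g ` e \<in> Orb" unfolding walls_act[OF g x yV] by blast
      then obtain a b where ab: "e = {a, b}" "a \<in> V" "b \<in> V"
        using T.edge_obtain T.walls_subset by (metis subsetD)
      then have "e \<in> Orb" using Orb_act_iff[OF g ab(2,3)] e(2) by simp
      then show False using d e(1) by blast
    qed
    then show ?thesis using act_closed[OF g yV] by (simp add: cls_def)
  qed
  show ?thesis
  proof
    show "\<phi> g ` cls x \<subseteq> cls (\<phi> g x)" using * g x by blast
    show "cls (\<phi> g x) \<subseteq> \<phi> g ` cls x"
    proof
      fix y assume y: "y \<in> cls (\<phi> g x)"
      then have "\<phi> (inv g) y \<in> cls x"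
        using *[OF inv_closed[OF g] act_closed[OF g x] y] act_inv[OF g x] by simp
      moreover have "y = \<phi> g (\<phi> (inv g) y)" using y act_inv'[OF g] by (simp add: cls_def)
      ultimately show "y \<in> \<phi> g ` cls x" by blast
    qed
  qed
qed

lemma act1_cls: "g \<in> carrier G \<Longrightarrow> x \<in> V \<Longrightarrow> act1 g (cls x) = cls (\<phi> g x)"
  using act_cls by (simp add: act1_def V1_def)

text \<open>The colouring of \<open>T\<close> across an orbit edge descends to classes; connecting
  paths descend because an edge outside the orbit becomes a point.\<close>

lemma is_tree_collapse: "is_tree V1 E1"
proof (rule cuts_imp_tree)
  show "V1 \<noteq> {}" using tree by (auto simp: V1_def is_tree_def)
  have "e \<subseteq> V1 \<and> card e = 2" if "e \<in> E1" for e
  proof -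
    obtain a b where "e = {cls a, cls b}" "{a, b} \<in> Orb" using \<open>e \<in> E1\<close> by (auto simp: E1_def)
    then show ?thesis using edge_cls_neq Orb_V by (auto simp: V1_def)
  qed
  then show simp: "simplicial_graph V1 E1" by (simp add: simplicial_graph_def)
  have "(cls x, cls y) \<in> (adjacency E1)\<^sup>*" if "x \<in> V" "y \<in> V" for x y
    using T.rtrancl_adjacency[OF that]
  proof induction
    case (step y z)
    then have yz: "{y, z} \<in> E" by simp
    show ?case
    proof (cases "{y, z} \<in> Orb")
      case True
      then have "{cls y, cls z} \<in> E1" by (auto simp: E1_def)
      then show ?thesis using step.IH by (auto intro: rtrancl_into_rtrancl)
    next
      case False
      then have "cls y = cls z"
        using cls_eq_iff[of y z] T.edge_in_V[OF yz] T.walls_edge[OF yz] by auto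
      then show ?thesis using step.IH by simp
    qed
  qed simp
  then show "graph_connected V1 E1"
    unfolding graph_connected_iff[OF simp] by (auto simp: V1_def)
  fix e assume "e \<in> E1"
  then obtain a b where ab: "e = {cls a, cls b}" "{a, b} \<in> Orb" by (auto simp: E1_def)
  define c where "c C = T.cut {a, b} (SOME x. x \<in> C \<and> x \<in> V)" for C
  have c: "c (cls x) = T.cut {a, b} x" if x: "x \<in> V" for x
  proof -
    have "\<exists>y. y \<in> cls x \<and> y \<in> V" using cls_self x by blast
    from someI_ex[OF this] have y: "(SOME y. y \<in> cls x \<and> y \<in> V) \<in> cls x" "(SOME y. y \<in> cls x \<and> y \<in> V) \<in> V"
      by auto
    have "T.walls x z \<inter> Orb = {}" if "z \<in> cls x" for z using that by (simp add: cls_def)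
    then have "cls x = cls (SOME y. y \<in> cls x \<and> y \<in> V)"
      using cls_eq_iff[OF x y(2)] y(1) by blast
    then show ?thesis unfolding c_def using cls_cut[OF _ x y(2) ab(2)] by simp
  qed
  have "is_cut E1 e c"
    unfolding is_cut_def
  proof (intro allI impI)
    fix x y assume "{x, y} \<in> E1"
    then obtain p q where pq: "{x, y} = {cls p, cls q}" "{p, q} \<in> Orb" by (auto simp: E1_def)
    have "c x \<noteq> c y \<longleftrightarrow> c (cls p) \<noteq> c (cls q)" using pq(1) by (auto simp: doubleton_eq_iff)
    also have "\<dots> \<longleftrightarrow> {p, q} = {a, b}"
      using c Orb_V[OF pq(2)] T.is_cut_cut[OF Orb_E[OF ab(2)]] Orb_E[OF pq(2)] by (simp add: is_cut_def)
    also have "\<dots> \<longleftrightarrow> {cls p, cls q} = {cls a, cls b}"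
    proof
      assume "{cls p, cls q} = {cls a, cls b}"
      then consider "cls p = cls a" "cls q = cls b" | "cls p = cls b" "cls q = cls a"
        by (auto simp: doubleton_eq_iff)
      then show "{p, q} = {a, b}"
      proof cases
        case 1
        then show ?thesis using edge_cls_unique[OF pq(2) ab(2)] by simp
      next
        case 2
        have "{b, a} \<in> Orb" using ab(2) by (simp add: insert_commute)
        then show ?thesis using edge_cls_unique[OF pq(2), of b a] 2 by (simp add: insert_commute)
      qed
    qed (auto simp: doubleton_eq_iff)
    finally show "c x \<noteq> c y \<longleftrightarrow> {x, y} = e" using pq(1) ab(1) by simp
  qed
  then show "\<exists>\<sigma>. is_cut E1 e \<sigma>" by blast
qed

lemma tree_action_collapse: "tree_action G V1 E1 act1"
proof -
  have "group_action G V1 act1"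
  proof (rule group_actionI)
    show "group G" by (rule is_group)
    show "act1 g \<in> extensional V1" for g by (simp add: act1_def)
  qed (auto simp: V1_def act1_cls act_closed act_one composition_rule)
  then interpret A: group_action G V1 act1 .
  show ?thesis
  proof
    show "is_tree V1 E1" by (rule is_tree_collapse)
    fix g assume g: "g \<in> carrier G"
    show "act1 g ` e \<in> E1" if "e \<in> E1" for e
    proof -
      obtain a b where ab: "e = {cls a, cls b}" "{a, b} \<in> Orb" using \<open>e \<in> E1\<close> by (auto simp: E1_def)
      have "act1 g ` e = {cls (\<phi> g a), cls (\<phi> g b)}" using ab act1_cls[OF g] Orb_V[OF ab(2)] by simp
      then show ?thesis using Orb_act[OF g ab(2)] by (auto simp: E1_def)
    qed
    show "\<not> (act1 g u = v \<and> act1 g v = u)" if "{u, v} \<in> E1" for u v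
    proof -
      obtain a b where ab: "{u, v} = {cls a, cls b}" "{a, b} \<in> Orb" using \<open>{u, v} \<in> E1\<close> by (auto simp: E1_def)
      have V: "a \<in> V" "b \<in> V" using Orb_V[OF ab(2)] by auto
      have ba: "{b, a} \<in> Orb" using ab(2) by (simp add: insert_commute)
      have "\<not> (act1 g (cls a) = cls b \<and> act1 g (cls b) = cls a)"
      proof
        assume "act1 g (cls a) = cls b \<and> act1 g (cls b) = cls a"
        then have "\<phi> g a = b" "\<phi> g b = a"
          using edge_cls_unique[OF Orb_act[OF g ab(2)] ba] act1_cls[OF g] V by auto
        then show False using no_inversion[OF g Orb_E[OF ab(2)]] by blast
      qed
      then show ?thesis using ab(1) by (auto simp: doubleton_eq_iff)
    qed
  qed
qed

lemma edge_stab_collapse: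
  assumes ab: "{a, b} \<in> Orb"
  shows "edge_stab G act1 {cls a, cls b} = edge_stab G \<phi> {a, b}"
proof -
  interpret A: tree_action G V1 E1 act1 by (rule tree_action_collapse)
  have V: "a \<in> V" "b \<in> V" using Orb_V[OF ab] by auto
  have "{cls a, cls b} \<in> E1" using ab by (auto simp: E1_def)
  then have "edge_stab G act1 {cls a, cls b} = {g \<in> carrier G. act1 g (cls a) = cls a \<and> act1 g (cls b) = cls b}"
    by (rule A.edge_stab_eq)
  also have "\<dots> = {g \<in> carrier G. \<phi> g a = a \<and> \<phi> g b = b}"
  proof -
    have "act1 g (cls a) = cls a \<and> act1 g (cls b) = cls b \<longleftrightarrow> \<phi> g a = a \<and> \<phi> g b = b"
      if g: "g \<in> carrier G" for g
      using edge_cls_unique[OF Orb_act[OF g ab] ab] act1_cls[OF g] V by auto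
    then show ?thesis by blast
  qed
  also have "\<dots> = edge_stab G \<phi> {a, b}" using edge_stab_eq[OF Orb_E[OF ab]] by simp
  finally show ?thesis .
qed

text \<open>A fixed class spans an invariant subtree of \<open>T\<close>, hence is all of
  \<open>V\<close> by minimality, although the ends of \<open>e0\<close> lie in different classes.
  This replaces non-elementarity, which is not claimed for the collapsed action.\<close>

lemma collapse_no_fixed_vertex:
  assumes min: "minimal_action G V E \<phi>"
  shows "\<not> (\<exists>C\<in>V1. \<forall>g\<in>carrier G. act1 g C = C)"
proof
  assume "\<exists>C\<in>V1. \<forall>g\<in>carrier G. act1 g C = C"
  then obtain x where x: "x \<in> V" and fixed: "\<And>g. g \<in> carrier G \<Longrightarrow> act1 g (cls x) = cls x"
    by (auto simp: V1_def)
  let ?C = "cls x" and ?D = "{e \<in> E. e \<subseteq> cls x}"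
  have inv: "\<phi> g ` ?C = ?C" if "g \<in> carrier G" for g
    using fixed[OF that] act1_cls[OF that x] act_cls[OF that x] by simp
  have CV: "?C \<subseteq> V" by (auto simp: cls_def)
  have "is_tree ?C ?D"
  proof (rule cuts_imp_tree)
    show "?C \<noteq> {}" using cls_self[OF x] by blast
    show "simplicial_graph ?C ?D" using T.simplicial by (auto simp: simplicial_graph_def)
    show "graph_connected ?C ?D"
      unfolding graph_connected_def
    proof (intro ballI)
      fix y z assume y: "y \<in> ?C" and z: "z \<in> ?C"
      then have yz: "y \<in> V" "z \<in> V" using CV by auto
      have "cls x = cls y" "cls x = cls z" using cls_eq_iff[OF x] yz y z by (auto simp: cls_def)
      then have d: "T.walls y z \<inter> Orb = {}" using cls_eq_iff[OF yz] by simp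
      obtain p where p: "edge_path V E p" "hd p = y" "last p = z" "distinct p" "T.walls y z = path_edges p"
        using T.distinct_path[OF yz] by metis
      have "set p \<subseteq> ?C"
      proof
        fix v assume v: "v \<in> set p"
        have vV: "v \<in> V" using v p(1) by (auto simp: edge_path_def)
        obtain r s where rs: "p = r @ v # s" using v by (meson split_list)
        have ep: "edge_path V E (r @ [v])"
          using p(1) rs edge_path_append[of "r @ [v]" s V E] by (cases "s = []") auto
        have "hd (r @ [v]) = y" using p(2) rs by (cases r) auto
        then have "T.walls y v = path_edges (r @ [v])"
          using T.walls_path[OF ep] p(4) rs by auto
        also have "\<dots> \<subseteq> path_edges p"
          using rs path_edges_append[of "r @ [v]" s] by (cases "s = []") auto
        finally have "T.walls y v \<inter> Orb = {}" using d p(5) by blast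
        then have "cls y = cls v" using cls_eq_iff[OF yz(1) vV] by simp
        then show "v \<in> ?C" using \<open>cls x = cls y\<close> cls_self[OF vV] by simp
      qed
      moreover have "successively (\<lambda>u v. {u, v} \<in> ?D) p"
      proof -
        have "{p ! i, p ! Suc i} \<in> ?D" if "Suc i < length p" for i
        proof -
          have "p ! i \<in> set p" "p ! Suc i \<in> set p" using that by auto
          then have "{p ! i, p ! Suc i} \<subseteq> ?C" using \<open>set p \<subseteq> ?C\<close> by blast
          moreover have "{p ! i, p ! Suc i} \<in> E"
            using path_edges_nth[OF that] path_edges_subset[OF p(1)] by blast
          ultimately show ?thesis by blast
        qed
        then show ?thesis by (simp add: successively_conv_nth)
      qed
      ultimately have "edge_path ?C ?D p" using p(1) by (simp add: edge_path_def)
      then show "\<exists>p. edge_path ?C ?D p \<and> hd p = y \<and> last p = z" using p by blast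
    qed
    show "\<exists>\<sigma>. is_cut ?D e \<sigma>" if "e \<in> ?D" for e
    proof -
      have "is_cut ?D e (T.cut e)" using T.is_cut_cut[of e] that by (simp add: is_cut_def)
      then show ?thesis by (rule exI[of "is_cut _ e"])
    qed
  qed
  moreover have "(\<lambda>e. \<phi> g ` e) ` ?D = ?D" if g: "g \<in> carrier G" for g
  proof -
    have sub: "\<phi> g ` e \<in> ?D" if "g \<in> carrier G" "e \<in> ?D" for g e
      using edge_closed[OF that(1)] inv[OF that(1)] that(2) by blast
    show ?thesis
    proof
      show "(\<lambda>e. \<phi> g ` e) ` ?D \<subseteq> ?D" using sub g by blast
      show "?D \<subseteq> (\<lambda>e. \<phi> g ` e) ` ?D"
      proof
        fix e assume e: "e \<in> ?D"
        then have "e = \<phi> g ` \<phi> (inv g) ` e"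
          using act_image_mult[OF g inv_closed[OF g], of e] act_image_one[of e] g by simp
        then show "e \<in> (\<lambda>e. \<phi> g ` e) ` ?D" using sub[OF inv_closed[OF g] e] by blast
      qed
    qed
  qed
  ultimately have VC: "?C = V"
    using min[unfolded minimal_action_def, THEN spec, THEN spec, of ?C ?D] CV inv by simp
  obtain a b where ab: "e0 = {a, b}" "a \<in> V" "b \<in> V" using T.edge_obtain[OF e0] by metis
  have "\<phi> \<one> ` e0 = e0" by (rule act_image_one[OF e0])
  then have Orb: "{a, b} \<in> Orb" unfolding Orb_def ab(1)[symmetric] by (metis (mono_tags, lifting) mem_Collect_eq one_closed)
  have "y \<in> cls x" if "y \<in> V" for y using that by (simp only: VC)
  then have "cls a = cls x" "cls b = cls x"
    using cls_eq_iff[OF x ab(2)] cls_eq_iff[OF x ab(3)] ab(2,3) unfolding cls_def by blast+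
  then show False using edge_cls_neq[OF Orb] by simp
qed

end

section \<open>Actions dominating a minimal action\<close>

context tree_morphism
begin

text \<open>The image of \<open>f\<close> is an invariant subtree, as cuts of \<open>T\<close>
  restrict to it. Minimality then makes \<open>f\<close> surjective on vertices and edges.\<close>

lemma minimal_imp_dominates:
  assumes min: "minimal_action G V E \<phi>"
  shows "dominates G V' E' \<phi>' V E \<phi>"
proof -
  let ?W = "f ` V'" and ?D = "(\<lambda>e. f ` e) ` E'"
  have WV: "?W \<subseteq> V" and DE: "?D \<subseteq> E" using f_V f_E by auto
  have simp: "simplicial_graph ?W ?D"
  proof -
    have "f ` e \<subseteq> ?W \<and> card (f ` e) = 2" if "e \<in> E'" for e
      using f_E[OF that] T.T.simplicial T'.T.edge_subset[OF that] by (auto simp: simplicial_graph_def)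
    then show ?thesis by (auto simp: simplicial_graph_def)
  qed
  have "is_tree ?W ?D"
  proof (rule cuts_imp_tree[OF _ simp])
    show "?W \<noteq> {}" using T'.tree by (auto simp: is_tree_def)
    have "(f x, f y) \<in> (adjacency ?D)\<^sup>*" if "(x, y) \<in> (adjacency E')\<^sup>*" for x y
      using that
    proof induction
      case (step y z)
      then have "{f y, f z} \<in> ?D" by (intro image_eqI[of _ _ "{y, z}"]) auto
      then show ?case using step.IH by (auto intro: rtrancl_into_rtrancl)
    qed simp
    then show "graph_connected ?W ?D"
      unfolding graph_connected_iff[OF simp] using T'.T.rtrancl_adjacency by blast
    show "\<exists>\<sigma>. is_cut ?D e \<sigma>" if "e \<in> ?D" for e
    proof -
      have "is_cut ?D e (T.T.cut e)" using T.T.is_cut_cut[of e] that DE unfolding is_cut_def by blast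
      then show ?thesis by (rule exI[of "is_cut _ e"])
    qed
  qed
  moreover have "\<phi> g ` ?W = ?W \<and> (\<lambda>e. \<phi> g ` e) ` ?D = ?D" if g: "g \<in> carrier G" for g
  proof
    have "\<phi> g ` ?W = f ` \<phi>' g ` V'" using f_equiv[OF g] by (force simp: image_image)
    then show "\<phi> g ` ?W = ?W" using T'.surj_prop[OF g] by simp
    have e: "\<phi> g ` f ` e = f ` \<phi>' g ` e" if "e \<in> E'" "g \<in> carrier G" for e g
      using image_act[OF that(2,1)] by simp
    show "(\<lambda>e. \<phi> g ` e) ` ?D = ?D"
    proof
      show "(\<lambda>e. \<phi> g ` e) ` ?D \<subseteq> ?D" using e g T'.edge_closed[OF g] by auto
      show "?D \<subseteq> (\<lambda>e. \<phi> g ` e) ` ?D"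
      proof
        fix d assume "d \<in> ?D"
        then obtain q where q: "q \<in> E'" "d = f ` q" by blast
        define r where "r = \<phi>' (inv g) ` q"
        have r: "r \<in> E'" using T'.edge_closed[of "inv g" q] q(1) g by (simp add: r_def)
        have "\<phi>' g ` r = q"
          unfolding r_def
          using T'.act_image_mult[of g "inv g" q] T'.act_image_one[OF q(1)] g q(1) by simp
        then have "d = \<phi> g ` f ` r" using e[OF r g] q(2) by simp
        then show "d \<in> (\<lambda>e. \<phi> g ` e) ` ?D" using r by blast
      qed
    qed
  qed
  ultimately have "?W = V" "?D = E"
    using min[unfolded minimal_action_def, THEN spec, THEN spec, of ?W ?D] WV DE by auto
  then show ?thesis unfolding dominates_def using f_equiv by blast
qed

text \<open>The tree \<open>V0\<close>, \<open>E0\<close> may differ from the target of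
  \<open>f\<close>: after collapsing, non-elementarity is known for the original tree only. An
  invariant line upstairs would make \<open>G\<close> virtually cyclic and hence this action
  elementary.\<close>

lemma bound_imp_nonelem_fh_acyl_splitting:
  assumes N: "fixed_edges_bound G E' \<phi>' N" and bfs: "bounded_finite_subgroups G"
    and nofix: "\<not> (\<exists>v\<in>V. \<forall>g\<in>carrier G. \<phi> g v = v)"
    and T0: "tree_action G V0 E0 \<phi>0" "non_elementary G V0 E0 \<phi>0"
  shows "nonelem_fh_acyl_splitting G V' E' \<phi>'"
proof -
  have acyl: "acylindrical G V' E' \<phi>'"
    by (rule T'.fixed_edges_bound_imp_acylindrical[OF N bfs])
  have nofix': "\<not> (\<exists>v\<in>V'. \<forall>g\<in>carrier G. \<phi>' g v = v)"
    using nofix f_V f_equiv by metis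
  have "\<not> (bi_infinite_geodesic V' E' \<gamma> \<and> (\<forall>g\<in>carrier G. \<phi>' g ` range \<gamma> = range \<gamma>))" for \<gamma>
    using T'.invariant_line_imp_virtually_cyclic[OF acyl nofix', of \<gamma>]
      tree_action.virtually_cyclic_imp_elementary[OF T0(1)] T0(2) by blast
  then have "non_elementary G V' E' \<phi>'" using nofix' by (auto simp: non_elementary_def)
  then show ?thesis
    using acyl T'.fixed_edges_bound_imp_finite_height[OF N] T'.tree_action_axioms
    by (simp add: nonelem_fh_acyl_splitting_def finite_height_splitting_def)
qed

end

theorem theorem1p4:
  fixes G :: "('g, 'b) monoid_scheme"
    and V :: "'v set" and E :: "'v set set" and \<phi> :: "'g \<Rightarrow> 'v \<Rightarrow> 'v"
  assumes "finitely_presented G"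
    and "bounded_finite_subgroups G"
    and "tree_action G V E \<phi>"
    and "minimal_action G V E \<phi>"
    and "acylindrical G V E \<phi>"
    and "non_elementary G V E \<phi>"
  shows
    "((\<forall>v\<in>V. locally_finite_height (G\<lparr>carrier := vertex_stab G \<phi> v\<rparr>)) \<longrightarrow>
        (\<exists>(V' :: nat set) E' \<phi>'.
           nonelem_fh_acyl_splitting G V' E' \<phi>' \<and> fg_edge_stabs G E' \<phi>' \<and>
           dominates G V' E' \<phi>' V E \<phi>) \<and>
        (finite_height_imp_quasi_convex \<and> hyperbolic_group G \<longrightarrow>
          (\<exists>(V' :: nat set) E' \<phi>'.
             quasi_convex_splitting G V' E' \<phi>' \<and> dominates G V' E' \<phi>' V E \<phi>)))
     \<and>
     ((\<exists>e\<in>E. finite_height G (edge_stab G \<phi> e) \<and>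
              locally_finite_height (G\<lparr>carrier := edge_stab G \<phi> e\<rparr>)) \<longrightarrow>
        (\<exists>(V' :: nat set) E' \<phi>'.
           nonelem_fh_acyl_splitting G V' E' \<phi>' \<and> fg_edge_stabs G E' \<phi>'))
     \<and>
     ((\<forall>e\<in>E. finite_height G (edge_stab G \<phi> e) \<and>
              locally_finite_height (G\<lparr>carrier := edge_stab G \<phi> e\<rparr>)) \<longrightarrow>
        (\<exists>(V' :: nat set) E' \<phi>'.
           nonelem_fh_acyl_splitting G V' E' \<phi>' \<and> fg_edge_stabs G E' \<phi>' \<and>
           dominates G V' E' \<phi>' V E \<phi>) \<and>
        (finite_height_imp_quasi_convex \<and> hyperbolic_group G \<longrightarrow>
          (\<exists>(V' :: nat set) E' \<phi>'.
             quasi_convex_splitting G V' E' \<phi>' \<and> dominates G V' E' \<phi>' V E \<phi>)))"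
proof -
  interpret A: tree_action G V E \<phi> by fact
  have cnt: "countable (carrier G)" by (rule A.finitely_presented_simply_connected(2)[OF assms(1)])
  obtain V' :: "nat set" and E' \<phi>' f R where "tree_morphism G V' E' \<phi>' V E \<phi> f R"
    using A.exists_dunwoody_resolution[OF assms(1)] by blast
  then interpret M: tree_morphism G V' E' \<phi>' V E \<phi> f R .
  have nofix: "\<not> (\<exists>v\<in>V. \<forall>g\<in>carrier G. \<phi> g v = v)"
    using assms(6) by (simp add: non_elementary_def)
  have dom: "dominates G V' E' \<phi>' V E \<phi>" by (rule M.minimal_imp_dominates[OF assms(4)])
  have split: "nonelem_fh_acyl_splitting G V' E' \<phi>'" if "\<exists>N. fixed_edges_bound G E' \<phi>' N"
    using M.bound_imp_nonelem_fh_acyl_splitting[OF _ assms(2) nofix assms(3,6)] that by blast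
  have qc: "quasi_convex_splitting G V' E' \<phi>'"
    if "nonelem_fh_acyl_splitting G V' E' \<phi>'" "finite_height_imp_quasi_convex" "hyperbolic_group G"
    using that(1) M.fg finite_height_quasi_convex[OF that(2,3) cnt]
    by (simp add: quasi_convex_splitting_def nonelem_fh_acyl_splitting_def
        finite_height_splitting_def fg_edge_stabs_def)
  have a: "\<exists>N. fixed_edges_bound G E' \<phi>' N"
    if "\<forall>v\<in>V. locally_finite_height (G\<lparr>carrier := vertex_stab G \<phi> v\<rparr>)"
    using M.exists_bound_vertices[OF _ assms(5)] that by blast
  have b: "\<exists>N. fixed_edges_bound G E' \<phi>' N"
    if "\<forall>e\<in>E. finite_height G (edge_stab G \<phi> e) \<and>
              locally_finite_height (G\<lparr>carrier := edge_stab G \<phi> e\<rparr>)"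
  proof (rule M.exists_bound_edges, rule bexI[OF _ A.one_closed])
    fix e assume "e \<in> E"
    then show "finite_height G (edge_stab G \<phi> (\<phi> \<one>\<^bsub>G\<^esub> ` e)) \<and>
        locally_finite_height (G\<lparr>carrier := edge_stab G \<phi> (\<phi> \<one>\<^bsub>G\<^esub> ` e)\<rparr>)"
      using that A.act_image_one by simp
  qed
  \<comment> \<open>With one controlled orbit the resolution is formed over the collapsed tree. It
    maps to that tree and not to \<open>T\<close>, so domination is not asserted.\<close>
  have c: "\<exists>(V1 :: nat set) E1 \<phi>1. nonelem_fh_acyl_splitting G V1 E1 \<phi>1 \<and> fg_edge_stabs G E1 \<phi>1"
    if e0: "e0 \<in> E" "finite_height G (edge_stab G \<phi> e0)"
      "locally_finite_height (G\<lparr>carrier := edge_stab G \<phi> e0\<rparr>)" for e0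
  proof -
    interpret C: collapse G V E \<phi> e0 by standard (rule e0)
    interpret C1: tree_action G C.V1 C.E1 C.act1 by (rule C.tree_action_collapse)
    obtain V1 :: "nat set" and E1 \<phi>1 f1 R1 where "tree_morphism G V1 E1 \<phi>1 C.V1 C.E1 C.act1 f1 R1"
      using C1.exists_dunwoody_resolution[OF assms(1)] by blast
    then interpret M1: tree_morphism G V1 E1 \<phi>1 C.V1 C.E1 C.act1 f1 R1 .
    have "\<exists>N. fixed_edges_bound G E1 \<phi>1 N"
    proof (rule M1.exists_bound_edges)
      fix e assume "e \<in> C.E1"
      then obtain a b where ab: "e = {C.cls a, C.cls b}" "{a, b} \<in> C.Orb" by (auto simp: C.E1_def)
      \<comment> \<open>Translating back by the inverse of \<open>g\<close> turns the stabiliser of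
        the collapsed edge into exactly that of \<open>e0\<close>.\<close>
      obtain g where g: "g \<in> carrier G" "{a, b} = \<phi> g ` e0" using ab(2) by (auto simp: C.Orb_def)
      have V: "a \<in> V" "b \<in> V" using C.Orb_V[OF ab(2)] by auto
      have ig: "inv\<^bsub>G\<^esub> g \<in> carrier G" using g by simp
      let ?a = "\<phi> (inv\<^bsub>G\<^esub> g) a" and ?b = "\<phi> (inv\<^bsub>G\<^esub> g) b"
      have "C.act1 (inv\<^bsub>G\<^esub> g) ` e = {C.cls ?a, C.cls ?b}"
        unfolding ab(1) using C.act1_cls[OF ig] V by simp
      then have "edge_stab G C.act1 (C.act1 (inv\<^bsub>G\<^esub> g) ` e) = edge_stab G \<phi> {?a, ?b}"
        using C.edge_stab_collapse[OF C.Orb_act[OF ig ab(2)]] by simp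
      also have "{?a, ?b} = \<phi> (inv\<^bsub>G\<^esub> g) ` \<phi> g ` e0" unfolding g(2)[symmetric] by simp
      also have "\<dots> = e0"
        using A.act_image_mult[OF ig g(1) e0(1)] A.act_image_one[OF e0(1)] g(1) by simp
      finally show "\<exists>h\<in>carrier G. finite_height G (edge_stab G C.act1 (C.act1 h ` e)) \<and>
          locally_finite_height (G\<lparr>carrier := edge_stab G C.act1 (C.act1 h ` e)\<rparr>)"
        using ig e0 by (intro bexI[of _ "inv\<^bsub>G\<^esub> g"]) simp_all
    qed
    then have "nonelem_fh_acyl_splitting G V1 E1 \<phi>1"
      using M1.bound_imp_nonelem_fh_acyl_splitting[OF _ assms(2)
          C.collapse_no_fixed_vertex[OF assms(4)] assms(3,6)] by blast
    then show ?thesis using M1.fg by blast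
  qed
  show ?thesis
    using dom split qc a b c M.fg by blast
qed

end
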